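(* Let $\mathbb T$ be a Lawvere 2-theory whose underlying Lawvere theory $\mathbb T_0$ is the free Lawvere theory $F\Omega$ on a signature $\Omega$, and let $U:\mathrm{Mod}(\mathbb T)_o\to\mathrm{Mod}(\Omega)_o$ be the forgetful 2-functor to $\Omega$-algebras in $\mathrm{Cat}$. Let $X$ and $Y$ be $\mathbb T$-algebra structures on a category $A$ and let $k:X\rightsquigarrow Y$ be an oplax morphism over the identity on $A$. Suppose that $A$ has an orthogonal factorisation system $(\mathcal E,\mathcal M)$ and that, for each $n$ and each $f\in\Omega(n)\subseteq\mathbb T(n,1)$, the functor $X(f):A^n\to A$ preserves pointwise $\mathcal E$'s and the functor $Y(f):A^n\to A$ preserves pointwise $\mathcal M$'s. For each $f\in\Omega(n)$ factor the natural transformation $k(f):X(f)\Rightarrow Y(f)$ in $[A^n,A]$ as $$X(f)\overset{e(f)}{\Longrightarrow}Z(f)\overset{m(f)}{\Longrightarrow}Y(f)$$ with $e(f)$ pointwise in $\mathcal E$ and $m(f)$ pointwise in $\mathcal M$. The functors $Z(f)$ make $A$ into an $\Omega$-algebra $Z$, and the $e(f)$ and $m(f)$ give oplax $\Omega$-algebra morphisms $e:UX\to Z$ and $m:Z\to UY$ with underlying functor $1_A$. Then $Z$, $e$ and $m$ lift uniquely along $U$: there is a unique triple consisting of a $\mathbb T$-algebra structure $\tilde Z$ on $A$ and oplax $\mathbb T$-algebra morphisms $\tilde e:X\rightsquigarrow\tilde Z$, $\tilde m:\tilde Z\rightsquigarrow Y$ over the identity on $A$ such that $U\tilde Z=Z$,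 $U\tilde e=e$ and $U\tilde m=m$.
   Context: $\mathbb F$ is the skeleton of the category of finite sets with objects $[n]=\{1,\dots,n\}$. A Lawvere theory is a category $\mathbb T$ with an identity-on-objects functor $\mathbb F^{op}\to\mathbb T$ preserving finite powers of $1$. A Lawvere 2-theory is a 2-category $\mathbb T$ with an identity-on-objects 2-functor $\mathbb F^{op}\to\mathbb T$ ($\mathbb F^{op}$ viewed as a locally discrete 2-category) preserving finite powers of $1$, where powers (products) in a 2-category are in the enriched sense: $\mathbb T(x,\prod_i a_i)\cong\prod_i\mathbb T(x,a_i)$ as categories. Its underlying category $\mathbb T_0$ is a Lawvere theory, called the underlying Lawvere theory. A signature $\Omega$ is a family of sets $\Omega(n)$, $n\in\mathbb N$. The free Lawvere theory $F\Omega$ has $F\Omega(n,m)=F\Omega(n,1)^m$, where $F\Omega(n,1)$ is the set of $\Omega$-terms in variables $x_1,\dots,x_n$ (built inductively from the variables by applying operations $f\in\Omega(k)$ to $k$ terms), with composition by substitution and $x_i:n\to1$ the $i$-th projection. One identifies $f\in\Omega(n)$ with the term $f(x_1,\dots,x_n)\in F\Omega(n,1)$. Let $\mathrm{Cat}$ be the 2-category of small categories with its specified finite powers $A^n$. A model ($\mathbb T$-algebra) is a 2-functor $X:\mathbb T\to\mathrm{Cat}$ strictly preserving finite powers of $1$; it is a $\mathbb T$-algebra structure on $A$ if $X(1)=A$. An oplax transformation $\alpha:F\Rightarrow G$ of 2-functors consists of 1-cells $\alpha_a:Fa\to Ga$ and 2-cells $\alpha_f:\alpha_b\,Ff\Rightarrow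 Gf\,\alpha_a$ for $f:a\to b$, with $\alpha_{\mathrm{id}}$ an identity, $(G\tau*1)\alpha_f=\alpha_{f'}(1*F\tau)$ for $\tau:f\Rightarrow f'$, and $\alpha_{gf}=(1*\alpha_f)(\alpha_g*1)$. An oplax morphism $k:X\rightsquigarrow Y$ of $\mathbb T$-algebras is an oplax transformation $X\Rightarrow Y$ whose restriction along $\mathbb F^{op}\to\mathbb T$ is 2-natural; then $k(n)=k(1)^n$ and $k$ is determined by $k(1)$ and 2-cells $k(t):k(1)\circ X(t)\Rightarrow Y(t)\circ k(1)^n$ for $t\in\mathbb T(n,1)$. If $X(1)=Y(1)=A$, $k$ is over the identity on $A$ if $k(1)=1_A$. With models, oplax morphisms and modifications one obtains the 2-category $\mathrm{Mod}(\mathbb T)_o=\mathrm{Mod}(\mathbb T,\mathrm{Cat})_o$. An $\Omega$-algebra in $\mathrm{Cat}$ is a category $A$ with a functor $f^A:A^n\to A$ for each $f\in\Omega(n)$; an oplax morphism of $\Omega$-algebras $A\to B$ is a functor $k:A\to B$ with a natural transformation $k(f):k\circ f^A\Rightarrow f^B\circ k^n$ for each $f\in\Omega(n)$, subject to no axioms. With the evident 2-cells these form a 2-category $\mathrm{Mod}(\Omega)_o$, and $\mathrm{Mod}(F\Omega)_o\cong\mathrm{Mod}(\Omega)_o$ (where $F\Omega$ is viewed as a 2-theory with only identity 2-cells). $U$ restricts models and oplax morphisms along $F\Omega=\mathbb T_0\hookrightarrow\mathbb T$ and then applies this isomorphism; so $UX$ is $X(1)$ with operations $X(f)$, and $Uk$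 is $k(1)$ with 2-cells $k(f)$, for $f\in\Omega(n)$. Write $e\perp m$ in a category if every commutative square $mu=ve$ has a unique $d$ with $de=u$, $md=v$. An orthogonal factorisation system $(\mathcal E,\mathcal M)$ on $A$ is a pair of classes of maps such that every morphism factors as an $\mathcal E$-map followed by an $\mathcal M$-map, $\mathcal E=\{f: f\perp m\ \forall m\in\mathcal M\}$ and $\mathcal M=\{g: e\perp g\ \forall e\in\mathcal E\}$. A natural transformation into $A$ (or $A^n$) is pointwise in $\mathcal E$ if each component (each coordinate of each component) is in $\mathcal E$. A functor $H:A^n\to A$ preserves pointwise $\mathcal E$'s if $H(g_1,\dots,g_n)\in\mathcal E$ whenever all $g_i\in\mathcal E$; similarly for $\mathcal M$. *)

theory Defs
  imports Main "HOL-Library.FuncSet"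
begin

section \<open>Categories, functors and natural transformations\<close>

text \<open>\<^term>\<open>Comp C g f\<close> is the composite of \<^term>\<open>f\<close> followed by \<^term>\<open>g\<close>.  The operations are
  unconstrained outside the carriers.\<close>

record ('o, 'm) cat =
  Obj :: "'o set"
  Arr :: "'m set"
  Dom :: "'m \<Rightarrow> 'o"
  Cod :: "'m \<Rightarrow> 'o"
  Id :: "'o \<Rightarrow> 'm"
  Comp :: "'m \<Rightarrow> 'm \<Rightarrow> 'm"

locale category =
  fixes C :: "('o, 'm, 'z) cat_scheme"
  assumes Dom_in [simp]: "f \<in> Arr C \<Longrightarrow> Dom C f \<in> Obj C"
    and Cod_in [simp]: "f \<in> Arr C \<Longrightarrow> Cod C f \<in> Obj C"
    and Id_in [simp]: "a \<in> Obj C \<Longrightarrow> Id C a \<in> Arr C"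
    and Dom_Id [simp]: "a \<in> Obj C \<Longrightarrow> Dom C (Id C a) = a"
    and Cod_Id [simp]: "a \<in> Obj C \<Longrightarrow> Cod C (Id C a) = a"
    and Comp_in [simp]:
      "\<lbrakk>f \<in> Arr C; g \<in> Arr C; Dom C g = Cod C f\<rbrakk> \<Longrightarrow> Comp C g f \<in> Arr C"
    and Dom_Comp [simp]:
      "\<lbrakk>f \<in> Arr C; g \<in> Arr C; Dom C g = Cod C f\<rbrakk> \<Longrightarrow> Dom C (Comp C g f) = Dom C f"
    and Cod_Comp [simp]:
      "\<lbrakk>f \<in> Arr C; g \<in> Arr C; Dom C g = Cod C f\<rbrakk> \<Longrightarrow> Cod C (Comp C g f) = Cod C g"
    and Comp_Id_right [simp]: "f \<in> Arr C \<Longrightarrow> Comp C f (Id C (Dom C f)) = f"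
    and Comp_Id_left [simp]: "f \<in> Arr C \<Longrightarrow> Comp C (Id C (Cod C f)) f = f"
    and Comp_assoc:
      "\<lbrakk>f \<in> Arr C; g \<in> Arr C; h \<in> Arr C; Dom C g = Cod C f; Dom C h = Cod C g\<rbrakk>
        \<Longrightarrow> Comp C h (Comp C g f) = Comp C (Comp C h g) f"

definition op_cat :: "('o, 'm) cat \<Rightarrow> ('o, 'm) cat" where
  "op_cat C = \<lparr>Obj = Obj C, Arr = Arr C, Dom = Cod C, Cod = Dom C, Id = Id C,
    Comp = (\<lambda>g f. Comp C f g)\<rparr>"

text \<open>The power of a category: objects and arrows are lists of length \<^term>\<open>n\<close>.\<close>

definition pow_cat :: "('o, 'm) cat \<Rightarrow> nat \<Rightarrow> ('o list, 'm list) cat" where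
  "pow_cat C n =
    \<lparr>Obj = {xs. length xs = n \<and> set xs \<subseteq> Obj C},
     Arr = {fs. length fs = n \<and> set fs \<subseteq> Arr C},
     Dom = map (Dom C), Cod = map (Cod C), Id = map (Id C), Comp = map2 (Comp C)\<rparr>"

text \<open>Functors and natural transformations carry their domain and codomain, and their maps are
  extensional, so that equality in HOL is equality of functors and of natural transformations.\<close>

record ('o1, 'm1, 'o2, 'm2) ftor =
  FDom :: "('o1, 'm1) cat"
  FCod :: "('o2, 'm2) cat"
  FObj :: "'o1 \<Rightarrow> 'o2"
  FArr :: "'m1 \<Rightarrow> 'm2"

locale cat_functor =
  fixes F :: "('o1, 'm1, 'o2, 'm2) ftor"
  assumes category_FDom: "category (FDom F)"
    and category_FCod: "category (FCod F)"
    and FObj_PiE: "FObj F \<in> Obj (FDom F) \<rightarrow>\<^sub>E Obj (FCod F)"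
    and FArr_PiE: "FArr F \<in> Arr (FDom F) \<rightarrow>\<^sub>E Arr (FCod F)"
    and Dom_FArr: "f \<in> Arr (FDom F) \<Longrightarrow> Dom (FCod F) (FArr F f) = FObj F (Dom (FDom F) f)"
    and Cod_FArr: "f \<in> Arr (FDom F) \<Longrightarrow> Cod (FCod F) (FArr F f) = FObj F (Cod (FDom F) f)"
    and FArr_Id: "a \<in> Obj (FDom F) \<Longrightarrow> FArr F (Id (FDom F) a) = Id (FCod F) (FObj F a)"
    and FArr_Comp:
      "\<lbrakk>f \<in> Arr (FDom F); g \<in> Arr (FDom F); Dom (FDom F) g = Cod (FDom F) f\<rbrakk>
        \<Longrightarrow> FArr F (Comp (FDom F) g f) = Comp (FCod F) (FArr F g) (FArr F f)"

definition iso_functor :: "('o1, 'm1, 'o2, 'm2) ftor \<Rightarrow> bool" where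
  "iso_functor F \<longleftrightarrow> cat_functor F
    \<and> bij_betw (FObj F) (Obj (FDom F)) (Obj (FCod F))
    \<and> bij_betw (FArr F) (Arr (FDom F)) (Arr (FCod F))"

definition id_ftor :: "('o, 'm) cat \<Rightarrow> ('o, 'm, 'o, 'm) ftor" where
  "id_ftor C = \<lparr>FDom = C, FCod = C, FObj = restrict (\<lambda>x. x) (Obj C), FArr = restrict (\<lambda>f. f) (Arr C)\<rparr>"

definition comp_ftor ::
  "('o2, 'm2, 'o3, 'm3) ftor \<Rightarrow> ('o1, 'm1, 'o2, 'm2) ftor \<Rightarrow> ('o1, 'm1, 'o3, 'm3) ftor" where
  "comp_ftor G F =
    \<lparr>FDom = FDom F, FCod = FCod G,
     FObj = restrict (\<lambda>x. FObj G (FObj F x)) (Obj (FDom F)),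
     FArr = restrict (\<lambda>f. FArr G (FArr F f)) (Arr (FDom F))\<rparr>"

definition pow_ftor ::
  "('o1, 'm1, 'o2, 'm2) ftor \<Rightarrow> nat \<Rightarrow> ('o1 list, 'm1 list, 'o2 list, 'm2 list) ftor" where
  "pow_ftor F n =
    \<lparr>FDom = pow_cat (FDom F) n, FCod = pow_cat (FCod F) n,
     FObj = restrict (map (FObj F)) (Obj (pow_cat (FDom F) n)),
     FArr = restrict (map (FArr F)) (Arr (pow_cat (FDom F) n))\<rparr>"

definition proj_ftor :: "('o, 'm) cat \<Rightarrow> nat \<Rightarrow> nat \<Rightarrow> ('o list, 'm list, 'o, 'm) ftor" where
  "proj_ftor C n i =
    \<lparr>FDom = pow_cat C n, FCod = C,
     FObj = restrict (\<lambda>xs. xs ! i) (Obj (pow_cat C n)),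
     FArr = restrict (\<lambda>fs. fs ! i) (Arr (pow_cat C n))\<rparr>"

text \<open>The identification of \<^term>\<open>C\<close> with its first power; its inverse is \<^term>\<open>proj_ftor C 1 0\<close>.\<close>

definition unary_ftor :: "('o, 'm) cat \<Rightarrow> ('o, 'm, 'o list, 'm list) ftor" where
  "unary_ftor C =
    \<lparr>FDom = C, FCod = pow_cat C 1,
     FObj = restrict (\<lambda>x. [x]) (Obj C), FArr = restrict (\<lambda>f. [f]) (Arr C)\<rparr>"

record ('o1, 'm1, 'o2, 'm2) ntrans =
  NDom :: "('o1, 'm1, 'o2, 'm2) ftor"
  NCod :: "('o1, 'm1, 'o2, 'm2) ftor"
  NAt :: "'o1 \<Rightarrow> 'm2"

locale nat_transf =
  fixes \<alpha> :: "('o1, 'm1, 'o2, 'm2) ntrans"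
  assumes functor_NDom: "cat_functor (NDom \<alpha>)"
    and functor_NCod: "cat_functor (NCod \<alpha>)"
    and FDom_eq: "FDom (NCod \<alpha>) = FDom (NDom \<alpha>)"
    and FCod_eq: "FCod (NCod \<alpha>) = FCod (NDom \<alpha>)"
    and NAt_PiE: "NAt \<alpha> \<in> Obj (FDom (NDom \<alpha>)) \<rightarrow>\<^sub>E Arr (FCod (NDom \<alpha>))"
    and Dom_NAt: "x \<in> Obj (FDom (NDom \<alpha>)) \<Longrightarrow> Dom (FCod (NDom \<alpha>)) (NAt \<alpha> x) = FObj (NDom \<alpha>) x"
    and Cod_NAt: "x \<in> Obj (FDom (NDom \<alpha>)) \<Longrightarrow> Cod (FCod (NDom \<alpha>)) (NAt \<alpha> x) = FObj (NCod \<alpha>) x"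
    and naturality:
      "f \<in> Arr (FDom (NDom \<alpha>)) \<Longrightarrow>
        Comp (FCod (NDom \<alpha>)) (NAt \<alpha> (Cod (FDom (NDom \<alpha>)) f)) (FArr (NDom \<alpha>) f)
        = Comp (FCod (NDom \<alpha>)) (FArr (NCod \<alpha>) f) (NAt \<alpha> (Dom (FDom (NDom \<alpha>)) f))"

definition id_ntrans :: "('o1, 'm1, 'o2, 'm2) ftor \<Rightarrow> ('o1, 'm1, 'o2, 'm2) ntrans" where
  "id_ntrans F =
    \<lparr>NDom = F, NCod = F, NAt = restrict (\<lambda>x. Id (FCod F) (FObj F x)) (Obj (FDom F))\<rparr>"

definition vcomp_ntrans ::
  "('o1, 'm1, 'o2, 'm2) ntrans \<Rightarrow> ('o1, 'm1, 'o2, 'm2) ntrans \<Rightarrow> ('o1, 'm1, 'o2, 'm2) ntrans" where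
  "vcomp_ntrans \<beta> \<alpha> =
    \<lparr>NDom = NDom \<alpha>, NCod = NCod \<beta>,
     NAt = restrict (\<lambda>x. Comp (FCod (NDom \<alpha>)) (NAt \<beta> x) (NAt \<alpha> x)) (Obj (FDom (NDom \<alpha>)))\<rparr>"

definition hcomp_ntrans ::
  "('o2, 'm2, 'o3, 'm3) ntrans \<Rightarrow> ('o1, 'm1, 'o2, 'm2) ntrans \<Rightarrow> ('o1, 'm1, 'o3, 'm3) ntrans" where
  "hcomp_ntrans \<beta> \<alpha> =
    \<lparr>NDom = comp_ftor (NDom \<beta>) (NDom \<alpha>), NCod = comp_ftor (NCod \<beta>) (NCod \<alpha>),
     NAt = restrict
       (\<lambda>x. Comp (FCod (NDom \<beta>)) (FArr (NCod \<beta>) (NAt \<alpha> x)) (NAt \<beta> (FObj (NDom \<alpha>) x)))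
       (Obj (FDom (NDom \<alpha>)))\<rparr>"


section \<open>2-categories\<close>

text \<open>The inherited fields are the objects and 1-cells.\<close>

record ('o, 'a, 'c) two_cat = "('o, 'a) cat" +
  Cell :: "'c set"
  Dom2 :: "'c \<Rightarrow> 'a"
  Cod2 :: "'c \<Rightarrow> 'a"
  Id2 :: "'a \<Rightarrow> 'c"
  VComp :: "'c \<Rightarrow> 'c \<Rightarrow> 'c"
  HComp :: "'c \<Rightarrow> 'c \<Rightarrow> 'c"

definition underlying_cat :: "('o, 'a, 'c) two_cat \<Rightarrow> ('o, 'a) cat" where
  "underlying_cat T = cat.truncate T"

definition vert_cat :: "('o, 'a, 'c) two_cat \<Rightarrow> ('a, 'c) cat" where
  "vert_cat T = \<lparr>Obj = Arr T, Arr = Cell T, Dom = Dom2 T, Cod = Cod2 T, Id = Id2 T, Comp = VComp T\<rparr>"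

definition horiz_cat :: "('o, 'a, 'c) two_cat \<Rightarrow> ('o, 'c) cat" where
  "horiz_cat T =
    \<lparr>Obj = Obj T, Arr = Cell T,
     Dom = (\<lambda>\<tau>. Dom T (Dom2 T \<tau>)), Cod = (\<lambda>\<tau>. Cod T (Dom2 T \<tau>)),
     Id = (\<lambda>a. Id2 T (Id T a)), Comp = HComp T\<rparr>"

definition hom_cat :: "('o, 'a, 'c) two_cat \<Rightarrow> 'o \<Rightarrow> 'o \<Rightarrow> ('a, 'c) cat" where
  "hom_cat T x y =
    \<lparr>Obj = {f \<in> Arr T. Dom T f = x \<and> Cod T f = y},
     Arr = {\<tau> \<in> Cell T. Dom T (Dom2 T \<tau>) = x \<and> Cod T (Dom2 T \<tau>) = y},
     Dom = Dom2 T, Cod = Cod2 T, Id = Id2 T, Comp = VComp T\<rparr>"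

locale two_category =
  fixes T :: "('o, 'a, 'c) two_cat"
  assumes underlying_category: "category (underlying_cat T)"
    and vert_category: "category (vert_cat T)"
    and horiz_category: "category (horiz_cat T)"
    and Dom_Cod2: "\<tau> \<in> Cell T \<Longrightarrow> Dom T (Cod2 T \<tau>) = Dom T (Dom2 T \<tau>)"
    and Cod_Cod2: "\<tau> \<in> Cell T \<Longrightarrow> Cod T (Cod2 T \<tau>) = Cod T (Dom2 T \<tau>)"
    and Dom2_HComp:
      "\<lbrakk>\<sigma> \<in> Cell T; \<tau> \<in> Cell T; Dom T (Dom2 T \<sigma>) = Cod T (Dom2 T \<tau>)\<rbrakk>
        \<Longrightarrow> Dom2 T (HComp T \<sigma> \<tau>) = Comp T (Dom2 T \<sigma>) (Dom2 T \<tau>)"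
    and Cod2_HComp:
      "\<lbrakk>\<sigma> \<in> Cell T; \<tau> \<in> Cell T; Dom T (Dom2 T \<sigma>) = Cod T (Dom2 T \<tau>)\<rbrakk>
        \<Longrightarrow> Cod2 T (HComp T \<sigma> \<tau>) = Comp T (Cod2 T \<sigma>) (Cod2 T \<tau>)"
    and HComp_Id2:
      "\<lbrakk>g \<in> Arr T; f \<in> Arr T; Dom T g = Cod T f\<rbrakk>
        \<Longrightarrow> HComp T (Id2 T g) (Id2 T f) = Id2 T (Comp T g f)"
    and interchange:
      "\<lbrakk>\<sigma> \<in> Cell T; \<sigma>' \<in> Cell T; \<tau> \<in> Cell T; \<tau>' \<in> Cell T;
        Dom2 T \<sigma>' = Cod2 T \<sigma>; Dom2 T \<tau>' = Cod2 T \<tau>; Dom T (Dom2 T \<sigma>) = Cod T (Dom2 T \<tau>)\<rbrakk>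
        \<Longrightarrow> HComp T (VComp T \<sigma>' \<sigma>) (VComp T \<tau>' \<tau>) = VComp T (HComp T \<sigma>' \<tau>') (HComp T \<sigma> \<tau>)"

definition locally_discrete :: "('o, 'm) cat \<Rightarrow> ('o, 'm, 'm) two_cat" where
  "locally_discrete C =
    \<lparr>Obj = Obj C, Arr = Arr C, Dom = Dom C, Cod = Cod C, Id = Id C, Comp = Comp C,
     Cell = Arr C, Dom2 = (\<lambda>f. f), Cod2 = (\<lambda>f. f), Id2 = (\<lambda>f. f),
     VComp = (\<lambda>g f. f), HComp = Comp C\<rparr>"

definition Cat2 ::
  "(('o, 'm) cat, ('o, 'm, 'o, 'm) ftor, ('o, 'm, 'o, 'm) ntrans) two_cat" where
  "Cat2 =
    \<lparr>Obj = {C. category C}, Arr = {F. cat_functor F}, Dom = FDom, Cod = FCod,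
     Id = id_ftor, Comp = comp_ftor,
     Cell = {\<alpha>. nat_transf \<alpha>}, Dom2 = NDom, Cod2 = NCod, Id2 = id_ntrans,
     VComp = vcomp_ntrans, HComp = hcomp_ntrans\<rparr>"

record ('o1, 'a1, 'c1, 'o2, 'a2, 'c2) two_ftor =
  TF0 :: "'o1 \<Rightarrow> 'o2"
  TF1 :: "'a1 \<Rightarrow> 'a2"
  TF2 :: "'c1 \<Rightarrow> 'c2"

definition two_functor ::
  "('o1, 'a1, 'c1) two_cat \<Rightarrow> ('o2, 'a2, 'c2) two_cat \<Rightarrow> ('o1, 'a1, 'c1, 'o2, 'a2, 'c2) two_ftor \<Rightarrow> bool" where
  "two_functor S K F \<longleftrightarrow> two_category S \<and> two_category K
    \<and> cat_functor \<lparr>FDom = underlying_cat S, FCod = underlying_cat K, FObj = TF0 F, FArr = TF1 F\<rparr>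
    \<and> cat_functor \<lparr>FDom = vert_cat S, FCod = vert_cat K, FObj = TF1 F, FArr = TF2 F\<rparr>
    \<and> cat_functor \<lparr>FDom = horiz_cat S, FCod = horiz_cat K, FObj = TF0 F, FArr = TF2 F\<rparr>"

record ('o, 'a, 'a2, 'c2) oplax =
  OAt :: "'o \<Rightarrow> 'a2"
  OCell :: "'a \<Rightarrow> 'c2"

locale oplax_transformation =
  fixes S :: "('o1, 'a1, 'c1) two_cat" and K :: "('o2, 'a2, 'c2) two_cat"
    and F G :: "('o1, 'a1, 'c1, 'o2, 'a2, 'c2) two_ftor"
    and \<alpha> :: "('o1, 'a1, 'a2, 'c2) oplax"
  assumes two_functor_F: "two_functor S K F"
    and two_functor_G: "two_functor S K G"
    and OAt_PiE: "OAt \<alpha> \<in> Obj S \<rightarrow>\<^sub>E Arr K"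
    and Dom_OAt: "a \<in> Obj S \<Longrightarrow> Dom K (OAt \<alpha> a) = TF0 F a"
    and Cod_OAt: "a \<in> Obj S \<Longrightarrow> Cod K (OAt \<alpha> a) = TF0 G a"
    and OCell_PiE: "OCell \<alpha> \<in> Arr S \<rightarrow>\<^sub>E Cell K"
    and Dom2_OCell: "f \<in> Arr S \<Longrightarrow> Dom2 K (OCell \<alpha> f) = Comp K (OAt \<alpha> (Cod S f)) (TF1 F f)"
    and Cod2_OCell: "f \<in> Arr S \<Longrightarrow> Cod2 K (OCell \<alpha> f) = Comp K (TF1 G f) (OAt \<alpha> (Dom S f))"
    and OCell_Id: "a \<in> Obj S \<Longrightarrow> OCell \<alpha> (Id S a) = Id2 K (OAt \<alpha> a)"
    and OCell_natural:
      "\<tau> \<in> Cell S \<Longrightarrow>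
        VComp K (HComp K (TF2 G \<tau>) (Id2 K (OAt \<alpha> (Dom S (Dom2 S \<tau>))))) (OCell \<alpha> (Dom2 S \<tau>))
        = VComp K (OCell \<alpha> (Cod2 S \<tau>)) (HComp K (Id2 K (OAt \<alpha> (Cod S (Dom2 S \<tau>)))) (TF2 F \<tau>))"
    and OCell_Comp:
      "\<lbrakk>f \<in> Arr S; g \<in> Arr S; Dom S g = Cod S f\<rbrakk> \<Longrightarrow>
        OCell \<alpha> (Comp S g f)
        = VComp K (HComp K (Id2 K (TF1 G g)) (OCell \<alpha> f)) (HComp K (OCell \<alpha> g) (Id2 K (TF1 F f)))"

text \<open>\<^term>\<open>p\<close> with the 1-cells \<^term>\<open>\<pi> i\<close> is the enriched \<^term>\<open>n\<close>-th power of \<^term>\<open>a\<close>: composition with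
  the projections is an isomorphism of categories from \<^term>\<open>hom_cat T x p\<close> to the power of
  \<^term>\<open>hom_cat T x a\<close>.\<close>

definition power_comparison ::
  "('o, 'a, 'c) two_cat \<Rightarrow> 'o \<Rightarrow> nat \<Rightarrow> 'o \<Rightarrow> (nat \<Rightarrow> 'a) \<Rightarrow> 'o \<Rightarrow> ('a, 'c, 'a list, 'c list) ftor" where
  "power_comparison T a n p \<pi> x =
    \<lparr>FDom = hom_cat T x p, FCod = pow_cat (hom_cat T x a) n,
     FObj = restrict (\<lambda>f. map (\<lambda>i. Comp T (\<pi> i) f) [0..<n]) (Obj (hom_cat T x p)),
     FArr = restrict (\<lambda>\<tau>. map (\<lambda>i. HComp T (Id2 T (\<pi> i)) \<tau>) [0..<n]) (Arr (hom_cat T x p))\<rparr>"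

definition is_power :: "('o, 'a, 'c) two_cat \<Rightarrow> 'o \<Rightarrow> nat \<Rightarrow> 'o \<Rightarrow> (nat \<Rightarrow> 'a) \<Rightarrow> bool" where
  "is_power T a n p \<pi> \<longleftrightarrow> p \<in> Obj T \<and> (\<forall>i<n. \<pi> i \<in> Arr T \<and> Dom T (\<pi> i) = p \<and> Cod T (\<pi> i) = a)
    \<and> (\<forall>x\<in>Obj T. iso_functor (power_comparison T a n p \<pi> x))"


section \<open>Lawvere 2-theories\<close>

text \<open>In the skeleton of finite sets the object \<^term>\<open>n\<close> stands for the set \<^term>\<open>{..<n}\<close> (the indices are
  shifted by one).  A map from \<^term>\<open>m\<close> to \<^term>\<open>n\<close> is the pair of \<^term>\<open>n\<close> and the list of its
  \<^term>\<open>m\<close> values.\<close>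

definition fin_cat :: "(nat, nat \<times> nat list) cat" where
  "fin_cat =
    \<lparr>Obj = UNIV, Arr = {(n, as). set as \<subseteq> {..<n}},
     Dom = (\<lambda>(n, as). length as), Cod = (\<lambda>(n, as). n), Id = (\<lambda>n. (n, [0..<n])),
     Comp = (\<lambda>(p, bs) (n, as). (p, map (\<lambda>a. bs ! a) as))\<rparr>"

abbreviation fin_op :: "(nat, nat \<times> nat list) cat" where
  "fin_op \<equiv> op_cat fin_cat"

text \<open>The projections from \<^term>\<open>n\<close> to 1 in \<^term>\<open>fin_op\<close>, i.e. the maps from a singleton.\<close>

definition fin_proj :: "nat \<Rightarrow> nat \<Rightarrow> nat \<times> nat list" where
  "fin_proj n i = (n, [i])"

type_synonym ('a, 'c) theory_map = "(nat, nat \<times> nat list, nat \<times> nat list, nat, 'a, 'c) two_ftor"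

definition lawvere_2theory :: "(nat, 'a, 'c) two_cat \<Rightarrow> ('a, 'c) theory_map \<Rightarrow> bool" where
  "lawvere_2theory T J \<longleftrightarrow> two_category T \<and> Obj T = UNIV
    \<and> two_functor (locally_discrete fin_op) T J \<and> (\<forall>n. TF0 J n = n)
    \<and> (\<forall>n. is_power T 1 n n (\<lambda>i. TF1 J (fin_proj n i)))"


section \<open>The free Lawvere theory on a signature\<close>

datatype 'f trm = Var nat | Op 'f "'f trm list"

primrec subst :: "(nat \<Rightarrow> 'f trm) \<Rightarrow> 'f trm \<Rightarrow> 'f trm" where
  "subst \<theta> (Var i) = \<theta> i"
| "subst \<theta> (Op f ts) = Op f (map (subst \<theta>) ts)"

text \<open>A signature is a family of sets, not assumed disjoint: the arity of an occurrence of a symbol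
  in a term is the number of its arguments.\<close>

inductive_set trms :: "(nat \<Rightarrow> 'f set) \<Rightarrow> nat \<Rightarrow> 'f trm set" for \<Omega> :: "nat \<Rightarrow> 'f set" and n :: nat where
  Var: "i < n \<Longrightarrow> Var i \<in> trms \<Omega> n"
| Op: "\<lbrakk>f \<in> \<Omega> (length ts); \<And>t. t \<in> set ts \<Longrightarrow> t \<in> trms \<Omega> n\<rbrakk> \<Longrightarrow> Op f ts \<in> trms \<Omega> n"

definition free_theory :: "(nat \<Rightarrow> 'f set) \<Rightarrow> (nat, nat \<times> 'f trm list) cat" where
  "free_theory \<Omega> =
    \<lparr>Obj = UNIV, Arr = {(n, ts). set ts \<subseteq> trms \<Omega> n},
     Dom = (\<lambda>(n, ts). n), Cod = (\<lambda>(n, ts). length ts), Id = (\<lambda>n. (n, map Var [0..<n])),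
     Comp = (\<lambda>(m, us) (n, ts). (n, map (subst (\<lambda>i. ts ! i)) us))\<rparr>"

text \<open>The underlying Lawvere theory of \<^term>\<open>T\<close> is the free one: \<^term>\<open>I\<close> is an isomorphism of
  Lawvere theories (identity on objects, compatible with the structure maps).\<close>

type_synonym ('f, 'a) free_iso = "(nat, nat \<times> 'f trm list, nat, 'a) ftor"

definition underlying_free ::
  "(nat \<Rightarrow> 'f set) \<Rightarrow> (nat, 'a, 'c) two_cat \<Rightarrow> ('a, 'c) theory_map \<Rightarrow> ('f, 'a) free_iso \<Rightarrow> bool" where
  "underlying_free \<Omega> T J I \<longleftrightarrow> iso_functor I
    \<and> FDom I = free_theory \<Omega> \<and> FCod I = underlying_cat T \<and> (\<forall>n. FObj I n = n)
    \<and> (\<forall>(n, as)\<in>Arr fin_op. FArr I (n, map Var as) = TF1 J (n, as))"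

definition op_cell :: "('f, 'a) free_iso \<Rightarrow> nat \<Rightarrow> 'f \<Rightarrow> 'a" where
  "op_cell I n f = FArr I (n, [Op f (map Var [0..<n])])"


section \<open>Models in Cat and their oplax morphisms\<close>

text \<open>A category \<^term>\<open>A\<close> is identified with its first power \<^term>\<open>pow_cat A 1\<close>, so that all powers of
  \<^term>\<open>A\<close> are objects of one instance of \<^term>\<open>Cat2\<close>.\<close>

type_synonym ('a, 'c, 'o, 'm) model =
  "(nat, 'a, 'c, ('o list, 'm list) cat, ('o list, 'm list, 'o list, 'm list) ftor,
    ('o list, 'm list, 'o list, 'm list) ntrans) two_ftor"

type_synonym ('a, 'o, 'm) model_map =
  "(nat, 'a, ('o list, 'm list, 'o list, 'm list) ftor, ('o list, 'm list, 'o list, 'm list) ntrans) oplax"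

definition algebra_on ::
  "(nat, 'a, 'c) two_cat \<Rightarrow> ('a, 'c) theory_map \<Rightarrow> ('o, 'm) cat \<Rightarrow> ('a, 'c, 'o, 'm) model \<Rightarrow> bool" where
  "algebra_on T J A X \<longleftrightarrow> category A \<and> two_functor T Cat2 X
    \<and> (\<forall>n. TF0 X n = pow_cat A n)
    \<and> (\<forall>n. \<forall>i<n. TF1 X (TF1 J (fin_proj n i)) = comp_ftor (unary_ftor A) (proj_ftor A n i))"

text \<open>The second conjunct says that the restriction along \<^term>\<open>J\<close> is 2-natural.\<close>

definition oplax_morphism ::
  "(nat, 'a, 'c) two_cat \<Rightarrow> ('a, 'c) theory_map \<Rightarrow> ('a, 'c, 'o, 'm) model \<Rightarrow> ('a, 'c, 'o, 'm) model
    \<Rightarrow> ('a, 'o, 'm) model_map \<Rightarrow> bool" where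
  "oplax_morphism T J X Y k \<longleftrightarrow> oplax_transformation T Cat2 X Y k
    \<and> (\<forall>\<phi>\<in>Arr fin_op. OCell k (TF1 J \<phi>)
        = id_ntrans (comp_ftor (OAt k (Cod fin_op \<phi>)) (TF1 X (TF1 J \<phi>))))"

definition over_identity :: "('o, 'm) cat \<Rightarrow> ('a, 'o, 'm) model_map \<Rightarrow> bool" where
  "over_identity A k \<longleftrightarrow> OAt k 1 = id_ftor (pow_cat A 1)"


section \<open>Algebras for a signature and the forgetful 2-functor\<close>

record ('f, 'o, 'm) omega_alg =
  ACarrier :: "('o, 'm) cat"
  AOp :: "nat \<times> 'f \<Rightarrow> ('o list, 'm list, 'o, 'm) ftor"

definition omega_algebra :: "(nat \<Rightarrow> 'f set) \<Rightarrow> ('f, 'o, 'm) omega_alg \<Rightarrow> bool" where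
  "omega_algebra \<Omega> P \<longleftrightarrow> category (ACarrier P) \<and> AOp P \<in> extensional (Sigma UNIV \<Omega>)
    \<and> (\<forall>n. \<forall>f\<in>\<Omega> n. cat_functor (AOp P (n, f)) \<and> FDom (AOp P (n, f)) = pow_cat (ACarrier P) n
          \<and> FCod (AOp P (n, f)) = ACarrier P)"

record ('f, 'o1, 'm1, 'o2, 'm2) omega_map =
  MFun :: "('o1, 'm1, 'o2, 'm2) ftor"
  MCell :: "nat \<times> 'f \<Rightarrow> ('o1 list, 'm1 list, 'o2, 'm2) ntrans"

definition omega_oplax_morphism ::
  "(nat \<Rightarrow> 'f set) \<Rightarrow> ('f, 'o1, 'm1) omega_alg \<Rightarrow> ('f, 'o2, 'm2) omega_alg
    \<Rightarrow> ('f, 'o1, 'm1, 'o2, 'm2) omega_map \<Rightarrow> bool" where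
  "omega_oplax_morphism \<Omega> P Q h \<longleftrightarrow> omega_algebra \<Omega> P \<and> omega_algebra \<Omega> Q
    \<and> cat_functor (MFun h) \<and> FDom (MFun h) = ACarrier P \<and> FCod (MFun h) = ACarrier Q
    \<and> MCell h \<in> extensional (Sigma UNIV \<Omega>)
    \<and> (\<forall>n. \<forall>f\<in>\<Omega> n. nat_transf (MCell h (n, f))
          \<and> NDom (MCell h (n, f)) = comp_ftor (MFun h) (AOp P (n, f))
          \<and> NCod (MCell h (n, f)) = comp_ftor (AOp Q (n, f)) (pow_ftor (MFun h) n))"

text \<open>The action of the forgetful 2-functor on models with value \<^term>\<open>A\<close> (respectively \<^term>\<open>B\<close>) at 1
  and on oplax morphisms; \<^term>\<open>proj_ftor B 1 0\<close> undoes the identification with the first power.\<close>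

definition forget_alg ::
  "(nat \<Rightarrow> 'f set) \<Rightarrow> ('f, 'a) free_iso \<Rightarrow> ('o, 'm) cat \<Rightarrow> ('a, 'c, 'o, 'm) model \<Rightarrow> ('f, 'o, 'm) omega_alg" where
  "forget_alg \<Omega> I A X =
    \<lparr>ACarrier = A,
     AOp = (\<lambda>(n, f)\<in>Sigma UNIV \<Omega>. comp_ftor (proj_ftor A 1 0) (TF1 X (op_cell I n f)))\<rparr>"

definition forget_map ::
  "(nat \<Rightarrow> 'f set) \<Rightarrow> ('f, 'a) free_iso \<Rightarrow> ('o, 'm) cat \<Rightarrow> ('o, 'm) cat
    \<Rightarrow> ('a, 'o, 'm) model_map \<Rightarrow> ('f, 'o, 'm, 'o, 'm) omega_map" where
  "forget_map \<Omega> I A B k =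
    \<lparr>MFun = comp_ftor (proj_ftor B 1 0) (comp_ftor (OAt k 1) (unary_ftor A)),
     MCell = (\<lambda>(n, f)\<in>Sigma UNIV \<Omega>.
       hcomp_ntrans (id_ntrans (proj_ftor B 1 0)) (OCell k (op_cell I n f)))\<rparr>"


section \<open>Orthogonal factorisation systems\<close>

definition orthogonal :: "('o, 'm) cat \<Rightarrow> 'm \<Rightarrow> 'm \<Rightarrow> bool" where
  "orthogonal A e m \<longleftrightarrow>
    (\<forall>u\<in>Arr A. \<forall>v\<in>Arr A.
      Dom A u = Dom A e \<and> Cod A u = Dom A m \<and> Dom A v = Cod A e \<and> Cod A v = Cod A m
        \<and> Comp A m u = Comp A v e
      \<longrightarrow> (\<exists>!d. d \<in> Arr A \<and> Dom A d = Cod A e \<and> Cod A d = Dom A m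
            \<and> Comp A d e = u \<and> Comp A m d = v))"

definition orthogonal_factorisation_system :: "('o, 'm) cat \<Rightarrow> 'm set \<Rightarrow> 'm set \<Rightarrow> bool" where
  "orthogonal_factorisation_system A E M \<longleftrightarrow>
    (\<forall>f\<in>Arr A. \<exists>e\<in>E. \<exists>m\<in>M. Cod A e = Dom A m \<and> f = Comp A m e)
    \<and> E = {f \<in> Arr A. \<forall>m\<in>M. orthogonal A f m}
    \<and> M = {g \<in> Arr A. \<forall>e\<in>E. orthogonal A e g}"

definition pointwise_in :: "'m2 set \<Rightarrow> ('o1, 'm1, 'o2, 'm2) ntrans \<Rightarrow> bool" where
  "pointwise_in E \<alpha> \<longleftrightarrow> (\<forall>x\<in>Obj (FDom (NDom \<alpha>)). NAt \<alpha> x \<in> E)"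

definition preserves_pointwise :: "nat \<Rightarrow> ('o list, 'm list, 'o, 'm) ftor \<Rightarrow> 'm set \<Rightarrow> bool" where
  "preserves_pointwise n H E \<longleftrightarrow> (\<forall>gs. length gs = n \<and> set gs \<subseteq> E \<longrightarrow> FArr H gs \<in> E)"

text \<open>\<^term>\<open>Z\<close>, \<^term>\<open>e\<close> and \<^term>\<open>m\<close> form a pointwise factorisation of a natural transformation.\<close>

definition pointwise_factorisation ::
  "'m2 set \<Rightarrow> 'm2 set \<Rightarrow> ('o1, 'm1, 'o2, 'm2) ntrans \<Rightarrow> ('o1, 'm1, 'o2, 'm2) ftor
    \<Rightarrow> ('o1, 'm1, 'o2, 'm2) ntrans \<Rightarrow> ('o1, 'm1, 'o2, 'm2) ntrans \<Rightarrow> bool" where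
  "pointwise_factorisation E M \<kappa> Z e m \<longleftrightarrow> cat_functor Z \<and> nat_transf e \<and> nat_transf m
    \<and> NDom e = NDom \<kappa> \<and> NCod e = Z \<and> NDom m = Z \<and> NCod m = NCod \<kappa>
    \<and> vcomp_ntrans m e = \<kappa> \<and> pointwise_in E e \<and> pointwise_in M m"

end

(*
  Since the underlying theory is free, 1-cells are tuples of terms: an Omega-algebra structure Z
  extends to them by evaluation, and e, m extend by composing components along subterms.  As X
  preserves E and Y preserves M, the extended components e(t), m(t) still lie in E and M (by
  naturality, e(f(ts)) is also e(f) after X(f)(e(ts))).  For a 2-cell s => t the value at Z is the
  diagonal of the square formed by e(s) and m(t), with sides e(t) after X and Y after m(s); this
  choice is forced by the oplax naturality of e and m, and uniqueness of diagonals gives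
  naturality, functoriality and compatibility with horizontal composition.
*)
theory Submission
  imports Defs
begin

section \<open>Powers of a category, functors and natural transformations\<close>

text \<open>The rigidity comes from the requirement that oplax morphisms restrict to 2-natural
  transformations along \<open>J\<close>. It makes the cells at projections identities. Together
  with the identity at 1, this forces \<open>OAt\<close> to be an identity at every n, makes the
  cell at a tuple the tuple of the cells at its entries, and turns the oplax composition law into a
  recursion over terms. So all data at 1-cells are determined by the operations, and only the values
  at 2-cells remain to be found. There diagonals are found one object at a time, while naturality
  compares the diagonals at two objects. Hence e(s) at x has to be orthogonal to m(t) at a different
  object y, and it is membership in E and M that is carried through the terms, rather than
  orthogonality of single pairs. As 1-cells end at arbitrary n, orthogonality is also transferred to
  powers of A. The conditions on e and on m have one shape: a square with e (or m) as one pair of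
  opposite sides and with the values of X and Z (or of Z and Y) at a 2-cell as the other pair. One
  pair of pasting lemmas therefore serves both halves.\<close>

lemma in_Obj_pow [simp]: "xs \<in> Obj (pow_cat C n) \<longleftrightarrow> length xs = n \<and> (\<forall>i<n. xs ! i \<in> Obj C)"
  by (auto simp: pow_cat_def set_conv_nth)

lemma in_Arr_pow [simp]: "fs \<in> Arr (pow_cat C n) \<longleftrightarrow> length fs = n \<and> (\<forall>i<n. fs ! i \<in> Arr C)"
  by (auto simp: pow_cat_def set_conv_nth)

lemma pow_cat_simps [simp]:
  "Dom (pow_cat C n) = map (Dom C)" "Cod (pow_cat C n) = map (Cod C)"
  "Id (pow_cat C n) = map (Id C)" "Comp (pow_cat C n) = map2 (Comp C)"
  by (simp_all add: pow_cat_def)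

lemma category_pow_cat:
  assumes "category C"
  shows "category (pow_cat C n)"
proof -
  interpret category C by fact
  show ?thesis
    by unfold_locales (auto simp: list_eq_iff_nth_eq Comp_assoc)
qed

lemma (in cat_functor) FObj_in: "x \<in> Obj (FDom F) \<Longrightarrow> FObj F x \<in> Obj (FCod F)"
  using FObj_PiE by auto

lemma (in cat_functor) FArr_in: "f \<in> Arr (FDom F) \<Longrightarrow> FArr F f \<in> Arr (FCod F)"
  using FArr_PiE by auto

lemma (in nat_transf) NAt_in: "x \<in> Obj (FDom (NDom \<alpha>)) \<Longrightarrow> NAt \<alpha> x \<in> Arr (FCod (NDom \<alpha>))"
  using NAt_PiE by auto

lemma ftor_eqI:
  assumes "cat_functor F" "cat_functor G" "FDom F = FDom G" "FCod F = FCod G"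
    and "\<And>x. x \<in> Obj (FDom G) \<Longrightarrow> FObj F x = FObj G x"
    and "\<And>f. f \<in> Arr (FDom G) \<Longrightarrow> FArr F f = FArr G f"
  shows "F = (G :: ('o1, 'm1, 'o2, 'm2) ftor)"
proof -
  interpret F: cat_functor F by fact
  interpret G: cat_functor G by fact
  have "FObj F = FObj G"
    using F.FObj_PiE G.FObj_PiE assms by (intro extensionalityI[of _ "Obj (FDom G)"]) (auto simp: PiE_iff)
  moreover have "FArr F = FArr G"
    using F.FArr_PiE G.FArr_PiE assms by (intro extensionalityI[of _ "Arr (FDom G)"]) (auto simp: PiE_iff)
  ultimately show ?thesis using assms by simp
qed

lemma ntrans_eqI:
  assumes "nat_transf \<alpha>" "nat_transf \<beta>" "NDom \<alpha> = NDom \<beta>" "NCod \<alpha> = NCod \<beta>"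
    and "\<And>x. x \<in> Obj (FDom (NDom \<beta>)) \<Longrightarrow> NAt \<alpha> x = NAt \<beta> x"
  shows "\<alpha> = (\<beta> :: ('o1, 'm1, 'o2, 'm2) ntrans)"
proof -
  interpret a: nat_transf \<alpha> by fact
  interpret b: nat_transf \<beta> by fact
  have "NAt \<alpha> = NAt \<beta>"
    using a.NAt_PiE b.NAt_PiE assms by (intro extensionalityI[of _ "Obj (FDom (NDom \<beta>))"]) (auto simp: PiE_iff)
  then show ?thesis using assms by simp
qed

lemma id_ftor_simps [simp]:
  "FDom (id_ftor C) = C" "FCod (id_ftor C) = C"
  "x \<in> Obj C \<Longrightarrow> FObj (id_ftor C) x = x" "f \<in> Arr C \<Longrightarrow> FArr (id_ftor C) f = f"
  by (simp_all add: id_ftor_def)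

lemma comp_ftor_simps [simp]:
  "FDom (comp_ftor G F) = FDom F" "FCod (comp_ftor G F) = FCod G"
  "x \<in> Obj (FDom F) \<Longrightarrow> FObj (comp_ftor G F) x = FObj G (FObj F x)"
  "f \<in> Arr (FDom F) \<Longrightarrow> FArr (comp_ftor G F) f = FArr G (FArr F f)"
  by (simp_all add: comp_ftor_def)

lemma proj_ftor_simps [simp]:
  "FDom (proj_ftor C n i) = pow_cat C n" "FCod (proj_ftor C n i) = C"
  "xs \<in> Obj (pow_cat C n) \<Longrightarrow> FObj (proj_ftor C n i) xs = xs ! i"
  "fs \<in> Arr (pow_cat C n) \<Longrightarrow> FArr (proj_ftor C n i) fs = fs ! i"
  by (simp_all add: proj_ftor_def)

lemma unary_ftor_simps [simp]:
  "FDom (unary_ftor C) = C" "FCod (unary_ftor C) = pow_cat C 1"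
  "x \<in> Obj C \<Longrightarrow> FObj (unary_ftor C) x = [x]"
  "f \<in> Arr C \<Longrightarrow> FArr (unary_ftor C) f = [f]"
  by (simp_all add: unary_ftor_def)

lemma cat_functor_id_ftor: "category C \<Longrightarrow> cat_functor (id_ftor C)"
  by (rule cat_functor.intro) (auto simp: id_ftor_def category.Dom_in category.Cod_in category.Id_in category.Comp_in)

lemma cat_functor_proj_ftor:
  assumes "category C" "i < n"
  shows "cat_functor (proj_ftor C n i)"
proof -
  interpret category C by fact
  interpret P: category "pow_cat C n" by (rule category_pow_cat) fact
  show ?thesis
    by (rule cat_functor.intro)
      (use assms in \<open>auto simp: proj_ftor_def list_eq_iff_nth_eq P.category_axioms\<close>)
qed

lemma cat_functor_unary_ftor:
  assumes "category C"
  shows "cat_functor (unary_ftor C)"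
proof -
  interpret category C by fact
  show ?thesis
    by (rule cat_functor.intro) (auto simp: unary_ftor_def category_axioms category_pow_cat)
qed

lemma cat_functor_comp_ftor:
  assumes "cat_functor F" "cat_functor G" "FDom G = FCod F"
  shows "cat_functor (comp_ftor G F)"
proof -
  interpret F: cat_functor F by fact
  interpret G: cat_functor G by fact
  interpret C: category "FDom F" by (rule F.category_FDom)
  have "\<And>f. f \<in> Arr (FDom F) \<Longrightarrow> FArr F f \<in> Arr (FDom G)"
    "\<And>x. x \<in> Obj (FDom F) \<Longrightarrow> FObj F x \<in> Obj (FDom G)"
    using F.FArr_in F.FObj_in assms(3) by auto
  then show ?thesis
    using F.Dom_FArr F.Cod_FArr F.FArr_Id F.FArr_Comp assms(3)
    by (intro cat_functor.intro)
      (auto simp: comp_ftor_def F.category_FDom G.category_FCod F.FObj_in F.FArr_in G.FObj_in G.FArr_in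
        G.Dom_FArr G.Cod_FArr G.FArr_Id[unfolded assms(3)] G.FArr_Comp[unfolded assms(3)])
qed

lemma comp_id_ftor:
  assumes "cat_functor F" "FCod F = C"
  shows "comp_ftor (id_ftor C) F = F"
  using assms cat_functor.category_FCod[OF assms(1)]
  by (intro ftor_eqI cat_functor_comp_ftor cat_functor_id_ftor)
    (auto simp: cat_functor.FObj_in cat_functor.FArr_in)

lemma comp_ftor_id:
  assumes "cat_functor F" "FDom F = C"
  shows "comp_ftor F (id_ftor C) = F"
  using assms cat_functor.category_FDom[OF assms(1)]
  by (intro ftor_eqI cat_functor_comp_ftor cat_functor_id_ftor) auto

text \<open>Over the identity functor the codomain of a cell of an Omega-algebra morphism involves
  this power; the equation reduces that codomain to the operation itself.\<close>

lemma pow_ftor_id_ftor: "pow_ftor (id_ftor C) n = id_ftor (pow_cat C n)"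
proof -
  have "restrict (map (FObj (id_ftor C))) (Obj (pow_cat C n)) = restrict (\<lambda>x. x) (Obj (pow_cat C n))"
    "restrict (map (FArr (id_ftor C))) (Arr (pow_cat C n)) = restrict (\<lambda>x. x) (Arr (pow_cat C n))"
    by (auto simp: fun_eq_iff restrict_def list_eq_iff_nth_eq)
  then show ?thesis by (simp add: pow_ftor_def id_ftor_def)
qed

lemma id_ntrans_simps [simp]:
  "NDom (id_ntrans F) = F" "NCod (id_ntrans F) = F"
  "x \<in> Obj (FDom F) \<Longrightarrow> NAt (id_ntrans F) x = Id (FCod F) (FObj F x)"
  by (simp_all add: id_ntrans_def)

lemma vcomp_ntrans_simps [simp]:
  "NDom (vcomp_ntrans \<beta> \<alpha>) = NDom \<alpha>" "NCod (vcomp_ntrans \<beta> \<alpha>) = NCod \<beta>"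
  "x \<in> Obj (FDom (NDom \<alpha>)) \<Longrightarrow>
    NAt (vcomp_ntrans \<beta> \<alpha>) x = Comp (FCod (NDom \<alpha>)) (NAt \<beta> x) (NAt \<alpha> x)"
  by (simp_all add: vcomp_ntrans_def)

lemma hcomp_ntrans_simps [simp]:
  "NDom (hcomp_ntrans \<beta> \<alpha>) = comp_ftor (NDom \<beta>) (NDom \<alpha>)"
  "NCod (hcomp_ntrans \<beta> \<alpha>) = comp_ftor (NCod \<beta>) (NCod \<alpha>)"
  "x \<in> Obj (FDom (NDom \<alpha>)) \<Longrightarrow>
    NAt (hcomp_ntrans \<beta> \<alpha>) x
    = Comp (FCod (NDom \<beta>)) (FArr (NCod \<beta>) (NAt \<alpha> x)) (NAt \<beta> (FObj (NDom \<alpha>) x))"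
  by (simp_all add: hcomp_ntrans_def)

section \<open>Functors and natural transformations with a named boundary\<close>

locale functor_between =
  fixes D :: "('o1, 'm1) cat" and C :: "('o2, 'm2) cat" and F :: "('o1, 'm1, 'o2, 'm2) ftor"
  assumes ftor: "cat_functor F" and FDom [simp]: "FDom F = D" and FCod [simp]: "FCod F = C"
begin

sublocale D: category D
  using cat_functor.category_FDom[OF ftor] by simp

sublocale C: category C
  using cat_functor.category_FCod[OF ftor] by simp

lemma obj_in [simp]: "x \<in> Obj D \<Longrightarrow> FObj F x \<in> Obj C"
  using cat_functor.FObj_in[OF ftor] by simp

lemma arr_in [simp]: "f \<in> Arr D \<Longrightarrow> FArr F f \<in> Arr C"
  using cat_functor.FArr_in[OF ftor] by simp

lemma Dom_arr [simp]: "f \<in> Arr D \<Longrightarrow> Dom C (FArr F f) = FObj F (Dom D f)"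
  using cat_functor.Dom_FArr[OF ftor] by simp

lemma Cod_arr [simp]: "f \<in> Arr D \<Longrightarrow> Cod C (FArr F f) = FObj F (Cod D f)"
  using cat_functor.Cod_FArr[OF ftor] by simp

lemma arr_Id [simp]: "x \<in> Obj D \<Longrightarrow> FArr F (Id D x) = Id C (FObj F x)"
  using cat_functor.FArr_Id[OF ftor] by simp

lemma arr_Comp:
  "\<lbrakk>f \<in> Arr D; g \<in> Arr D; Dom D g = Cod D f\<rbrakk>
    \<Longrightarrow> FArr F (Comp D g f) = Comp C (FArr F g) (FArr F f)"
  using cat_functor.FArr_Comp[OF ftor] by simp

end

lemma functor_betweenI:
  assumes "category D" "category C" "FDom F = D" "FCod F = C"
    and "FObj F \<in> extensional (Obj D)" "FArr F \<in> extensional (Arr D)"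
    and "\<And>x. x \<in> Obj D \<Longrightarrow> FObj F x \<in> Obj C"
    and "\<And>f. f \<in> Arr D \<Longrightarrow> FArr F f \<in> Arr C"
    and "\<And>f. f \<in> Arr D \<Longrightarrow> Dom C (FArr F f) = FObj F (Dom D f)"
    and "\<And>f. f \<in> Arr D \<Longrightarrow> Cod C (FArr F f) = FObj F (Cod D f)"
    and "\<And>x. x \<in> Obj D \<Longrightarrow> FArr F (Id D x) = Id C (FObj F x)"
    and "\<And>f g. \<lbrakk>f \<in> Arr D; g \<in> Arr D; Dom D g = Cod D f\<rbrakk>
      \<Longrightarrow> FArr F (Comp D g f) = Comp C (FArr F g) (FArr F f)"
  shows "functor_between D C F"
  using assms by (intro functor_between.intro cat_functor.intro) (auto simp: PiE_iff)

text \<open>The boundary is required of \<open>F\<close> only; \<open>nat_transf\<close> carries it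
  over to \<open>G\<close>. Having \<open>D\<close> and \<open>C\<close> as parameters lets the
  simplifier avoid \<open>FDom\<close> and \<open>FCod\<close> of composite expressions.\<close>

locale trans_between =
  fixes D :: "('o1, 'm1) cat" and C :: "('o2, 'm2) cat" and F G :: "('o1, 'm1, 'o2, 'm2) ftor"
    and \<alpha> :: "('o1, 'm1, 'o2, 'm2) ntrans"
  assumes trans: "nat_transf \<alpha>" and NDom [simp]: "NDom \<alpha> = F" and NCod [simp]: "NCod \<alpha> = G"
    and FDom_F: "FDom F = D" and FCod_F: "FCod F = C"
begin

sublocale F: functor_between D C F
  using nat_transf.functor_NDom[OF trans] FDom_F FCod_F by (intro functor_between.intro) simp_all

sublocale G: functor_between D C G
  using nat_transf.functor_NCod[OF trans] nat_transf.FDom_eq[OF trans] nat_transf.FCod_eq[OF trans] FDom_F FCod_F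
  by (intro functor_between.intro) simp_all

lemma at_in [simp]: "x \<in> Obj D \<Longrightarrow> NAt \<alpha> x \<in> Arr C"
  using nat_transf.NAt_in[OF trans] by simp

lemma Dom_at [simp]: "x \<in> Obj D \<Longrightarrow> Dom C (NAt \<alpha> x) = FObj F x"
  using nat_transf.Dom_NAt[OF trans] by simp

lemma Cod_at [simp]: "x \<in> Obj D \<Longrightarrow> Cod C (NAt \<alpha> x) = FObj G x"
  using nat_transf.Cod_NAt[OF trans] by simp

lemma nat:
  "f \<in> Arr D \<Longrightarrow> Comp C (NAt \<alpha> (Cod D f)) (FArr F f) = Comp C (FArr G f) (NAt \<alpha> (Dom D f))"
  using nat_transf.naturality[OF trans] by simp

end

lemma trans_betweenI:
  assumes "functor_between D C F" "functor_between D C G" "NDom \<alpha> = F" "NCod \<alpha> = G"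
    and "NAt \<alpha> \<in> extensional (Obj D)"
    and "\<And>x. x \<in> Obj D \<Longrightarrow> NAt \<alpha> x \<in> Arr C"
    and "\<And>x. x \<in> Obj D \<Longrightarrow> Dom C (NAt \<alpha> x) = FObj F x"
    and "\<And>x. x \<in> Obj D \<Longrightarrow> Cod C (NAt \<alpha> x) = FObj G x"
    and "\<And>f. f \<in> Arr D \<Longrightarrow>
      Comp C (NAt \<alpha> (Cod D f)) (FArr F f) = Comp C (FArr G f) (NAt \<alpha> (Dom D f))"
  shows "trans_between D C F G \<alpha>"
proof -
  interpret F: functor_between D C F by fact
  interpret G: functor_between D C G by fact
  show ?thesis
    using assms(5-) F.ftor G.ftor
    by (intro trans_between.intro nat_transf.intro) (auto simp: PiE_iff assms(3,4))
qed

lemma functor_between_comp_ftor: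
  assumes "functor_between D C F" "functor_between C B G"
  shows "functor_between D B (comp_ftor G F)"
  using assms by (auto intro: cat_functor_comp_ftor simp: functor_between_def)

lemma trans_between_id_ntrans:
  assumes "functor_between D C F"
  shows "trans_between D C F F (id_ntrans F)"
proof -
  interpret functor_between D C F by fact
  have "Comp C (Id C (FObj F (Cod D f))) (FArr F f) = Comp C (FArr F f) (Id C (FObj F (Dom D f)))"
    if "f \<in> Arr D" for f
    using that C.Comp_Id_left[OF arr_in, of f] C.Comp_Id_right[OF arr_in, of f] by simp
  then show ?thesis
    by (intro trans_betweenI assms) (auto simp: id_ntrans_def)
qed

lemma trans_between_vcomp_ntrans:
  assumes "trans_between D C F G \<alpha>" "trans_between D C G H \<beta>"
  shows "trans_between D C F H (vcomp_ntrans \<beta> \<alpha>)"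
proof -
  interpret a: trans_between D C F G \<alpha> by fact
  interpret b: trans_between D C G H \<beta> by fact
  have "Comp C (Comp C (NAt \<beta> (Cod D f)) (NAt \<alpha> (Cod D f))) (FArr F f)
      = Comp C (FArr H f) (Comp C (NAt \<beta> (Dom D f)) (NAt \<alpha> (Dom D f)))" if f: "f \<in> Arr D" for f
  proof -
    have "Comp C (Comp C (NAt \<beta> (Cod D f)) (NAt \<alpha> (Cod D f))) (FArr F f)
        = Comp C (NAt \<beta> (Cod D f)) (Comp C (FArr G f) (NAt \<alpha> (Dom D f)))"
      using f by (simp add: a.F.C.Comp_assoc[symmetric] a.nat)
    also have "\<dots> = Comp C (Comp C (FArr H f) (NAt \<beta> (Dom D f))) (NAt \<alpha> (Dom D f))"
      using f b.nat[OF f] by (simp add: a.F.C.Comp_assoc)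
    also have "\<dots> = Comp C (FArr H f) (Comp C (NAt \<beta> (Dom D f)) (NAt \<alpha> (Dom D f)))"
      using f by (simp add: a.F.C.Comp_assoc[symmetric])
    finally show ?thesis .
  qed
  then show ?thesis
    by (intro trans_betweenI a.F.functor_between_axioms b.G.functor_between_axioms)
      (auto simp: vcomp_ntrans_def)
qed

section \<open>Whiskering and pasting of squares\<close>

lemma whisker_left:
  assumes "functor_between C B H" "trans_between D C F G \<alpha>"
  shows "trans_between D B (comp_ftor H F) (comp_ftor H G) (hcomp_ntrans (id_ntrans H) \<alpha>)"
    and "x \<in> Obj D \<Longrightarrow> NAt (hcomp_ntrans (id_ntrans H) \<alpha>) x = FArr H (NAt \<alpha> x)"
proof -
  interpret H: functor_between C B H by fact
  interpret a: trans_between D C F G \<alpha> by fact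
  \<comment> \<open>The definition of horizontal composition leaves an identity as one factor; it is
    removed once here, and all later uses go through this form.\<close>
  have at: "NAt (hcomp_ntrans (id_ntrans H) \<alpha>) x = FArr H (NAt \<alpha> x)" if "x \<in> Obj D" for x
    using that H.C.Comp_Id_right[of "FArr H (NAt \<alpha> x)"] by simp
  then show "x \<in> Obj D \<Longrightarrow> NAt (hcomp_ntrans (id_ntrans H) \<alpha>) x = FArr H (NAt \<alpha> x)" .
  have "Comp B (FArr H (NAt \<alpha> (Cod D f))) (FArr H (FArr F f))
      = Comp B (FArr H (FArr G f)) (FArr H (NAt \<alpha> (Dom D f)))" if "f \<in> Arr D" for f
    using that by (simp add: H.arr_Comp[symmetric] a.nat)
  then show "trans_between D B (comp_ftor H F) (comp_ftor H G) (hcomp_ntrans (id_ntrans H) \<alpha>)"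
    by (intro trans_betweenI functor_between_comp_ftor[OF _ assms(1)] a.F.functor_between_axioms
        a.G.functor_between_axioms)
      (simp_all add: at del: hcomp_ntrans_simps(3), simp_all add: hcomp_ntrans_def)
qed

lemma whisker_right:
  assumes "trans_between C B F G \<alpha>" "functor_between D C H"
  shows "trans_between D B (comp_ftor F H) (comp_ftor G H) (hcomp_ntrans \<alpha> (id_ntrans H))"
    and "x \<in> Obj D \<Longrightarrow> NAt (hcomp_ntrans \<alpha> (id_ntrans H)) x = NAt \<alpha> (FObj H x)"
proof -
  interpret H: functor_between D C H by fact
  interpret a: trans_between C B F G \<alpha> by fact
  have at: "NAt (hcomp_ntrans \<alpha> (id_ntrans H)) x = NAt \<alpha> (FObj H x)" if "x \<in> Obj D" for x
    using that a.F.C.Comp_Id_left[of "NAt \<alpha> (FObj H x)"] by simp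
  then show "x \<in> Obj D \<Longrightarrow> NAt (hcomp_ntrans \<alpha> (id_ntrans H)) x = NAt \<alpha> (FObj H x)" .
  have "Comp B (NAt \<alpha> (FObj H (Cod D f))) (FArr F (FArr H f))
      = Comp B (FArr G (FArr H f)) (NAt \<alpha> (FObj H (Dom D f)))" if "f \<in> Arr D" for f
    using that a.nat[of "FArr H f"] by simp
  then show "trans_between D B (comp_ftor F H) (comp_ftor G H) (hcomp_ntrans \<alpha> (id_ntrans H))"
    by (intro trans_betweenI functor_between_comp_ftor[OF assms(2)] a.F.functor_between_axioms
        a.G.functor_between_axioms)
      (simp_all add: at del: hcomp_ntrans_simps(3), simp_all add: hcomp_ntrans_def)
qed

lemma functor_between_id_ftor: "category C \<Longrightarrow> functor_between C C (id_ftor C)"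
  by (simp add: functor_between_def cat_functor_id_ftor)

text \<open>Oplax naturality whiskers the values at a 2-cell with \<open>OAt\<close>. For morphisms
  over the identity, this lemma and the next make those whiskerings disappear.\<close>

lemma hcomp_ntrans_id_left:
  assumes "trans_between D C F G \<alpha>"
  shows "hcomp_ntrans (id_ntrans (id_ftor C)) \<alpha> = \<alpha>"
proof -
  interpret a: trans_between D C F G \<alpha> by fact
  note id = functor_between_id_ftor[OF a.F.C.category_axioms]
  show ?thesis
    by (rule ntrans_eqI[OF trans_between.trans[OF whisker_left(1)[OF id assms]] a.trans])
      (simp_all add: whisker_left(2)[OF id assms] comp_id_ftor a.F.ftor a.G.ftor
        del: hcomp_ntrans_simps(3))
qed

lemma hcomp_ntrans_id_right:
  assumes "trans_between D C F G \<alpha>"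
  shows "hcomp_ntrans \<alpha> (id_ntrans (id_ftor D)) = \<alpha>"
proof -
  interpret a: trans_between D C F G \<alpha> by fact
  note id = functor_between_id_ftor[OF a.F.D.category_axioms]
  show ?thesis
    by (rule ntrans_eqI[OF trans_between.trans[OF whisker_right(1)[OF assms id]] a.trans])
      (simp_all add: whisker_right(2)[OF assms id] comp_ftor_id a.F.ftor a.G.ftor
        del: hcomp_ntrans_simps(3))
qed

text \<open>Two commuting squares that share the side \<open>e'\<close> are pasted. The letters
  stand for either half of the problem: e with the values of X and Z, or m with the values of Z and
  Y.\<close>

lemma vcomp_square:
  assumes "trans_between D C F H e" "trans_between D C F' H' e'" "trans_between D C F'' H'' e''"
    and "trans_between D C F F' \<xi>" "trans_between D C H H' \<zeta>"
    and "trans_between D C F' F'' \<xi>'" "trans_between D C H' H'' \<zeta>'"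
    and x: "x \<in> Obj D"
    and sq: "Comp C (NAt \<zeta> x) (NAt e x) = Comp C (NAt e' x) (NAt \<xi> x)"
    and sq': "Comp C (NAt \<zeta>' x) (NAt e' x) = Comp C (NAt e'' x) (NAt \<xi>' x)"
  shows "Comp C (NAt (vcomp_ntrans \<zeta>' \<zeta>) x) (NAt e x) = Comp C (NAt e'' x) (NAt (vcomp_ntrans \<xi>' \<xi>) x)"
proof -
  interpret e: trans_between D C F H e by fact
  interpret e': trans_between D C F' H' e' by fact
  interpret e'': trans_between D C F'' H'' e'' by fact
  interpret \<xi>: trans_between D C F F' \<xi> by fact
  interpret \<zeta>: trans_between D C H H' \<zeta> by fact
  interpret \<xi>': trans_between D C F' F'' \<xi>' by fact
  interpret \<zeta>': trans_between D C H' H'' \<zeta>' by fact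
  have "Comp C (NAt (vcomp_ntrans \<zeta>' \<zeta>) x) (NAt e x) = Comp C (NAt \<zeta>' x) (Comp C (NAt e' x) (NAt \<xi> x))"
    using x by (simp add: e.F.C.Comp_assoc[symmetric] sq)
  also have "\<dots> = Comp C (Comp C (NAt e'' x) (NAt \<xi>' x)) (NAt \<xi> x)"
    using x by (simp add: e.F.C.Comp_assoc sq')
  also have "\<dots> = Comp C (NAt e'' x) (NAt (vcomp_ntrans \<xi>' \<xi>) x)"
    using x by (simp add: e.F.C.Comp_assoc)
  finally show ?thesis .
qed

text \<open>The squares compose horizontally when the vertical sides are composed in the way the 2-cells of
  an oplax transformation are.\<close>

lemma hcomp_square:
  assumes "trans_between D C F H e" "trans_between D C F' H' e'"
    and "trans_between D C F F' \<xi>" "trans_between D C H H' \<zeta>"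
    and "trans_between C B K L d" "trans_between C B K' L' d'"
    and "trans_between C B K K' \<psi>" "trans_between C B L L' \<omega>"
    and x: "x \<in> Obj D"
    and sq: "Comp C (NAt \<zeta> x) (NAt e x) = Comp C (NAt e' x) (NAt \<xi> x)"
    and sq': "\<And>y. y \<in> Obj C \<Longrightarrow> Comp B (NAt \<omega> y) (NAt d y) = Comp B (NAt d' y) (NAt \<psi> y)"
  shows "Comp B (NAt (hcomp_ntrans \<omega> \<zeta>) x) (Comp B (FArr L (NAt e x)) (NAt d (FObj F x)))
    = Comp B (Comp B (FArr L' (NAt e' x)) (NAt d' (FObj F' x))) (NAt (hcomp_ntrans \<psi> \<xi>) x)"
proof -
  interpret e: trans_between D C F H e by fact
  interpret e': trans_between D C F' H' e' by fact
  interpret \<xi>: trans_between D C F F' \<xi> by fact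
  interpret \<zeta>: trans_between D C H H' \<zeta> by fact
  interpret d: trans_between C B K L d by fact
  interpret d': trans_between C B K' L' d' by fact
  interpret \<psi>: trans_between C B K K' \<psi> by fact
  interpret \<omega>: trans_between C B L L' \<omega> by fact
  note assoc = d.F.C.Comp_assoc
  have "Comp B (NAt (hcomp_ntrans \<omega> \<zeta>) x) (Comp B (FArr L (NAt e x)) (NAt d (FObj F x)))
      = Comp B (FArr L' (NAt \<zeta> x)) (Comp B (Comp B (NAt \<omega> (FObj H x)) (FArr L (NAt e x))) (NAt d (FObj F x)))"
    using x by (simp add: assoc)
  \<comment> \<open>Naturality of \<omega> at \<open>NAt e x\<close> moves \<omega> next to
    \<open>d\<close>, where the second square applies; naturality of \<open>d'\<close> plays the
    matching role below.\<close>
  also have "\<dots> = Comp B (FArr L' (NAt \<zeta> x)) (Comp B (Comp B (FArr L' (NAt e x)) (NAt \<omega> (FObj F x))) (NAt d (FObj F x)))"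
    using x \<omega>.nat[of "NAt e x"] by simp
  also have "\<dots> = Comp B (FArr L' (Comp C (NAt \<zeta> x) (NAt e x))) (Comp B (NAt \<omega> (FObj F x)) (NAt d (FObj F x)))"
    using x by (simp add: assoc d'.G.arr_Comp)
  also have "\<dots> = Comp B (FArr L' (Comp C (NAt e' x) (NAt \<xi> x))) (Comp B (NAt d' (FObj F x)) (NAt \<psi> (FObj F x)))"
    using x by (simp add: sq sq')
  also have "\<dots> = Comp B (FArr L' (NAt e' x)) (Comp B (Comp B (FArr L' (NAt \<xi> x)) (NAt d' (FObj F x))) (NAt \<psi> (FObj F x)))"
    using x by (simp add: assoc d'.G.arr_Comp)
  also have "\<dots> = Comp B (FArr L' (NAt e' x)) (Comp B (Comp B (NAt d' (FObj F' x)) (FArr K' (NAt \<xi> x))) (NAt \<psi> (FObj F x)))"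
    using x d'.nat[of "NAt \<xi> x"] by simp
  also have "\<dots> = Comp B (Comp B (FArr L' (NAt e' x)) (NAt d' (FObj F' x))) (NAt (hcomp_ntrans \<psi> \<xi>) x)"
    using x by (simp add: assoc)
  finally show ?thesis .
qed

text \<open>A horizontal composite is the vertical composite of two whiskerings, \<beta> before
  \<open>F\<close> and then \<alpha> under \<open>K\<close>, so its boundary and naturality are
  inherited from them.\<close>

lemma trans_between_hcomp_ntrans:
  assumes "trans_between D C F G \<alpha>" "trans_between C B H K \<beta>"
  shows "trans_between D B (comp_ftor H F) (comp_ftor K G) (hcomp_ntrans \<beta> \<alpha>)"
proof -
  interpret a: trans_between D C F G \<alpha> by fact
  interpret b: trans_between C B H K \<beta> by fact
  have "trans_between D B (comp_ftor H F) (comp_ftor K G)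
      (vcomp_ntrans (hcomp_ntrans (id_ntrans K) \<alpha>) (hcomp_ntrans \<beta> (id_ntrans F)))" (is "trans_between _ _ _ _ ?v")
    by (rule trans_between_vcomp_ntrans[OF whisker_right(1)[OF assms(2) a.F.functor_between_axioms]
          whisker_left(1)[OF b.G.functor_between_axioms assms(1)]])
  moreover have "NAt ?v = NAt (hcomp_ntrans \<beta> \<alpha>)"
    using whisker_right(2)[OF assms(2) a.F.functor_between_axioms]
      whisker_left(2)[OF b.G.functor_between_axioms assms(1)]
    by (auto simp: fun_eq_iff vcomp_ntrans_def restrict_def hcomp_ntrans_def[of \<beta> \<alpha>]
        simp del: hcomp_ntrans_simps(3))
  then have "?v = hcomp_ntrans \<beta> \<alpha>" by simp
  ultimately show ?thesis by simp
qed


section \<open>Orthogonal factorisation systems\<close>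

lemma orthogonal_ex:
  assumes "orthogonal C e m" "u \<in> Arr C" "v \<in> Arr C" "Dom C u = Dom C e" "Cod C u = Dom C m"
    "Dom C v = Cod C e" "Cod C v = Cod C m" "Comp C m u = Comp C v e"
  obtains d where "d \<in> Arr C" "Dom C d = Cod C e" "Cod C d = Dom C m" "Comp C d e = u" "Comp C m d = v"
  using assms unfolding orthogonal_def by blast

text \<open>The square is manufactured from \<open>d\<close> itself: with sides
  \<open>Comp C d e\<close> and \<open>Comp C m d\<close> it has \<open>d\<close> as a diagonal, and
  by the last two hypotheses \<open>d'\<close> is another.\<close>

lemma orthogonal_eq:
  assumes "category C" "orthogonal C e m" "e \<in> Arr C" "m \<in> Arr C"
    and "d \<in> Arr C" "Dom C d = Cod C e" "Cod C d = Dom C m"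
    and "d' \<in> Arr C" "Dom C d' = Cod C e" "Cod C d' = Dom C m"
    and "Comp C d e = Comp C d' e" "Comp C m d = Comp C m d'"
  shows "d = d'"
proof -
  interpret category C by fact
  have sq: "Comp C d e \<in> Arr C" "Comp C m d \<in> Arr C" "Comp C m (Comp C d e) = Comp C (Comp C m d) e"
    using assms by (auto simp: Comp_assoc)
  define P where "P x \<longleftrightarrow> x \<in> Arr C \<and> Dom C x = Cod C e \<and> Cod C x = Dom C m
      \<and> Comp C x e = Comp C d e \<and> Comp C m x = Comp C m d" for x
  have "\<exists>!x. P x"
    unfolding P_def
    by (rule assms(2)[unfolded orthogonal_def, rule_format])
      (use assms(3-7) sq in simp_all)
  moreover have "P d" "P d'" using assms by (simp_all add: P_def)
  ultimately show ?thesis by blast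
qed

text \<open>Composition and boundaries in a power are coordinatewise, so the diagonal is assembled
  from diagonals in the coordinates. This covers 1-cells that end at an arbitrary n.\<close>

lemma orthogonal_pow_cat:
  assumes "category C" "es \<in> Arr (pow_cat C n)" "ms \<in> Arr (pow_cat C n)"
    and orth: "\<And>i. i < n \<Longrightarrow> orthogonal C (es ! i) (ms ! i)"
  shows "orthogonal (pow_cat C n) es ms"
  unfolding orthogonal_def
proof (intro ballI impI)
  interpret category C by fact
  fix us vs
  assume us: "us \<in> Arr (pow_cat C n)" and vs: "vs \<in> Arr (pow_cat C n)"
    and "Dom (pow_cat C n) us = Dom (pow_cat C n) es \<and> Cod (pow_cat C n) us = Dom (pow_cat C n) ms
      \<and> Dom (pow_cat C n) vs = Cod (pow_cat C n) es \<and> Cod (pow_cat C n) vs = Cod (pow_cat C n) ms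
      \<and> Comp (pow_cat C n) ms us = Comp (pow_cat C n) vs es"
  then have sq: "Dom C (us ! i) = Dom C (es ! i) \<and> Cod C (us ! i) = Dom C (ms ! i)
      \<and> Dom C (vs ! i) = Cod C (es ! i) \<and> Cod C (vs ! i) = Cod C (ms ! i)
      \<and> Comp C (ms ! i) (us ! i) = Comp C (vs ! i) (es ! i)" if "i < n" for i
    using that assms(2,3) by (auto simp: list_eq_iff_nth_eq)
  have "\<exists>d. d \<in> Arr C \<and> Dom C d = Cod C (es ! i) \<and> Cod C d = Dom C (ms ! i)
      \<and> Comp C d (es ! i) = us ! i \<and> Comp C (ms ! i) d = vs ! i" if i: "i < n" for i
    by (rule orthogonal_ex[OF orth[OF i], of "us ! i" "vs ! i"]) (use us vs sq[OF i] i in auto)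
  then obtain d where d: "\<And>i. i < n \<Longrightarrow> d i \<in> Arr C \<and> Dom C (d i) = Cod C (es ! i)
      \<and> Cod C (d i) = Dom C (ms ! i) \<and> Comp C (d i) (es ! i) = us ! i \<and> Comp C (ms ! i) (d i) = vs ! i"
    by metis
  show "\<exists>!ds. ds \<in> Arr (pow_cat C n) \<and> Dom (pow_cat C n) ds = Cod (pow_cat C n) es
      \<and> Cod (pow_cat C n) ds = Dom (pow_cat C n) ms
      \<and> Comp (pow_cat C n) ds es = us \<and> Comp (pow_cat C n) ms ds = vs"
  proof (rule ex1I[of _ "map d [0..<n]"])
    fix ds
    assume ds: "ds \<in> Arr (pow_cat C n) \<and> Dom (pow_cat C n) ds = Cod (pow_cat C n) es
      \<and> Cod (pow_cat C n) ds = Dom (pow_cat C n) ms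
      \<and> Comp (pow_cat C n) ds es = us \<and> Comp (pow_cat C n) ms ds = vs"
    then have ds': "ds ! i \<in> Arr C" "Dom C (ds ! i) = Cod C (es ! i)" "Cod C (ds ! i) = Dom C (ms ! i)"
      "Comp C (ds ! i) (es ! i) = us ! i" "Comp C (ms ! i) (ds ! i) = vs ! i" if "i < n" for i
      using that assms(2,3) us vs by (auto simp: list_eq_iff_nth_eq)
    have "ds ! i = d i" if i: "i < n" for i
      using orthogonal_eq[OF category_axioms orth[OF i]] assms(2,3) d[OF i] ds'[OF i] i by auto
    then show "ds = map d [0..<n]" using ds by (auto simp: list_eq_iff_nth_eq)
  qed (use d assms(2,3) us vs in \<open>auto simp: list_eq_iff_nth_eq\<close>)
qed

text \<open>Uniqueness of diagonals at each object; it is what makes the value of the lifted algebra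
  at a 2-cell unique.\<close>

lemma trans_between_orthogonal_eq:
  assumes "trans_between D C F H e" "trans_between D C H' G' m'"
    and "trans_between D C H H' \<zeta>" "trans_between D C H H' \<zeta>'"
    and orth: "\<And>x. x \<in> Obj D \<Longrightarrow> orthogonal C (NAt e x) (NAt m' x)"
    and "\<And>x. x \<in> Obj D \<Longrightarrow> Comp C (NAt \<zeta> x) (NAt e x) = Comp C (NAt \<zeta>' x) (NAt e x)"
    and "\<And>x. x \<in> Obj D \<Longrightarrow> Comp C (NAt m' x) (NAt \<zeta> x) = Comp C (NAt m' x) (NAt \<zeta>' x)"
  shows "\<zeta> = \<zeta>'"
proof -
  interpret e: trans_between D C F H e by fact
  interpret m': trans_between D C H' G' m' by fact
  interpret z: trans_between D C H H' \<zeta> by fact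
  interpret z': trans_between D C H H' \<zeta>' by fact
  have "NAt \<zeta> x = NAt \<zeta>' x" if x: "x \<in> Obj D" for x
    by (rule orthogonal_eq[OF e.F.C.category_axioms orth[OF x]]) (simp_all add: x assms(6,7))
  then show ?thesis by (intro ntrans_eqI z.trans z'.trans) simp_all
qed

text \<open>Diagonals are chosen object by object. They form a natural transformation because
  orthogonality is assumed for \<open>x\<close> and \<open>y\<close> independently: naturality at an
  arrow concerns the component of \<open>e\<close> at its domain and that of \<open>m'\<close> at
  its codomain.\<close>

lemma natural_diagonal:
  assumes "trans_between D C F H e" "trans_between D C H G m"
    and "trans_between D C F' H' e'" "trans_between D C H' G' m'"
    and "trans_between D C F F' \<xi>" "trans_between D C G G' \<upsilon>"
    and comm: "\<And>x. x \<in> Obj D \<Longrightarrow>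
      Comp C (NAt m' x) (Comp C (NAt e' x) (NAt \<xi> x)) = Comp C (NAt \<upsilon> x) (Comp C (NAt m x) (NAt e x))"
    and orth: "\<And>x y. \<lbrakk>x \<in> Obj D; y \<in> Obj D\<rbrakk> \<Longrightarrow> orthogonal C (NAt e x) (NAt m' y)"
  obtains \<zeta> where "trans_between D C H H' \<zeta>"
    and "\<And>x. x \<in> Obj D \<Longrightarrow> Comp C (NAt \<zeta> x) (NAt e x) = Comp C (NAt e' x) (NAt \<xi> x)"
    and "\<And>x. x \<in> Obj D \<Longrightarrow> Comp C (NAt m' x) (NAt \<zeta> x) = Comp C (NAt \<upsilon> x) (NAt m x)"
proof -
  interpret e: trans_between D C F H e by fact
  interpret m: trans_between D C H G m by fact
  interpret e': trans_between D C F' H' e' by fact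
  interpret m': trans_between D C H' G' m' by fact
  interpret \<xi>: trans_between D C F F' \<xi> by fact
  interpret \<upsilon>: trans_between D C G G' \<upsilon> by fact
  have "\<exists>d. d \<in> Arr C \<and> Dom C d = FObj H x \<and> Cod C d = FObj H' x
      \<and> Comp C d (NAt e x) = Comp C (NAt e' x) (NAt \<xi> x)
      \<and> Comp C (NAt m' x) d = Comp C (NAt \<upsilon> x) (NAt m x)" if x: "x \<in> Obj D" for x
  proof -
    have sq: "Comp C (NAt m' x) (Comp C (NAt e' x) (NAt \<xi> x)) = Comp C (Comp C (NAt \<upsilon> x) (NAt m x)) (NAt e x)"
      using x comm by (simp add: e.F.C.Comp_assoc)
    show ?thesis
      by (rule orthogonal_ex[OF orth[OF x x], of "Comp C (NAt e' x) (NAt \<xi> x)"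
          "Comp C (NAt \<upsilon> x) (NAt m x)"]) (use sq x in auto)
  qed
  then have "\<forall>x\<in>Obj D. \<exists>d. d \<in> Arr C \<and> Dom C d = FObj H x \<and> Cod C d = FObj H' x
      \<and> Comp C d (NAt e x) = Comp C (NAt e' x) (NAt \<xi> x)
      \<and> Comp C (NAt m' x) d = Comp C (NAt \<upsilon> x) (NAt m x)" by blast
  from bchoice[OF this] obtain z where z: "\<And>x. x \<in> Obj D \<Longrightarrow> z x \<in> Arr C \<and> Dom C (z x) = FObj H x \<and> Cod C (z x) = FObj H' x
      \<and> Comp C (z x) (NAt e x) = Comp C (NAt e' x) (NAt \<xi> x)
      \<and> Comp C (NAt m' x) (z x) = Comp C (NAt \<upsilon> x) (NAt m x)"
    by blast
  have z_in [simp]: "x \<in> Obj D \<Longrightarrow> z x \<in> Arr C" "x \<in> Obj D \<Longrightarrow> Dom C (z x) = FObj H x"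
    "x \<in> Obj D \<Longrightarrow> Cod C (z x) = FObj H' x" for x
    using z by auto
  \<comment> \<open>Both sides fill one square from \<open>NAt e ?x\<close> to
    \<open>NAt m' ?y\<close>: facts 1 and 2 say that they agree after precomposition with the former
    and after postcomposition with the latter.\<close>
  have natural: "Comp C (z (Cod D f)) (FArr H f) = Comp C (FArr H' f) (z (Dom D f))" if f: "f \<in> Arr D" for f
  proof -
    let ?x = "Dom D f" and ?y = "Cod D f"
    have xy: "?x \<in> Obj D" "?y \<in> Obj D" using f by auto
    have "Comp C (Comp C (z ?y) (FArr H f)) (NAt e ?x) = Comp C (z ?y) (Comp C (NAt e ?y) (FArr F f))"
      using f xy by (simp add: e.F.C.Comp_assoc[symmetric] e.nat)
    also have "\<dots> = Comp C (Comp C (NAt e' ?y) (NAt \<xi> ?y)) (FArr F f)"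
      using f xy z[OF xy(2)] by (simp add: e.F.C.Comp_assoc)
    also have "\<dots> = Comp C (NAt e' ?y) (Comp C (FArr F' f) (NAt \<xi> ?x))"
      using f xy by (simp add: e.F.C.Comp_assoc[symmetric] \<xi>.nat)
    also have "\<dots> = Comp C (Comp C (FArr H' f) (NAt e' ?x)) (NAt \<xi> ?x)"
      using f xy e'.nat[OF f] by (simp add: e.F.C.Comp_assoc)
    also have "\<dots> = Comp C (FArr H' f) (Comp C (z ?x) (NAt e ?x))"
      using f xy z[OF xy(1)] by (simp add: e.F.C.Comp_assoc[symmetric])
    also have "\<dots> = Comp C (Comp C (FArr H' f) (z ?x)) (NAt e ?x)"
      using f xy by (intro e.F.C.Comp_assoc) auto
    finally have 1: "Comp C (Comp C (z ?y) (FArr H f)) (NAt e ?x) = Comp C (Comp C (FArr H' f) (z ?x)) (NAt e ?x)" .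
    have "Comp C (NAt m' ?y) (Comp C (z ?y) (FArr H f)) = Comp C (Comp C (NAt \<upsilon> ?y) (NAt m ?y)) (FArr H f)"
      using f xy z[OF xy(2)] by (simp add: e.F.C.Comp_assoc)
    also have "\<dots> = Comp C (NAt \<upsilon> ?y) (Comp C (FArr G f) (NAt m ?x))"
      using f xy by (simp add: e.F.C.Comp_assoc[symmetric] m.nat)
    also have "\<dots> = Comp C (Comp C (FArr G' f) (NAt \<upsilon> ?x)) (NAt m ?x)"
      using f xy \<upsilon>.nat[OF f] by (simp add: e.F.C.Comp_assoc)
    also have "\<dots> = Comp C (FArr G' f) (Comp C (NAt m' ?x) (z ?x))"
      using f xy z[OF xy(1)] by (simp add: e.F.C.Comp_assoc[symmetric])
    also have "\<dots> = Comp C (NAt m' ?y) (Comp C (FArr H' f) (z ?x))"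
      using f xy m'.nat[OF f] by (simp add: e.F.C.Comp_assoc)
    finally have 2: "Comp C (NAt m' ?y) (Comp C (z ?y) (FArr H f)) = Comp C (NAt m' ?y) (Comp C (FArr H' f) (z ?x))" .
    show ?thesis
      by (rule orthogonal_eq[OF e.F.C.category_axioms orth[OF xy] _ _ _ _ _ _ _ _ 1 2]) (use f xy in simp_all)
  qed
  let ?z = "\<lparr>NDom = H, NCod = H', NAt = restrict z (Obj D)\<rparr>"
  have "trans_between D C H H' ?z"
    by (rule trans_betweenI[OF e.G.functor_between_axioms e'.G.functor_between_axioms])
      (use natural in auto)
  then show ?thesis by (rule that) (use z in auto)
qed

section \<open>Closure properties of the two classes and pointwise factorisations\<close>

locale factorisation_system = category A
  for A :: "('o, 'm) cat" and E M :: "'m set" +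
  assumes ofs: "orthogonal_factorisation_system A E M"
begin

lemma E_iff: "f \<in> E \<longleftrightarrow> f \<in> Arr A \<and> (\<forall>m\<in>M. orthogonal A f m)"
  using ofs unfolding orthogonal_factorisation_system_def by blast

lemma M_iff: "f \<in> M \<longleftrightarrow> f \<in> Arr A \<and> (\<forall>e\<in>E. orthogonal A e f)"
  using ofs unfolding orthogonal_factorisation_system_def by blast

lemma E_in [simp]: "f \<in> E \<Longrightarrow> f \<in> Arr A" using E_iff by blast

lemma M_in [simp]: "f \<in> M \<Longrightarrow> f \<in> Arr A" using M_iff by blast

lemma orth: "\<lbrakk>e \<in> E; m \<in> M\<rbrakk> \<Longrightarrow> orthogonal A e m" using E_iff by blast

lemma factorise:
  assumes "f \<in> Arr A"
  obtains e m where "e \<in> E" "m \<in> M" "Cod A e = Dom A m" "f = Comp A m e"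
  using assms ofs unfolding orthogonal_factorisation_system_def by blast

text \<open>In a square that starts with an identity the upper side \<open>u\<close> is itself the
  diagonal. Variables contribute identities, so this is the base case of the induction over
  terms.\<close>

lemma Id_E [simp]:
  assumes a: "a \<in> Obj A"
  shows "Id A a \<in> E"
  unfolding E_iff orthogonal_def
proof (intro conjI ballI impI)
  have unit: "Comp A d (Id A a) = d" if "d \<in> Arr A" "Dom A d = a" for d
    using Comp_Id_right[of d] that by simp
  fix m u v
  assume "m \<in> M" "u \<in> Arr A" "v \<in> Arr A"
    and sq: "Dom A u = Dom A (Id A a) \<and> Cod A u = Dom A m \<and> Dom A v = Cod A (Id A a)
      \<and> Cod A v = Cod A m \<and> Comp A m u = Comp A v (Id A a)"
  then have "Comp A m u = v" using a unit[of v] by simp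
  then show "\<exists>!d. d \<in> Arr A \<and> Dom A d = Cod A (Id A a) \<and> Cod A d = Dom A m
      \<and> Comp A d (Id A a) = u \<and> Comp A m d = v"
    using sq a \<open>u \<in> Arr A\<close> unit by (intro ex1I[of _ u]) (simp, metis Cod_Id)
qed (use a in simp)

text \<open>Dually, in a square that ends with an identity the lower side \<open>v\<close> is the
  diagonal.\<close>

lemma Id_M [simp]:
  assumes a: "a \<in> Obj A"
  shows "Id A a \<in> M"
  unfolding M_iff orthogonal_def
proof (intro conjI ballI impI)
  have unit: "Comp A (Id A a) d = d" if "d \<in> Arr A" "Cod A d = a" for d
    using Comp_Id_left[of d] that by simp
  fix e u v
  assume "e \<in> E" "u \<in> Arr A" "v \<in> Arr A"
    and sq: "Dom A u = Dom A e \<and> Cod A u = Dom A (Id A a) \<and> Dom A v = Cod A e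
      \<and> Cod A v = Cod A (Id A a) \<and> Comp A (Id A a) u = Comp A v e"
  then have "u = Comp A v e" using a unit[of u] by simp
  then show "\<exists>!d. d \<in> Arr A \<and> Dom A d = Cod A e \<and> Cod A d = Dom A (Id A a)
      \<and> Comp A d e = u \<and> Comp A (Id A a) d = v"
    using sq a \<open>v \<in> Arr A\<close> unit by (intro ex1I[of _ v]) (simp, metis Dom_Id)
qed (use a in simp)

text \<open>Two diagonals in turn: the first is taken against \<open>f\<close> with lower side
  \<open>Comp A v g\<close>, and it becomes the upper side of the square whose diagonal against
  \<open>g\<close> is the one sought.\<close>

lemma Comp_E [simp]:
  assumes f: "f \<in> E" and g: "g \<in> E" and fg: "Dom A g = Cod A f"
  shows "Comp A g f \<in> E"
  unfolding E_iff orthogonal_def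
proof (intro conjI ballI impI)
  show "Comp A g f \<in> Arr A" using assms by simp
  fix m u v
  assume m: "m \<in> M" and uv: "u \<in> Arr A" "v \<in> Arr A"
    and "Dom A u = Dom A (Comp A g f) \<and> Cod A u = Dom A m \<and> Dom A v = Cod A (Comp A g f)
      \<and> Cod A v = Cod A m \<and> Comp A m u = Comp A v (Comp A g f)"
  then have sq: "Dom A u = Dom A f" "Cod A u = Dom A m" "Dom A v = Cod A g" "Cod A v = Cod A m"
    "Comp A m u = Comp A (Comp A v g) f"
    using assms by (auto simp: Comp_assoc)
  obtain d where d: "d \<in> Arr A" "Dom A d = Cod A f" "Cod A d = Dom A m" "Comp A d f = u"
    "Comp A m d = Comp A v g"
    by (rule orthogonal_ex[OF orth[OF f m], of u "Comp A v g"]) (use assms m uv sq in auto)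
  obtain d' where d': "d' \<in> Arr A" "Dom A d' = Cod A g" "Cod A d' = Dom A m" "Comp A d' g = d"
    "Comp A m d' = v"
    by (rule orthogonal_ex[OF orth[OF g m], of d v]) (use assms m uv sq d in auto)
  show "\<exists>!d. d \<in> Arr A \<and> Dom A d = Cod A (Comp A g f) \<and> Cod A d = Dom A m
      \<and> Comp A d (Comp A g f) = u \<and> Comp A m d = v"
  proof (rule ex1I[of _ d'])
    show "d' \<in> Arr A \<and> Dom A d' = Cod A (Comp A g f) \<and> Cod A d' = Dom A m
        \<and> Comp A d' (Comp A g f) = u \<and> Comp A m d' = v"
      using assms d d' by (simp add: Comp_assoc)
    fix x assume "x \<in> Arr A \<and> Dom A x = Cod A (Comp A g f) \<and> Cod A x = Dom A m
        \<and> Comp A x (Comp A g f) = u \<and> Comp A m x = v"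
    then have x: "x \<in> Arr A" "Dom A x = Cod A g" "Cod A x = Dom A m" "Comp A (Comp A x g) f = u" "Comp A m x = v"
      using assms by (auto simp: Comp_assoc)
    have "Comp A x g = d"
      using orthogonal_eq[OF category_axioms orth[OF f m], of "Comp A x g" d] assms m x d by (simp add: Comp_assoc)
    then show "x = d'"
      using orthogonal_eq[OF category_axioms orth[OF g m], of x d'] assms m x d' by simp
  qed
qed

text \<open>The dual argument: the diagonal against \<open>g\<close> comes first and serves as the
  lower side of the square against \<open>f\<close>.\<close>

lemma Comp_M [simp]:
  assumes f: "f \<in> M" and g: "g \<in> M" and fg: "Dom A g = Cod A f"
  shows "Comp A g f \<in> M"
  unfolding M_iff orthogonal_def
proof (intro conjI ballI impI)
  show "Comp A g f \<in> Arr A" using assms by simp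
  fix e u v
  assume e: "e \<in> E" and uv: "u \<in> Arr A" "v \<in> Arr A"
    and "Dom A u = Dom A e \<and> Cod A u = Dom A (Comp A g f) \<and> Dom A v = Cod A e
      \<and> Cod A v = Cod A (Comp A g f) \<and> Comp A (Comp A g f) u = Comp A v e"
  then have sq: "Dom A u = Dom A e" "Cod A u = Dom A f" "Dom A v = Cod A e" "Cod A v = Cod A g"
    "Comp A g (Comp A f u) = Comp A v e"
    using assms by (auto simp: Comp_assoc)
  obtain d where d: "d \<in> Arr A" "Dom A d = Cod A e" "Cod A d = Dom A g" "Comp A d e = Comp A f u"
    "Comp A g d = v"
    by (rule orthogonal_ex[OF orth[OF e g], of "Comp A f u" v]) (use assms e uv sq in auto)
  obtain d' where d': "d' \<in> Arr A" "Dom A d' = Cod A e" "Cod A d' = Dom A f" "Comp A d' e = u"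
    "Comp A f d' = d"
    by (rule orthogonal_ex[OF orth[OF e f], of u d]) (use assms e uv sq d in auto)
  show "\<exists>!d. d \<in> Arr A \<and> Dom A d = Cod A e \<and> Cod A d = Dom A (Comp A g f)
      \<and> Comp A d e = u \<and> Comp A (Comp A g f) d = v"
  proof (rule ex1I[of _ d'])
    show "d' \<in> Arr A \<and> Dom A d' = Cod A e \<and> Cod A d' = Dom A (Comp A g f)
        \<and> Comp A d' e = u \<and> Comp A (Comp A g f) d' = v"
      using assms d d' by (simp add: Comp_assoc[symmetric])
    fix x assume "x \<in> Arr A \<and> Dom A x = Cod A e \<and> Cod A x = Dom A (Comp A g f)
        \<and> Comp A x e = u \<and> Comp A (Comp A g f) x = v"
    then have x: "x \<in> Arr A" "Dom A x = Cod A e" "Cod A x = Dom A f" "Comp A x e = u" "Comp A g (Comp A f x) = v"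
      using assms by (auto simp: Comp_assoc)
    have "Comp A f x = d"
      using orthogonal_eq[OF category_axioms orth[OF e g], of "Comp A f x" d] assms e x d by (simp add: Comp_assoc[symmetric])
    then show "x = d'"
      using orthogonal_eq[OF category_axioms orth[OF e f], of x d'] assms e x d' by simp
  qed
qed

text \<open>Factor every component. On an arrow \<open>Z\<close> is the diagonal between the
  factorisations chosen at its two ends, and uniqueness of that diagonal gives both functor
  laws.\<close>

lemma pointwise_factorisation_ex:
  assumes "trans_between D A F G \<kappa>"
  shows "\<exists>Z e m. pointwise_factorisation E M \<kappa> Z e m"
proof -
  interpret \<kappa>: trans_between D A F G \<kappa> by fact
  \<comment> \<open>The two factors are chosen together as a pair, so that they belong to the same
    factorisation.\<close>
  have "\<exists>p. fst p \<in> E \<and> snd p \<in> M \<and> Cod A (fst p) = Dom A (snd p)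
      \<and> NAt \<kappa> x = Comp A (snd p) (fst p)" if x: "x \<in> Obj D" for x
  proof -
    obtain e m where "e \<in> E" "m \<in> M" "Cod A e = Dom A m" "NAt \<kappa> x = Comp A m e"
      by (rule factorise[OF \<kappa>.at_in[OF x]])
    then show ?thesis by (intro exI[of _ "(e, m)"]) simp
  qed
  then have "\<forall>x\<in>Obj D. \<exists>p. fst p \<in> E \<and> snd p \<in> M \<and> Cod A (fst p) = Dom A (snd p)
      \<and> NAt \<kappa> x = Comp A (snd p) (fst p)" by blast
  from bchoice[OF this] obtain p where p: "\<And>x. x \<in> Obj D \<Longrightarrow> fst (p x) \<in> E \<and> snd (p x) \<in> M
      \<and> Cod A (fst (p x)) = Dom A (snd (p x)) \<and> NAt \<kappa> x = Comp A (snd (p x)) (fst (p x))"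
    by blast
  define e m where "e x = fst (p x)" and "m x = snd (p x)" for x
  have em: "e x \<in> E \<and> m x \<in> M \<and> Cod A (e x) = Dom A (m x) \<and> NAt \<kappa> x = Comp A (m x) (e x)"
    if "x \<in> Obj D" for x
    using p[OF that] by (simp add: e_def m_def)
  have em_in [simp]: "e x \<in> E" "m x \<in> M" "Dom A (m x) = Cod A (e x)" "Dom A (e x) = FObj F x"
    "Cod A (m x) = FObj G x" and \<kappa>_eq: "NAt \<kappa> x = Comp A (m x) (e x)" if "x \<in> Obj D" for x
    using em[OF that] \<kappa>.Dom_at[OF that] \<kappa>.Cod_at[OF that] by auto
  have "\<exists>d. d \<in> Arr A \<and> Dom A d = Cod A (e (Dom D f)) \<and> Cod A d = Cod A (e (Cod D f))
      \<and> Comp A d (e (Dom D f)) = Comp A (e (Cod D f)) (FArr F f)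
      \<and> Comp A (m (Cod D f)) d = Comp A (FArr G f) (m (Dom D f))" if f: "f \<in> Arr D" for f
  proof -
    let ?x = "Dom D f" and ?y = "Cod D f"
    have xy: "?x \<in> Obj D" "?y \<in> Obj D" using f by auto
    have "Comp A (Comp A (m ?y) (e ?y)) (FArr F f) = Comp A (FArr G f) (Comp A (m ?x) (e ?x))"
      using \<kappa>.nat[OF f] by (simp only: \<kappa>_eq[OF xy(1)] \<kappa>_eq[OF xy(2)])
    then have sq: "Comp A (m ?y) (Comp A (e ?y) (FArr F f)) = Comp A (Comp A (FArr G f) (m ?x)) (e ?x)"
      using f xy by (simp add: Comp_assoc)

    show ?thesis
      by (rule orthogonal_ex[OF orth[of "e ?x" "m ?y"], of "Comp A (e ?y) (FArr F f)" "Comp A (FArr G f) (m ?x)"])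
        (use sq f xy in auto)
  qed
  then have "\<forall>f\<in>Arr D. \<exists>d. d \<in> Arr A \<and> Dom A d = Cod A (e (Dom D f)) \<and> Cod A d = Cod A (e (Cod D f))
      \<and> Comp A d (e (Dom D f)) = Comp A (e (Cod D f)) (FArr F f)
      \<and> Comp A (m (Cod D f)) d = Comp A (FArr G f) (m (Dom D f))" by blast
  from bchoice[OF this] obtain z where z: "\<And>f. f \<in> Arr D \<Longrightarrow>
      z f \<in> Arr A \<and> Dom A (z f) = Cod A (e (Dom D f)) \<and> Cod A (z f) = Cod A (e (Cod D f))
      \<and> Comp A (z f) (e (Dom D f)) = Comp A (e (Cod D f)) (FArr F f)
      \<and> Comp A (m (Cod D f)) (z f) = Comp A (FArr G f) (m (Dom D f))"
    by blast
  have z_in [simp]: "z f \<in> Arr A" "Dom A (z f) = Cod A (e (Dom D f))" "Cod A (z f) = Cod A (e (Cod D f))"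
    if "f \<in> Arr D" for f
    using z[OF that] by auto
  define Z where "Z = \<lparr>FDom = D, FCod = A, FObj = restrict (\<lambda>x. Cod A (e x)) (Obj D), FArr = restrict z (Arr D)\<rparr>"
  \<comment> \<open>The value on an arrow is recognised by its two triangles; preservation of
    identities and of composites is then a check of these triangles.\<close>
  have z_eqI: "z f = d" if "f \<in> Arr D" "d \<in> Arr A" "Dom A d = Cod A (e (Dom D f))"
    "Cod A d = Cod A (e (Cod D f))" "Comp A d (e (Dom D f)) = Comp A (e (Cod D f)) (FArr F f)"
    "Comp A (m (Cod D f)) d = Comp A (FArr G f) (m (Dom D f))" for f d
    by (rule orthogonal_eq[OF category_axioms orth[of "e (Dom D f)" "m (Cod D f)"]])
      (simp_all add: that z[OF that(1)])
  have Z: "functor_between D A Z"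
  proof (rule functor_betweenI)
    fix x assume x: "x \<in> Obj D"
    have "z (Id D x) = Id A (Cod A (e x))"
      using x Comp_Id_left[of "e x"] Comp_Id_right[of "e x"] Comp_Id_left[of "m x"] Comp_Id_right[of "m x"]
      by (intro z_eqI) auto
    then show "FArr Z (Id D x) = Id A (FObj Z x)" using x by (simp add: Z_def)
  next
    fix f g assume fg: "f \<in> Arr D" "g \<in> Arr D" "Dom D g = Cod D f"
    have "z (Comp D g f) = Comp A (z g) (z f)"
    proof (rule z_eqI)
      have "Comp A (Comp A (z g) (z f)) (e (Dom D f)) = Comp A (z g) (Comp A (e (Cod D f)) (FArr F f))"
        using fg z[OF fg(1)] by (simp add: Comp_assoc[symmetric])
      also have "\<dots> = Comp A (Comp A (e (Cod D g)) (FArr F g)) (FArr F f)"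
        using fg z[OF fg(2)] by (simp add: Comp_assoc)
      also have "\<dots> = Comp A (e (Cod D g)) (FArr F (Comp D g f))"
        using fg by (simp add: Comp_assoc \<kappa>.F.arr_Comp)
      finally show "Comp A (Comp A (z g) (z f)) (e (Dom D (Comp D g f)))
          = Comp A (e (Cod D (Comp D g f))) (FArr F (Comp D g f))"
        using fg by simp
      have "Comp A (m (Cod D g)) (Comp A (z g) (z f)) = Comp A (FArr G g) (Comp A (m (Cod D f)) (z f))"
        using fg z[OF fg(2)] by (simp add: Comp_assoc)
      also have "\<dots> = Comp A (FArr G (Comp D g f)) (m (Dom D f))"
        using fg z[OF fg(1)] by (simp add: Comp_assoc \<kappa>.G.arr_Comp)
      finally show "Comp A (m (Cod D (Comp D g f))) (Comp A (z g) (z f))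
          = Comp A (FArr G (Comp D g f)) (m (Dom D (Comp D g f)))"
        using fg by simp
    qed (use fg in auto)
    then show "FArr Z (Comp D g f) = Comp A (FArr Z g) (FArr Z f)" using fg by (simp add: Z_def)
  qed (auto simp: Z_def \<kappa>.F.D.category_axioms category_axioms)
  let ?e = "\<lparr>NDom = F, NCod = Z, NAt = restrict e (Obj D)\<rparr>"
  let ?m = "\<lparr>NDom = Z, NCod = G, NAt = restrict m (Obj D)\<rparr>"
  have e: "trans_between D A F Z ?e"
    by (rule trans_betweenI[OF \<kappa>.F.functor_between_axioms Z]) (simp_all add: Z_def z)
  have m: "trans_between D A Z G ?m"
    by (rule trans_betweenI[OF Z \<kappa>.G.functor_between_axioms]) (simp_all add: Z_def z)
  have "vcomp_ntrans ?m ?e = \<kappa>"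
    by (rule ntrans_eqI)
      (simp_all add: trans_between.trans[OF trans_between_vcomp_ntrans[OF e m]] \<kappa>.trans \<kappa>_eq)
  then show ?thesis
    using functor_between.ftor[OF Z] trans_between.trans[OF e] trans_between.trans[OF m]
    by - (rule exI[of _ Z], rule exI[of _ ?e], rule exI[of _ ?m],
      simp add: pointwise_factorisation_def pointwise_in_def functor_between.FDom[OF Z])
qed

end

section \<open>Evaluation of terms\<close>

lemma map_nth_length: "length xs = n \<Longrightarrow> map ((!) xs) [0..<n] = xs"
  using map_nth by auto

text \<open>Polymorphic in the values, so that one recursion and one substitution lemma serve
  objects and arrows. The arity passed to the interpretation is read off from the argument list, in
  agreement with \<open>trms\<close>.\<close>

primrec eval :: "(nat \<times> 'f \<Rightarrow> 'v list \<Rightarrow> 'v) \<Rightarrow> 'v list \<Rightarrow> 'f trm \<Rightarrow> 'v" where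
  "eval \<phi> xs (Var i) = xs ! i"
| "eval \<phi> xs (Op f ts) = \<phi> (length ts, f) (map (eval \<phi> xs) ts)"

abbreviation eval_obj :: "('f, 'o, 'm) omega_alg \<Rightarrow> 'o list \<Rightarrow> 'f trm \<Rightarrow> 'o" where
  "eval_obj P \<equiv> eval (\<lambda>p. FObj (AOp P p))"

abbreviation eval_arr :: "('f, 'o, 'm) omega_alg \<Rightarrow> 'm list \<Rightarrow> 'f trm \<Rightarrow> 'm" where
  "eval_arr P \<equiv> eval (\<lambda>p. FArr (AOp P p))"

lemma eval_subst:
  assumes "t \<in> trms \<Omega> (length us)"
  shows "eval \<phi> xs (subst ((!) us) t) = eval \<phi> (map (eval \<phi> xs) us) t"
  using assms by induction (auto simp: o_def cong: map_cong)

lemma subst_in_trms: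
  assumes "t \<in> trms \<Omega> (length us)" "set us \<subseteq> trms \<Omega> n"
  shows "subst ((!) us) t \<in> trms \<Omega> n"
  using assms by induction (auto intro!: trms.Op)

definition term_ftor ::
  "('f, 'o, 'm) omega_alg \<Rightarrow> nat \<Rightarrow> 'f trm list \<Rightarrow> ('o list, 'm list, 'o list, 'm list) ftor" where
  "term_ftor P n ts =
    \<lparr>FDom = pow_cat (ACarrier P) n, FCod = pow_cat (ACarrier P) (length ts),
     FObj = restrict (\<lambda>xs. map (eval_obj P xs) ts) (Obj (pow_cat (ACarrier P) n)),
     FArr = restrict (\<lambda>fs. map (eval_arr P fs) ts) (Arr (pow_cat (ACarrier P) n))\<rparr>"

locale omega_alg_on =
  fixes \<Omega> :: "nat \<Rightarrow> 'f set" and A :: "('o, 'm) cat" and P :: "('f, 'o, 'm) omega_alg"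
  assumes alg: "omega_algebra \<Omega> P" and carrier [simp]: "ACarrier P = A"
begin

sublocale category A
  using alg unfolding omega_algebra_def by simp

lemma op: "f \<in> \<Omega> n \<Longrightarrow> functor_between (pow_cat A n) A (AOp P (n, f))"
  using alg unfolding omega_algebra_def by (auto intro: functor_between.intro)

lemma eval_obj_in [simp]:
  assumes "t \<in> trms \<Omega> (length xs)" "\<forall>i<length xs. xs ! i \<in> Obj A"
  shows "eval_obj P xs t \<in> Obj A"
  using assms
proof induction
  case (Op f ts)
  then interpret functor_between "pow_cat A (length ts)" A "AOp P (length ts, f)" by (simp add: op)
  show ?case using Op by (auto intro!: obj_in)
qed simp

lemma eval_arr:
  assumes "t \<in> trms \<Omega> (length fs)" "\<forall>i<length fs. fs ! i \<in> Arr A"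
  shows eval_arr_in [simp]: "eval_arr P fs t \<in> Arr A"
    and Dom_eval_arr [simp]: "Dom A (eval_arr P fs t) = eval_obj P (map (Dom A) fs) t"
    and Cod_eval_arr [simp]: "Cod A (eval_arr P fs t) = eval_obj P (map (Cod A) fs) t"
proof -
  have "eval_arr P fs t \<in> Arr A \<and> Dom A (eval_arr P fs t) = eval_obj P (map (Dom A) fs) t
      \<and> Cod A (eval_arr P fs t) = eval_obj P (map (Cod A) fs) t"
    using assms
  proof induction
    case (Op f ts)
    then interpret functor_between "pow_cat A (length ts)" A "AOp P (length ts, f)" by (simp add: op)
    have in_Arr: "map (eval_arr P fs) ts \<in> Arr (pow_cat A (length ts))" using Op by auto
    have "map (Dom A \<circ> eval_arr P fs) ts = map (eval_obj P (map (Dom A) fs)) ts"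
      "map (Cod A \<circ> eval_arr P fs) ts = map (eval_obj P (map (Cod A) fs)) ts"
      using Op by auto
    then show ?case
      using arr_in[OF in_Arr] Dom_arr[OF in_Arr] Cod_arr[OF in_Arr] by (simp del: map_eq_conv)
  qed auto
  then show "eval_arr P fs t \<in> Arr A" "Dom A (eval_arr P fs t) = eval_obj P (map (Dom A) fs) t"
    "Cod A (eval_arr P fs t) = eval_obj P (map (Cod A) fs) t" by auto
qed

lemma eval_arr_Id:
  assumes "t \<in> trms \<Omega> n" "xs \<in> Obj (pow_cat A n)"
  shows "eval_arr P (map (Id A) xs) t = Id A (eval_obj P xs t)"
  using assms
proof induction
  case (Op f ts)
  then interpret functor_between "pow_cat A (length ts)" A "AOp P (length ts, f)" by (simp add: op)
  have "map (eval_arr P (map (Id A) xs)) ts = map (Id A) (map (eval_obj P xs) ts)"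
    using Op by auto
  then have "eval_arr P (map (Id A) xs) (Op f ts)
      = FArr (AOp P (length ts, f)) (Id (pow_cat A (length ts)) (map (eval_obj P xs) ts))"
    by (simp only: eval.simps pow_cat_simps)
  also have "\<dots> = Id A (eval_obj P xs (Op f ts))"
    using Op by (subst arr_Id) auto
  finally show ?case .
qed simp

lemma eval_arr_Comp:
  assumes "t \<in> trms \<Omega> n" "fs \<in> Arr (pow_cat A n)" "gs \<in> Arr (pow_cat A n)"
    "map (Dom A) gs = map (Cod A) fs"
  shows "eval_arr P (map2 (Comp A) gs fs) t = Comp A (eval_arr P gs t) (eval_arr P fs t)"
  using assms
proof induction
  case (Op f ts)
  then interpret functor_between "pow_cat A (length ts)" A "AOp P (length ts, f)" by (simp add: op)
  have bd: "Dom A (eval_arr P gs t) = Cod A (eval_arr P fs t)" if "t \<in> set ts" for t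
    using Op that by simp
  have "map (eval_arr P (map2 (Comp A) gs fs)) ts
      = Comp (pow_cat A (length ts)) (map (eval_arr P gs) ts) (map (eval_arr P fs) ts)"
    using Op by (auto simp: list_eq_iff_nth_eq)
  then have "eval_arr P (map2 (Comp A) gs fs) (Op f ts)
      = FArr (AOp P (length ts, f))
          (Comp (pow_cat A (length ts)) (map (eval_arr P gs) ts) (map (eval_arr P fs) ts))"
    by (simp only: eval.simps)
  also have "\<dots> = Comp A (eval_arr P gs (Op f ts)) (eval_arr P fs (Op f ts))"
    using Op by (subst arr_Comp) (auto simp: bd)
  finally show ?case .
qed simp

lemma functor_term_ftor:
  assumes "set ts \<subseteq> trms \<Omega> n"
  shows "functor_between (pow_cat A n) (pow_cat A (length ts)) (term_ftor P n ts)"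
proof -
  have ts: "t \<in> trms \<Omega> n" if "t \<in> set ts" for t using that assms by auto
  interpret P: category "pow_cat A n" by (rule category_pow_cat) unfold_locales
  show ?thesis
  proof (rule functor_betweenI)
    show "category (pow_cat A n)" "category (pow_cat A (length ts))"
      by (simp_all add: category_pow_cat category_axioms)
    fix x assume x: "x \<in> Obj (pow_cat A n)"
    then have "map (Id A) x \<in> Arr (pow_cat A n)" by simp
    then show "FArr (term_ftor P n ts) (Id (pow_cat A n) x)
        = Id (pow_cat A (length ts)) (FObj (term_ftor P n ts) x)"
      using x ts eval_arr_Id[OF _ x] by (simp add: term_ftor_def)
  next
    fix f g assume fg: "f \<in> Arr (pow_cat A n)" "g \<in> Arr (pow_cat A n)"
      "Dom (pow_cat A n) g = Cod (pow_cat A n) f"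
    then have gf: "map2 (Comp A) g f \<in> Arr (pow_cat A n)" using P.Comp_in[of f g] by simp
    show "FArr (term_ftor P n ts) (Comp (pow_cat A n) g f)
        = Comp (pow_cat A (length ts)) (FArr (term_ftor P n ts) g) (FArr (term_ftor P n ts) f)"
      using fg gf ts eval_arr_Comp[OF _ fg(1,2)] by (simp add: term_ftor_def list_eq_iff_nth_eq)
  qed (use ts in \<open>auto simp: term_ftor_def\<close>)
qed

lemma term_ftor_Var:
  "term_ftor P n (map Var [0..<n]) = id_ftor (pow_cat A n)"
  by (auto simp: term_ftor_def id_ftor_def o_def restrict_def fun_eq_iff map_nth)

text \<open>Composition in \<open>free_theory\<close> is substitution, so this is functoriality of
  the extension of an algebra to all 1-cells.\<close>

lemma term_ftor_subst:
  assumes "set ts \<subseteq> trms \<Omega> n" "set us \<subseteq> trms \<Omega> (length ts)"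
  shows "term_ftor P n (map (subst ((!) ts)) us) = comp_ftor (term_ftor P (length ts) us) (term_ftor P n ts)"
    (is "?L = ?R")
proof (rule ftor_eqI)
  have us: "set (map (subst ((!) ts)) us) \<subseteq> trms \<Omega> n"
    using assms subst_in_trms[OF _ assms(1)] by auto
  show "cat_functor ?L" by (rule functor_between.ftor[OF functor_term_ftor[OF us]])
  show "cat_functor ?R"
    by (intro cat_functor_comp_ftor functor_between.ftor[OF functor_term_ftor] assms)
      (simp add: term_ftor_def)
  show "FDom ?L = FDom ?R" "FCod ?L = FCod ?R" by (simp_all add: term_ftor_def)
  have us: "u \<in> trms \<Omega> (length ts)" if "u \<in> set us" for u using that assms by auto
  have ts: "t \<in> trms \<Omega> n" if "t \<in> set ts" for t using that assms by auto
  show "FObj ?L x = FObj ?R x" if "x \<in> Obj (FDom ?R)" for x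
    using that us ts by (simp add: term_ftor_def eval_subst[OF us])
  show "FArr ?L x = FArr ?R x" if "x \<in> Arr (FDom ?R)" for x
    using that us ts by (simp add: term_ftor_def eval_subst[OF us])
qed

text \<open>Forgetting the extension of an algebra gives the algebra back;
  \<open>proj_ftor A 1 0\<close> removes the list of length 1.\<close>

lemma term_ftor_Op:
  assumes f: "f \<in> \<Omega> n"
  shows "comp_ftor (proj_ftor A 1 0) (term_ftor P n [Op f (map Var [0..<n])]) = AOp P (n, f)"
proof -
  have t: "set [Op f (map Var [0..<n])] \<subseteq> trms \<Omega> n" using f by (auto intro!: trms.intros)
  interpret f: functor_between "pow_cat A n" A "AOp P (n, f)" by (rule op[OF f])
  interpret t: functor_between "pow_cat A n" "pow_cat A 1" "term_ftor P n [Op f (map Var [0..<n])]"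
    using functor_term_ftor[OF t] by simp
  have "cat_functor (comp_ftor (proj_ftor A 1 0) (term_ftor P n [Op f (map Var [0..<n])]))"
    by (rule cat_functor_comp_ftor[OF t.ftor cat_functor_proj_ftor]) (simp_all add: category_axioms)
  then show ?thesis
    by (rule ftor_eqI[OF _ f.ftor])
      (simp_all add: term_ftor_def o_def map_nth_length)
qed

end

text \<open>The second clause is the oplax composition law for the cell of \<open>f\<close> after a
  tuple: first the cell of \<open>f\<close> at the evaluated arguments, then \<open>Q\<close> at
  \<open>f\<close> applied to the cells of the arguments. Variables get identities because they
  stand for projections, where an oplax morphism is strict.\<close>

primrec eval_cell ::
  "('f, 'o, 'm) omega_alg \<Rightarrow> ('f, 'o, 'm) omega_alg
    \<Rightarrow> (nat \<times> 'f \<Rightarrow> ('o list, 'm list, 'o, 'm) ntrans) \<Rightarrow> 'o list \<Rightarrow> 'f trm \<Rightarrow> 'm" where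
  "eval_cell P Q c xs (Var i) = Id (ACarrier P) (xs ! i)"
| "eval_cell P Q c xs (Op f ts) =
    Comp (ACarrier P) (FArr (AOp Q (length ts, f)) (map (eval_cell P Q c xs) ts))
      (NAt (c (length ts, f)) (map (eval_obj P xs) ts))"

definition term_ntrans ::
  "('f, 'o, 'm) omega_alg \<Rightarrow> ('f, 'o, 'm) omega_alg
    \<Rightarrow> (nat \<times> 'f \<Rightarrow> ('o list, 'm list, 'o, 'm) ntrans) \<Rightarrow> nat \<Rightarrow> 'f trm list
    \<Rightarrow> ('o list, 'm list, 'o list, 'm list) ntrans" where
  "term_ntrans P Q c n ts =
    \<lparr>NDom = term_ftor P n ts, NCod = term_ftor Q n ts,
     NAt = restrict (\<lambda>xs. map (eval_cell P Q c xs) ts) (Obj (pow_cat (ACarrier P) n))\<rparr>"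

text \<open>An oplax morphism of Omega-algebras over the identity functor, with the composites with
  that identity stripped off.\<close>

locale omega_cells =
  P: omega_alg_on \<Omega> A P + Q: omega_alg_on \<Omega> A Q
  for \<Omega> :: "nat \<Rightarrow> 'f set" and A :: "('o, 'm) cat" and P Q :: "('f, 'o, 'm) omega_alg" +
  fixes c :: "nat \<times> 'f \<Rightarrow> ('o list, 'm list, 'o, 'm) ntrans"
  assumes cell: "f \<in> \<Omega> n \<Longrightarrow> trans_between (pow_cat A n) A (AOp P (n, f)) (AOp Q (n, f)) (c (n, f))"
begin

lemma eval_cell:
  assumes "t \<in> trms \<Omega> (length xs)" "\<forall>i<length xs. xs ! i \<in> Obj A"
  shows eval_cell_in [simp]: "eval_cell P Q c xs t \<in> Arr A"
    and Dom_eval_cell [simp]: "Dom A (eval_cell P Q c xs t) = eval_obj P xs t"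
    and Cod_eval_cell [simp]: "Cod A (eval_cell P Q c xs t) = eval_obj Q xs t"
proof -
  have "eval_cell P Q c xs t \<in> Arr A \<and> Dom A (eval_cell P Q c xs t) = eval_obj P xs t
      \<and> Cod A (eval_cell P Q c xs t) = eval_obj Q xs t"
    using assms
  proof induction
    case (Op f ts)
    then interpret c: trans_between "pow_cat A (length ts)" A "AOp P (length ts, f)" "AOp Q (length ts, f)"
      "c (length ts, f)" by (simp add: cell)
    have in_Arr: "map (eval_cell P Q c xs) ts \<in> Arr (pow_cat A (length ts))"
      and in_Obj: "map (eval_obj P xs) ts \<in> Obj (pow_cat A (length ts))"
      using Op by auto
    have "map (Dom A \<circ> eval_cell P Q c xs) ts = map (eval_obj P xs) ts"
      "map (Cod A \<circ> eval_cell P Q c xs) ts = map (eval_obj Q xs) ts"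
      using Op by auto
    then show ?case
      using c.G.arr_in[OF in_Arr] c.G.Dom_arr[OF in_Arr] c.G.Cod_arr[OF in_Arr] c.at_in[OF in_Obj]
        c.Dom_at[OF in_Obj] c.Cod_at[OF in_Obj] by (simp del: map_eq_conv)
  qed auto
  then show "eval_cell P Q c xs t \<in> Arr A" "Dom A (eval_cell P Q c xs t) = eval_obj P xs t"
    "Cod A (eval_cell P Q c xs t) = eval_obj Q xs t" by auto
qed

text \<open>Naturality of the cell of \<open>f\<close> deals with the outermost symbol;
  functoriality of \<open>Q\<close> at \<open>f\<close> then lets the induction hypothesis act on
  the arguments.\<close>

lemma eval_cell_nat:
  assumes "t \<in> trms \<Omega> n" "fs \<in> Arr (pow_cat A n)"
  shows "Comp A (eval_cell P Q c (map (Cod A) fs) t) (eval_arr P fs t)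
    = Comp A (eval_arr Q fs t) (eval_cell P Q c (map (Dom A) fs) t)"
  using assms
proof induction
  case (Op f ts)
  then interpret c: trans_between "pow_cat A (length ts)" A "AOp P (length ts, f)" "AOp Q (length ts, f)"
    "c (length ts, f)" by (simp add: cell)
  let ?A = "pow_cat A (length ts)" and ?P = "FArr (AOp P (length ts, f))" and ?Q = "FArr (AOp Q (length ts, f))"
  let ?xs = "map (Dom A) fs" and ?ys = "map (Cod A) fs"
  have fs: "?xs \<in> Obj (pow_cat A n)" "?ys \<in> Obj (pow_cat A n)" using Op by auto
  have in_Arr: "map (eval_cell P Q c ?xs) ts \<in> Arr ?A" "map (eval_cell P Q c ?ys) ts \<in> Arr ?A"
    "map (eval_arr P fs) ts \<in> Arr ?A" "map (eval_arr Q fs) ts \<in> Arr ?A"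
    using Op fs by auto
  have in_Obj: "map (eval_obj P ?xs) ts \<in> Obj ?A" "map (eval_obj P ?ys) ts \<in> Obj ?A"
    using Op fs by auto
  have bd: "Dom ?A (map (eval_arr P fs) ts) = map (eval_obj P ?xs) ts"
    "Cod ?A (map (eval_arr P fs) ts) = map (eval_obj P ?ys) ts"
    "Dom ?A (map (eval_arr Q fs) ts) = map (eval_obj Q ?xs) ts"
    "Cod ?A (map (eval_arr Q fs) ts) = map (eval_obj Q ?ys) ts"
    "Dom ?A (map (eval_cell P Q c ?xs) ts) = map (eval_obj P ?xs) ts"
    "Cod ?A (map (eval_cell P Q c ?xs) ts) = map (eval_obj Q ?xs) ts"
    "Dom ?A (map (eval_cell P Q c ?ys) ts) = map (eval_obj P ?ys) ts"
    "Cod ?A (map (eval_cell P Q c ?ys) ts) = map (eval_obj Q ?ys) ts"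
    using Op fs by auto
  have IH: "Comp ?A (map (eval_cell P Q c ?ys) ts) (map (eval_arr P fs) ts)
      = Comp ?A (map (eval_arr Q fs) ts) (map (eval_cell P Q c ?xs) ts)"
    using Op by (auto simp: list_eq_iff_nth_eq)
  have "Comp A (eval_cell P Q c ?ys (Op f ts)) (eval_arr P fs (Op f ts))
      = Comp A (?Q (map (eval_cell P Q c ?ys) ts))
          (Comp A (NAt (c (length ts, f)) (map (eval_obj P ?ys) ts)) (?P (map (eval_arr P fs) ts)))"
    using in_Arr in_Obj bd by (simp add: P.Comp_assoc del: in_Obj_pow in_Arr_pow pow_cat_simps)
  also have "\<dots> = Comp A (?Q (map (eval_cell P Q c ?ys) ts))
      (Comp A (?Q (map (eval_arr P fs) ts)) (NAt (c (length ts, f)) (map (eval_obj P ?xs) ts)))"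
    using c.nat[OF in_Arr(3)] by (simp only: bd)
  also have "\<dots> = Comp A (?Q (Comp ?A (map (eval_cell P Q c ?ys) ts) (map (eval_arr P fs) ts)))
      (NAt (c (length ts, f)) (map (eval_obj P ?xs) ts))"
    using in_Arr in_Obj bd by (simp add: P.Comp_assoc c.G.arr_Comp del: in_Obj_pow in_Arr_pow pow_cat_simps)
  also have "\<dots> = Comp A (eval_arr Q fs (Op f ts)) (eval_cell P Q c ?xs (Op f ts))"
    using in_Arr in_Obj bd unfolding IH
    by (simp add: P.Comp_assoc c.G.arr_Comp del: in_Obj_pow in_Arr_pow pow_cat_simps)
  finally show ?case .
qed (auto simp: P.Comp_Id_left P.Comp_Id_right)

text \<open>As substitution is composition of 1-cells, this is the oplax composition law for the
  extended cells. In the step for \<open>Op\<close>, functoriality of \<open>Q\<close> at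
  \<open>f\<close> separates the inner tuple from the outer term.\<close>

lemma eval_cell_subst:
  assumes "t \<in> trms \<Omega> (length us)" "set us \<subseteq> trms \<Omega> n" "xs \<in> Obj (pow_cat A n)"
  shows "eval_cell P Q c xs (subst ((!) us) t)
    = Comp A (eval_arr Q (map (eval_cell P Q c xs) us) t) (eval_cell P Q c (map (eval_obj P xs) us) t)"
  using assms
proof induction
  case (Var i)
  then have "us ! i \<in> trms \<Omega> n" by auto
  then show ?case
    using Var P.Comp_Id_right[of "eval_cell P Q c xs (us ! i)"] by simp
next
  case (Op f ts)
  then interpret c: trans_between "pow_cat A (length ts)" A "AOp P (length ts, f)" "AOp Q (length ts, f)"
    "c (length ts, f)" by (simp add: cell)
  let ?A = "pow_cat A (length ts)" and ?Q = "FArr (AOp Q (length ts, f))"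
  let ?cs = "map (eval_cell P Q c xs) us" and ?ys = "map (eval_obj P xs) us"
  have us: "\<And>u. u \<in> set us \<Longrightarrow> u \<in> trms \<Omega> n" using Op by auto
  have fs: "?cs \<in> Arr (pow_cat A (length us))" "?ys \<in> Obj (pow_cat A (length us))" using Op us by auto
  have Dom_cs: "map (Dom A) ?cs = ?ys" using Op us by auto
  have in_Arr: "map (eval_cell P Q c ?ys) ts \<in> Arr ?A" "map (eval_arr Q ?cs) ts \<in> Arr ?A"
    using Op fs by auto
  have in_Obj: "map (eval_obj P ?ys) ts \<in> Obj ?A"
    using Op fs by auto
  have "Dom A (eval_arr Q ?cs t) = eval_obj Q ?ys t" if "t \<in> set ts" for t
    using Op fs that by (simp add: Dom_cs del: map_map)
  then have bd: "Dom ?A (map (eval_arr Q ?cs) ts) = map (eval_obj Q ?ys) ts"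
    "Dom ?A (map (eval_cell P Q c ?ys) ts) = map (eval_obj P ?ys) ts"
    "Cod ?A (map (eval_cell P Q c ?ys) ts) = map (eval_obj Q ?ys) ts"
    using Op fs by auto
  have IH: "map (eval_cell P Q c xs) (map (subst ((!) us)) ts)
      = Comp ?A (map (eval_arr Q ?cs) ts) (map (eval_cell P Q c ?ys) ts)"
    using Op by (auto simp: list_eq_iff_nth_eq)
  have ob: "map (eval_obj P xs) (map (subst ((!) us)) ts) = map (eval_obj P ?ys) ts"
    using Op by (auto simp: eval_subst[where \<Omega> = \<Omega>])
  have "eval_cell P Q c xs (subst ((!) us) (Op f ts))
      = Comp A (?Q (Comp ?A (map (eval_arr Q ?cs) ts) (map (eval_cell P Q c ?ys) ts)))
          (NAt (c (length ts, f)) (map (eval_obj P ?ys) ts))"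
    by (simp only: subst.simps eval_cell.simps IH ob length_map P.carrier)
  also have "\<dots> = Comp A (eval_arr Q ?cs (Op f ts)) (eval_cell P Q c ?ys (Op f ts))"
    using in_Arr in_Obj bd by (simp add: P.Comp_assoc c.G.arr_Comp del: in_Obj_pow in_Arr_pow pow_cat_simps map_map)
  finally show ?case .
qed

lemma trans_term_ntrans:
  assumes "set ts \<subseteq> trms \<Omega> n"
  shows "trans_between (pow_cat A n) (pow_cat A (length ts)) (term_ftor P n ts) (term_ftor Q n ts)
    (term_ntrans P Q c n ts)"
proof -
  have ts: "t \<in> trms \<Omega> n" if "t \<in> set ts" for t using that assms by auto
  interpret P: category "pow_cat A n" by (rule category_pow_cat) unfold_locales
  show ?thesis
  proof (rule trans_betweenI[OF P.functor_term_ftor[OF assms] Q.functor_term_ftor[OF assms]])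
    fix f assume f: "f \<in> Arr (pow_cat A n)"
    then have "map (Dom A) f \<in> Obj (pow_cat A n)" "map (Cod A) f \<in> Obj (pow_cat A n)" by auto
    then show "Comp (pow_cat A (length ts)) (NAt (term_ntrans P Q c n ts) (Cod (pow_cat A n) f)) (FArr (term_ftor P n ts) f)
        = Comp (pow_cat A (length ts)) (FArr (term_ftor Q n ts) f) (NAt (term_ntrans P Q c n ts) (Dom (pow_cat A n) f))"
      using f ts eval_cell_nat[OF _ f] by (simp add: term_ntrans_def term_ftor_def list_eq_iff_nth_eq)
  qed (use ts in \<open>auto simp: term_ntrans_def term_ftor_def\<close>)
qed

text \<open>Tuples of variables are the 1-cells that come from \<open>J\<close>, so this gives
  strictness of the extended cells along \<open>J\<close>.\<close>

lemma term_ntrans_Var: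
  assumes "set as \<subseteq> {..<n}"
  shows "term_ntrans P Q c n (map Var as) = id_ntrans (term_ftor P n (map Var as))"
proof -
  have "set (map Var as) \<subseteq> trms \<Omega> n" using assms by (auto intro: trms.Var)
  note t = trans_term_ntrans[OF this]
  interpret t: trans_between "pow_cat A n" "pow_cat A (length as)" "term_ftor P n (map Var as)"
    "term_ftor Q n (map Var as)" "term_ntrans P Q c n (map Var as)" using t by simp
  have "term_ftor Q n (map Var as) = term_ftor P n (map Var as)"
    by (simp add: term_ftor_def o_def)
  then show ?thesis
    using assms
    by (intro ntrans_eqI t.trans trans_between.trans[OF trans_between_id_ntrans[OF t.F.functor_between_axioms]])
      (auto simp: term_ntrans_def term_ftor_def)
qed

lemma NAt_term_ntrans_subst:
  assumes "set ts \<subseteq> trms \<Omega> n" "set us \<subseteq> trms \<Omega> (length ts)" "xs \<in> Obj (pow_cat A n)"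
  shows "NAt (term_ntrans P Q c n (map (subst ((!) ts)) us)) xs
    = Comp (pow_cat A (length us)) (FArr (term_ftor Q (length ts) us) (NAt (term_ntrans P Q c n ts) xs))
        (NAt (term_ntrans P Q c (length ts) us) (FObj (term_ftor P n ts) xs))"
proof -
  have ts: "t \<in> trms \<Omega> n" if "t \<in> set ts" for t using that assms by auto
  have us: "u \<in> trms \<Omega> (length ts)" if "u \<in> set us" for u using that assms by auto
  interpret t: trans_between "pow_cat A n" "pow_cat A (length ts)" "term_ftor P n ts" "term_ftor Q n ts"
    "term_ntrans P Q c n ts" by (rule trans_term_ntrans[OF assms(1)])
  have "FObj (term_ftor P n ts) xs \<in> Obj (pow_cat A (length ts))" "NAt (term_ntrans P Q c n ts) xs \<in> Arr (pow_cat A (length ts))"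
    using assms(3) by (rule t.F.obj_in t.at_in)+
  then show ?thesis
    using assms(3) us eval_cell_subst[OF us assms(1,3)] by (simp add: term_ntrans_def term_ftor_def list_eq_iff_nth_eq)
qed

text \<open>The arguments are variables, so the recursion leaves \<open>Q\<close> at
  \<open>f\<close> of a tuple of identities, which is an identity, after the given cell. Hence
  forgetting the extended cells recovers \<open>c\<close>.\<close>

lemma term_ntrans_Op:
  assumes f: "f \<in> \<Omega> n"
  shows "hcomp_ntrans (id_ntrans (proj_ftor A 1 0)) (term_ntrans P Q c n [Op f (map Var [0..<n])]) = c (n, f)"
proof -
  have t: "set [Op f (map Var [0..<n])] \<subseteq> trms \<Omega> n" using f by (auto intro!: trms.intros)
  interpret f: trans_between "pow_cat A n" A "AOp P (n, f)" "AOp Q (n, f)" "c (n, f)" by (rule cell[OF f])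
  interpret t: trans_between "pow_cat A n" "pow_cat A 1" "term_ftor P n [Op f (map Var [0..<n])]"
    "term_ftor Q n [Op f (map Var [0..<n])]" "term_ntrans P Q c n [Op f (map Var [0..<n])]"
    using trans_term_ntrans[OF t] by simp
  have p: "functor_between (pow_cat A 1) A (proj_ftor A 1 0)"
    by (simp add: functor_between_def cat_functor_proj_ftor P.category_axioms)
  note w = whisker_left[OF p t.trans_between_axioms]
  show ?thesis
  proof (rule ntrans_eqI[OF trans_between.trans[OF w(1)] f.trans])
    fix x assume "x \<in> Obj (FDom (NDom (c (n, f))))"
    then have x: "x \<in> Obj (pow_cat A n)" by simp
    have ids: "map (\<lambda>i. Id A (x ! i)) [0..<n] = map (Id A) x" using x by (simp add: list_eq_iff_nth_eq)
    have "NAt (term_ntrans P Q c n [Op f (map Var [0..<n])]) x = [Comp A (FArr (AOp Q (n, f)) (Id (pow_cat A n) x)) (NAt (c (n, f)) x)]"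
      using x ids by (simp add: term_ntrans_def o_def map_nth_length)
    also have "\<dots> = [NAt (c (n, f)) x]"
      using x P.Comp_Id_left[of "NAt (c (n, f)) x"] by (simp del: pow_cat_simps in_Obj_pow)
    finally have eq: "NAt (term_ntrans P Q c n [Op f (map Var [0..<n])]) x = [NAt (c (n, f)) x]" .
    show "NAt (hcomp_ntrans (id_ntrans (proj_ftor A 1 0)) (term_ntrans P Q c n [Op f (map Var [0..<n])])) x = NAt (c (n, f)) x"
      unfolding w(2)[OF x] eq using f.at_in[OF x] by simp
  qed (simp_all add: P.term_ftor_Op[OF f] Q.term_ftor_Op[OF f] del: One_nat_def)
qed

lemma omega_oplax_morphism_id:
  assumes "c \<in> extensional (Sigma UNIV \<Omega>)"
  shows "omega_oplax_morphism \<Omega> P Q \<lparr>MFun = id_ftor A, MCell = c\<rparr>"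
proof -
  have "nat_transf (c (n, f)) \<and> NDom (c (n, f)) = comp_ftor (id_ftor A) (AOp P (n, f))
      \<and> NCod (c (n, f)) = comp_ftor (AOp Q (n, f)) (pow_ftor (id_ftor A) n)" if f: "f \<in> \<Omega> n" for n f
  proof -
    interpret c: trans_between "pow_cat A n" A "AOp P (n, f)" "AOp Q (n, f)" "c (n, f)" by (rule cell[OF f])
    show ?thesis
      by (simp add: c.trans pow_ftor_id_ftor comp_id_ftor comp_ftor_id c.F.ftor c.G.ftor)
  qed
  then show ?thesis
    using assms
    by (simp add: omega_oplax_morphism_def P.alg Q.alg cat_functor_id_ftor P.category_axioms)
qed

end

text \<open>A factorisation of the cells at the operations spreads to all terms. The exchange needed
  is naturality of the cell of \<open>f\<close> in \<open>d\<close> at the tuple \<open>?cs\<close>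
  of cells of the arguments.\<close>

lemma eval_cell_comp:
  assumes "omega_cells \<Omega> A P Q c" "omega_cells \<Omega> A Q R d"
    and b: "\<And>n f xs. \<lbrakk>f \<in> \<Omega> n; xs \<in> Obj (pow_cat A n)\<rbrakk>
      \<Longrightarrow> NAt (b (n, f)) xs = Comp A (NAt (d (n, f)) xs) (NAt (c (n, f)) xs)"
    and "t \<in> trms \<Omega> n" "xs \<in> Obj (pow_cat A n)"
  shows "eval_cell P R b xs t = Comp A (eval_cell Q R d xs t) (eval_cell P Q c xs t)"
proof -
  interpret c: omega_cells \<Omega> A P Q c by fact
  interpret d: omega_cells \<Omega> A Q R d by fact
  show ?thesis
    using assms(4,5)
  proof induction
    case (Var i)
    then show ?case using c.P.Comp_Id_left[of "Id A (xs ! i)"] by simp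
  next
    case (Op f ts)
    then interpret cf: trans_between "pow_cat A (length ts)" A "AOp P (length ts, f)" "AOp Q (length ts, f)"
      "c (length ts, f)" by (simp add: c.cell)
    interpret df: trans_between "pow_cat A (length ts)" A "AOp Q (length ts, f)" "AOp R (length ts, f)"
      "d (length ts, f)" using Op by (simp add: d.cell)
    let ?A = "pow_cat A (length ts)" and ?Q = "FArr (AOp Q (length ts, f))" and ?R = "FArr (AOp R (length ts, f))"
    let ?c = "NAt (c (length ts, f))" and ?d = "NAt (d (length ts, f))"
    let ?cs = "map (eval_cell P Q c xs) ts" and ?ds = "map (eval_cell Q R d xs) ts"
    let ?ps = "map (eval_obj P xs) ts" and ?qs = "map (eval_obj Q xs) ts"
    have ins: "?cs \<in> Arr ?A" "?ds \<in> Arr ?A" "?ps \<in> Obj ?A" "?qs \<in> Obj ?A" using Op by auto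
    have bd: "Dom ?A ?cs = ?ps" "Cod ?A ?cs = ?qs" "Dom ?A ?ds = ?qs" using Op by auto
    have IH: "map (eval_cell P R b xs) ts = Comp ?A ?ds ?cs"
      using Op by (auto simp: list_eq_iff_nth_eq)
    have "eval_cell P R b xs (Op f ts) = Comp A (?R (Comp ?A ?ds ?cs)) (Comp A (?d ?ps) (?c ?ps))"
      using Op by (simp only: eval_cell.simps IH b[OF Op.hyps(1) ins(3)] c.P.carrier)
    also have "\<dots> = Comp A (?R ?ds) (Comp A (Comp A (?R ?cs) (?d ?ps)) (?c ?ps))"
      using ins bd by (simp add: c.P.Comp_assoc df.G.arr_Comp del: in_Obj_pow in_Arr_pow pow_cat_simps)
    also have "\<dots> = Comp A (?R ?ds) (Comp A (Comp A (?d ?qs) (?Q ?cs)) (?c ?ps))"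
      using df.nat[OF ins(1)] by (simp only: bd)
    also have "\<dots> = Comp A (eval_cell Q R d xs (Op f ts)) (eval_cell P Q c xs (Op f ts))"
      using ins bd by (simp add: c.P.Comp_assoc del: in_Obj_pow in_Arr_pow pow_cat_simps)
    finally show ?case .
  qed
qed

section \<open>Membership of the extended cells in the two classes\<close>

context factorisation_system
begin

text \<open>The components at a term are given by applying \<^term>\<open>Q\<close> to components at subterms; naturality
  turns this into an application of \<^term>\<open>P\<close>, which is the one that preserves \<^term>\<open>E\<close>.\<close>

lemma eval_cell_E:
  assumes "omega_cells \<Omega> A P Q c" "\<And>n f. f \<in> \<Omega> n \<Longrightarrow> preserves_pointwise n (AOp P (n, f)) E"
    and "\<And>n f. f \<in> \<Omega> n \<Longrightarrow> pointwise_in E (c (n, f))"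
    and "t \<in> trms \<Omega> n" "xs \<in> Obj (pow_cat A n)"
  shows "eval_cell P Q c xs t \<in> E"
proof -
  interpret c: omega_cells \<Omega> A P Q c by fact
  show ?thesis
    using assms(4,5)
  proof induction
    case (Op f ts)
    then interpret cf: trans_between "pow_cat A (length ts)" A "AOp P (length ts, f)" "AOp Q (length ts, f)"
      "c (length ts, f)" by (simp add: c.cell)
    let ?A = "pow_cat A (length ts)" and ?P = "FArr (AOp P (length ts, f))" and ?c = "NAt (c (length ts, f))"
    let ?cs = "map (eval_cell P Q c xs) ts" and ?qs = "map (eval_obj Q xs) ts"
    have ins: "?cs \<in> Arr ?A" "?qs \<in> Obj ?A" using Op by auto
    have bd: "Dom ?A ?cs = map (eval_obj P xs) ts" "Cod ?A ?cs = ?qs" using Op by auto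
    have "?P ?cs \<in> E" using Op.IH Op.prems
      by (intro assms(2)[OF Op.hyps(1), unfolded preserves_pointwise_def, rule_format]) auto
    moreover have "?c ?qs \<in> E"
      using assms(3)[OF Op.hyps(1)] ins unfolding pointwise_in_def by (simp del: in_Obj_pow)
    ultimately have "Comp A (?c ?qs) (?P ?cs) \<in> E"
      using ins bd by (intro Comp_E) (simp_all del: in_Obj_pow in_Arr_pow pow_cat_simps)
    then show ?case using cf.nat[OF ins(1)] by (simp only: bd eval_cell.simps c.P.carrier)
  qed simp
qed

text \<open>The recursion already applies \<open>Q\<close>, which here is the algebra that preserves
  M, so closure of M under composition applies directly.\<close>

lemma eval_cell_M:
  assumes "omega_cells \<Omega> A P Q c" "\<And>n f. f \<in> \<Omega> n \<Longrightarrow> preserves_pointwise n (AOp Q (n, f)) M"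
    and "\<And>n f. f \<in> \<Omega> n \<Longrightarrow> pointwise_in M (c (n, f))"
    and "t \<in> trms \<Omega> n" "xs \<in> Obj (pow_cat A n)"
  shows "eval_cell P Q c xs t \<in> M"
proof -
  interpret c: omega_cells \<Omega> A P Q c by fact
  show ?thesis
    using assms(4,5)
  proof induction
    case (Op f ts)
    then interpret cf: trans_between "pow_cat A (length ts)" A "AOp P (length ts, f)" "AOp Q (length ts, f)"
      "c (length ts, f)" by (simp add: c.cell)
    let ?A = "pow_cat A (length ts)" and ?Q = "FArr (AOp Q (length ts, f))" and ?c = "NAt (c (length ts, f))"
    let ?cs = "map (eval_cell P Q c xs) ts" and ?ps = "map (eval_obj P xs) ts"
    have ins: "?cs \<in> Arr ?A" "?ps \<in> Obj ?A" using Op by auto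
    have bd: "Dom ?A ?cs = ?ps" using Op by auto
    have "?Q ?cs \<in> M" using Op.IH Op.prems
      by (intro assms(2)[OF Op.hyps(1), unfolded preserves_pointwise_def, rule_format]) auto
    moreover have "?c ?ps \<in> M"
      using assms(3)[OF Op.hyps(1)] ins unfolding pointwise_in_def by (simp del: in_Obj_pow)
    ultimately have "Comp A (?Q ?cs) (?c ?ps) \<in> M"
      using ins bd by (intro Comp_M) (simp_all del: in_Obj_pow in_Arr_pow pow_cat_simps)
    then show ?case by simp
  qed simp
qed

end

section \<open>Algebras for a 2-theory with free underlying theory\<close>

lemma singleton_nth [simp]: "length xs = Suc 0 \<Longrightarrow> [xs ! 0] = xs"
  by (cases xs) auto

lemma underlying_cat_simps [simp]:
  "Obj (underlying_cat T) = Obj T" "Arr (underlying_cat T) = Arr T"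
  "Dom (underlying_cat T) = Dom T" "Cod (underlying_cat T) = Cod T"
  "Id (underlying_cat T) = Id T" "Comp (underlying_cat T) = Comp T"
  by (simp_all add: underlying_cat_def cat.truncate_def)

lemma vert_cat_simps [simp]:
  "Obj (vert_cat T) = Arr T" "Arr (vert_cat T) = Cell T"
  "Dom (vert_cat T) = Dom2 T" "Cod (vert_cat T) = Cod2 T"
  "Id (vert_cat T) = Id2 T" "Comp (vert_cat T) = VComp T"
  by (simp_all add: vert_cat_def)

lemma horiz_cat_simps [simp]:
  "Obj (horiz_cat T) = Obj T" "Arr (horiz_cat T) = Cell T"
  "Dom (horiz_cat T) = (\<lambda>\<tau>. Dom T (Dom2 T \<tau>))" "Cod (horiz_cat T) = (\<lambda>\<tau>. Cod T (Dom2 T \<tau>))"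
  "Id (horiz_cat T) = (\<lambda>a. Id2 T (Id T a))" "Comp (horiz_cat T) = HComp T"
  by (simp_all add: horiz_cat_def)

lemma Cat2_simps [simp]:
  "Obj Cat2 = {C. category C}" "Arr Cat2 = {F. cat_functor F}" "Dom Cat2 = FDom" "Cod Cat2 = FCod"
  "Id Cat2 = id_ftor" "Comp Cat2 = comp_ftor"
  "Cell Cat2 = {\<alpha>. nat_transf \<alpha>}" "Dom2 Cat2 = NDom" "Cod2 Cat2 = NCod" "Id2 Cat2 = id_ntrans"
  "VComp Cat2 = vcomp_ntrans" "HComp Cat2 = hcomp_ntrans"
  by (simp_all add: Cat2_def)

lemma fin_op_simps [simp]:
  "(n, as) \<in> Arr fin_op \<longleftrightarrow> set as \<subseteq> {..<n}" "Dom fin_op (n, as) = n" "Cod fin_op (n, as) = length as"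
  by (simp_all add: op_cat_def fin_cat_def)

lemma free_theory_simps [simp]:
  "Obj (free_theory \<Omega>) = UNIV" "(n, ts) \<in> Arr (free_theory \<Omega>) \<longleftrightarrow> set ts \<subseteq> trms \<Omega> n"
  "Dom (free_theory \<Omega>) (n, ts) = n" "Cod (free_theory \<Omega>) (n, ts) = length ts"
  "Id (free_theory \<Omega>) n = (n, map Var [0..<n])"
  "Comp (free_theory \<Omega>) (m, us) (n, ts) = (n, map (subst ((!) ts)) us)"
  by (simp_all add: free_theory_def)

section \<open>2-theories with free underlying theory: 1-cells as tuples of terms\<close>

locale free_2theory =
  fixes \<Omega> :: "nat \<Rightarrow> 'f set" and T :: "(nat, 'a, 'c) two_cat" and J :: "('a, 'c) theory_map"
    and I :: "('f, 'a) free_iso"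
  assumes lawvere: "lawvere_2theory T J" and free: "underlying_free \<Omega> T J I"
begin

sublocale two_category T
  using lawvere unfolding lawvere_2theory_def by simp

sublocale T1: category "underlying_cat T"
  by (rule underlying_category)

sublocale T2: category "vert_cat T"
  by (rule vert_category)

sublocale T3: category "horiz_cat T"
  by (rule horiz_category)

lemma Obj_T [simp]: "Obj T = UNIV"
  using lawvere unfolding lawvere_2theory_def by simp

lemma two_cat_in [simp]:
  "\<lbrakk>f \<in> Arr T; g \<in> Arr T; Dom T g = Cod T f\<rbrakk> \<Longrightarrow> Comp T g f \<in> Arr T"
  "\<lbrakk>f \<in> Arr T; g \<in> Arr T; Dom T g = Cod T f\<rbrakk> \<Longrightarrow> Dom T (Comp T g f) = Dom T f"
  "\<lbrakk>f \<in> Arr T; g \<in> Arr T; Dom T g = Cod T f\<rbrakk> \<Longrightarrow> Cod T (Comp T g f) = Cod T g"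
  "Id T n \<in> Arr T" "Dom T (Id T n) = n" "Cod T (Id T n) = n"
  "\<tau> \<in> Cell T \<Longrightarrow> Dom2 T \<tau> \<in> Arr T" "\<tau> \<in> Cell T \<Longrightarrow> Cod2 T \<tau> \<in> Arr T"
  "\<tau> \<in> Cell T \<Longrightarrow> Dom T (Cod2 T \<tau>) = Dom T (Dom2 T \<tau>)"
  "\<tau> \<in> Cell T \<Longrightarrow> Cod T (Cod2 T \<tau>) = Cod T (Dom2 T \<tau>)"
  "f \<in> Arr T \<Longrightarrow> Id2 T f \<in> Cell T" "f \<in> Arr T \<Longrightarrow> Dom2 T (Id2 T f) = f" "f \<in> Arr T \<Longrightarrow> Cod2 T (Id2 T f) = f"
  "\<lbrakk>\<tau> \<in> Cell T; \<sigma> \<in> Cell T; Dom2 T \<sigma> = Cod2 T \<tau>\<rbrakk> \<Longrightarrow> VComp T \<sigma> \<tau> \<in> Cell T"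
  "\<lbrakk>\<tau> \<in> Cell T; \<sigma> \<in> Cell T; Dom2 T \<sigma> = Cod2 T \<tau>\<rbrakk> \<Longrightarrow> Dom2 T (VComp T \<sigma> \<tau>) = Dom2 T \<tau>"
  "\<lbrakk>\<tau> \<in> Cell T; \<sigma> \<in> Cell T; Dom2 T \<sigma> = Cod2 T \<tau>\<rbrakk> \<Longrightarrow> Cod2 T (VComp T \<sigma> \<tau>) = Cod2 T \<sigma>"
  "\<lbrakk>\<tau> \<in> Cell T; \<sigma> \<in> Cell T; Dom T (Dom2 T \<sigma>) = Cod T (Dom2 T \<tau>)\<rbrakk> \<Longrightarrow> HComp T \<sigma> \<tau> \<in> Cell T"
  "\<lbrakk>\<tau> \<in> Cell T; \<sigma> \<in> Cell T; Dom T (Dom2 T \<sigma>) = Cod T (Dom2 T \<tau>)\<rbrakk>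
    \<Longrightarrow> Dom2 T (HComp T \<sigma> \<tau>) = Comp T (Dom2 T \<sigma>) (Dom2 T \<tau>)"
  "\<lbrakk>\<tau> \<in> Cell T; \<sigma> \<in> Cell T; Dom T (Dom2 T \<sigma>) = Cod T (Dom2 T \<tau>)\<rbrakk>
    \<Longrightarrow> Cod2 T (HComp T \<sigma> \<tau>) = Comp T (Cod2 T \<sigma>) (Cod2 T \<tau>)"
  using T1.Comp_in[of f g] T1.Dom_Comp[of f g] T1.Cod_Comp[of f g] T1.Id_in[of n] T1.Dom_Id[of n] T1.Cod_Id[of n]
    T2.Dom_in[of \<tau>] T2.Cod_in[of \<tau>] Dom_Cod2[of \<tau>] Cod_Cod2[of \<tau>] T2.Id_in[of f] T2.Dom_Id[of f] T2.Cod_Id[of f]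
    T2.Comp_in[of \<tau> \<sigma>] T2.Dom_Comp[of \<tau> \<sigma>] T2.Cod_Comp[of \<tau> \<sigma>] T3.Comp_in[of \<tau> \<sigma>] Dom2_HComp[of \<sigma> \<tau>] Cod2_HComp[of \<sigma> \<tau>]
  by simp_all

lemma FObj_I [simp]: "FObj I n = n"
  and FDom_I [simp]: "FDom I = free_theory \<Omega>"
  and FCod_I [simp]: "FCod I = underlying_cat T"
  using free unfolding underlying_free_def by simp_all

lemma bij_I: "bij_betw (FArr I) (Arr (free_theory \<Omega>)) (Arr T)"
  using free unfolding underlying_free_def iso_functor_def by (metis underlying_cat_simps(2))

sublocale I: cat_functor I
  using free unfolding underlying_free_def iso_functor_def by simp

lemma Arr_cases:
  assumes "g \<in> Arr T"
  obtains n ts where "set ts \<subseteq> trms \<Omega> n" "g = FArr I (n, ts)"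
proof -
  have "g \<in> FArr I ` Arr (free_theory \<Omega>)" using bij_I assms by (simp add: bij_betw_def)
  then show ?thesis using that by (metis free_theory_simps(2) imageE surj_pair)
qed

lemma I_in [simp]: "set ts \<subseteq> trms \<Omega> n \<Longrightarrow> FArr I (n, ts) \<in> Arr T"
  using I.FArr_in[of "(n, ts)"] by simp

lemma Dom_I [simp]: "set ts \<subseteq> trms \<Omega> n \<Longrightarrow> Dom T (FArr I (n, ts)) = n"
  using I.Dom_FArr[of "(n, ts)"] by simp

lemma Cod_I [simp]: "set ts \<subseteq> trms \<Omega> n \<Longrightarrow> Cod T (FArr I (n, ts)) = length ts"
  using I.Cod_FArr[of "(n, ts)"] by simp

lemma Id_eq: "Id T n = FArr I (n, map Var [0..<n])"
  using I.FArr_Id[of n] by simp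

lemma Comp_I:
  assumes "set ts \<subseteq> trms \<Omega> n" "set us \<subseteq> trms \<Omega> (length ts)"
  shows "Comp T (FArr I (length ts, us)) (FArr I (n, ts)) = FArr I (n, map (subst ((!) ts)) us)"
  using I.FArr_Comp[of "(n, ts)" "(length ts, us)"] assms by simp

lemma J_eq: "set as \<subseteq> {..<n} \<Longrightarrow> TF1 J (n, as) = FArr I (n, map Var as)"
  using free unfolding underlying_free_def by (auto dest!: bspec[of _ _ "(n, as)"])

lemma proj_eq: "i < n \<Longrightarrow> TF1 J (fin_proj n i) = FArr I (n, [Var i])"
  by (simp add: fin_proj_def J_eq)

lemma set_Var_trms [simp]: "set as \<subseteq> {..<n} \<Longrightarrow> Var ` set as \<subseteq> trms \<Omega> n"
  by (auto intro: trms.Var)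

lemma Var_trms [simp]: "i < n \<Longrightarrow> Var i \<in> trms \<Omega> n"
  by (rule trms.Var)

lemma Op_Var_trms [simp]: "f \<in> \<Omega> n \<Longrightarrow> Op f (map Var [0..<n]) \<in> trms \<Omega> n"
  by (auto intro!: trms.Op trms.Var)

text \<open>The values of models and the cells of oplax morphisms are prescribed at projections.
  This decomposition and \<open>op_comp\<close> reduce any tuple of terms to projections and
  operations.\<close>

lemma proj_comp:
  assumes "set ts \<subseteq> trms \<Omega> n" "i < length ts"
  shows "FArr I (n, [ts ! i]) = Comp T (TF1 J (fin_proj (length ts) i)) (FArr I (n, ts))"
  using assms by (simp add: proj_eq Comp_I)

lemma op_comp:
  assumes "f \<in> \<Omega> (length ts)" "set ts \<subseteq> trms \<Omega> n"
  shows "FArr I (n, [Op f ts]) = Comp T (op_cell I (length ts) f) (FArr I (n, ts))"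
  using assms by (simp add: op_cell_def Comp_I o_def map_nth)

end

section \<open>Models are determined on 1-cells by their operations\<close>

lemma functor_between_two_functor:
  assumes "two_functor S K F"
  shows "functor_between (underlying_cat S) (underlying_cat K)
      \<lparr>FDom = underlying_cat S, FCod = underlying_cat K, FObj = TF0 F, FArr = TF1 F\<rparr>"
    and "functor_between (vert_cat S) (vert_cat K)
      \<lparr>FDom = vert_cat S, FCod = vert_cat K, FObj = TF1 F, FArr = TF2 F\<rparr>"
    and "functor_between (horiz_cat S) (horiz_cat K)
      \<lparr>FDom = horiz_cat S, FCod = horiz_cat K, FObj = TF0 F, FArr = TF2 F\<rparr>"
  using assms unfolding two_functor_def functor_between_def by simp_all

locale two_algebra = free_2theory \<Omega> T J I
  for \<Omega> :: "nat \<Rightarrow> 'f set" and T :: "(nat, 'a, 'c) two_cat" and J :: "('a, 'c) theory_map"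
    and I :: "('f, 'a) free_iso" +
  fixes A :: "('o, 'm) cat" and X :: "('a, 'c, 'o, 'm) model"
  assumes algebra: "algebra_on T J A X"
begin

sublocale A: category A
  using algebra unfolding algebra_on_def by simp

lemma two_functor_X: "two_functor T Cat2 X"
  using algebra unfolding algebra_on_def by simp

sublocale X1: functor_between "underlying_cat T" "underlying_cat Cat2"
    "\<lparr>FDom = underlying_cat T, FCod = underlying_cat Cat2, FObj = TF0 X, FArr = TF1 X\<rparr>"
  by (rule functor_between_two_functor[OF two_functor_X])

sublocale X2: functor_between "vert_cat T" "vert_cat Cat2"
    "\<lparr>FDom = vert_cat T, FCod = vert_cat Cat2, FObj = TF1 X, FArr = TF2 X\<rparr>"
  by (rule functor_between_two_functor[OF two_functor_X])

sublocale X3: functor_between "horiz_cat T" "horiz_cat Cat2"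
    "\<lparr>FDom = horiz_cat T, FCod = horiz_cat Cat2, FObj = TF0 X, FArr = TF2 X\<rparr>"
  by (rule functor_between_two_functor[OF two_functor_X])

lemma TF0_X [simp]: "TF0 X n = pow_cat A n"
  using algebra unfolding algebra_on_def by simp

lemma TF1_proj: "i < n \<Longrightarrow> TF1 X (TF1 J (fin_proj n i)) = comp_ftor (unary_ftor A) (proj_ftor A n i)"
  using algebra unfolding algebra_on_def by simp

lemma TF1_between: "g \<in> Arr T \<Longrightarrow> functor_between (pow_cat A (Dom T g)) (pow_cat A (Cod T g)) (TF1 X g)"
  using X1.arr_in[of g] X1.Dom_arr[of g] X1.Cod_arr[of g] by (simp add: functor_between_def)

lemma TF1_Id: "TF1 X (Id T n) = id_ftor (pow_cat A n)"
  using X1.arr_Id[of n] by simp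

lemma TF1_Comp:
  "\<lbrakk>f \<in> Arr T; g \<in> Arr T; Dom T g = Cod T f\<rbrakk> \<Longrightarrow> TF1 X (Comp T g f) = comp_ftor (TF1 X g) (TF1 X f)"
  using X1.arr_Comp[of f g] by simp

lemma TF2_between:
  assumes "\<tau> \<in> Cell T"
  shows "trans_between (pow_cat A (Dom T (Dom2 T \<tau>))) (pow_cat A (Cod T (Dom2 T \<tau>)))
    (TF1 X (Dom2 T \<tau>)) (TF1 X (Cod2 T \<tau>)) (TF2 X \<tau>)"
proof -
  interpret functor_between "pow_cat A (Dom T (Dom2 T \<tau>))" "pow_cat A (Cod T (Dom2 T \<tau>))" "TF1 X (Dom2 T \<tau>)"
    using assms by (simp add: TF1_between)
  show ?thesis
    using assms X2.arr_in[of \<tau>] X2.Dom_arr[of \<tau>] X2.Cod_arr[of \<tau>] by (simp add: trans_between_def)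
qed

lemma TF2_Id2: "g \<in> Arr T \<Longrightarrow> TF2 X (Id2 T g) = id_ntrans (TF1 X g)"
  using X2.arr_Id[of g] by simp

lemma TF2_VComp:
  "\<lbrakk>\<tau> \<in> Cell T; \<sigma> \<in> Cell T; Dom2 T \<sigma> = Cod2 T \<tau>\<rbrakk> \<Longrightarrow> TF2 X (VComp T \<sigma> \<tau>) = vcomp_ntrans (TF2 X \<sigma>) (TF2 X \<tau>)"
  using X2.arr_Comp[of \<tau> \<sigma>] by simp

lemma TF2_HComp:
  "\<lbrakk>\<tau> \<in> Cell T; \<sigma> \<in> Cell T; Dom T (Dom2 T \<sigma>) = Cod T (Dom2 T \<tau>)\<rbrakk>
    \<Longrightarrow> TF2 X (HComp T \<sigma> \<tau>) = hcomp_ntrans (TF2 X \<sigma>) (TF2 X \<tau>)"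
  using X3.arr_Comp[of \<tau> \<sigma>] by simp

lemma TF1_ext: "TF1 X \<in> extensional (Arr T)"
  using cat_functor.FArr_PiE[OF X1.ftor] by (simp add: PiE_iff)

lemma TF2_ext: "TF2 X \<in> extensional (Cell T)"
  using cat_functor.FArr_PiE[OF X2.ftor] by (simp add: PiE_iff)

abbreviation UX :: "('f, 'o, 'm) omega_alg" where "UX \<equiv> forget_alg \<Omega> I A X"

lemma op_cell_in [simp]:
  "f \<in> \<Omega> n \<Longrightarrow> op_cell I n f \<in> Arr T" "f \<in> \<Omega> n \<Longrightarrow> Dom T (op_cell I n f) = n"
  "f \<in> \<Omega> n \<Longrightarrow> Cod T (op_cell I n f) = 1"
  by (simp_all add: op_cell_def)

lemma functor_proj: "functor_between (pow_cat A 1) A (proj_ftor A 1 0)"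
  by (simp add: functor_between_def cat_functor_proj_ftor A.category_axioms)

lemma AOp_UX: "f \<in> \<Omega> n \<Longrightarrow> AOp UX (n, f) = comp_ftor (proj_ftor A 1 0) (TF1 X (op_cell I n f))"
  by (simp add: forget_alg_def)

lemma AOp_UX_between: "f \<in> \<Omega> n \<Longrightarrow> functor_between (pow_cat A n) A (AOp UX (n, f))"
  unfolding AOp_UX using TF1_between[of "op_cell I n f"]
  by (auto intro!: functor_between_comp_ftor functor_proj simp del: One_nat_def)

sublocale UX: omega_alg_on \<Omega> A UX
proof
  show "omega_algebra \<Omega> UX"
    unfolding omega_algebra_def using AOp_UX_between
    by (auto simp: functor_between_def A.category_axioms forget_alg_def)
qed (simp add: forget_alg_def)

text \<open>Follow the tuple by the i-th projection, whose value in a model is fixed. The brackets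
  come from identifying \<open>A\<close> with its first power.\<close>

lemma TF1_component:
  assumes "set ts \<subseteq> trms \<Omega> n" "i < length ts"
  shows "xs \<in> Obj (pow_cat A n) \<Longrightarrow> FObj (TF1 X (FArr I (n, [ts ! i]))) xs = [FObj (TF1 X (FArr I (n, ts))) xs ! i]"
    and "fs \<in> Arr (pow_cat A n) \<Longrightarrow> FArr (TF1 X (FArr I (n, [ts ! i]))) fs = [FArr (TF1 X (FArr I (n, ts))) fs ! i]"
proof -
  interpret functor_between "pow_cat A n" "pow_cat A (length ts)" "TF1 X (FArr I (n, ts))"
    using TF1_between[of "FArr I (n, ts)"] assms by simp
  have eq: "TF1 X (FArr I (n, [ts ! i]))
      = comp_ftor (comp_ftor (unary_ftor A) (proj_ftor A (length ts) i)) (TF1 X (FArr I (n, ts)))"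
    unfolding proj_comp[OF assms] TF1_proj[OF assms(2), symmetric]
    by (rule TF1_Comp) (use assms in \<open>simp_all add: proj_eq\<close>)
  show "FObj (TF1 X (FArr I (n, [ts ! i]))) xs = [FObj (TF1 X (FArr I (n, ts))) xs ! i]"
    if "xs \<in> Obj (pow_cat A n)"
    using that obj_in[OF that] assms(2) by (simp add: eq)
  show "FArr (TF1 X (FArr I (n, [ts ! i]))) fs = [FArr (TF1 X (FArr I (n, ts))) fs ! i]"
    if "fs \<in> Arr (pow_cat A n)"
    using that arr_in[OF that] assms(2) by (simp add: eq)
qed

text \<open>The claim for single terms is a hypothesis because the lemma is used inside the
  induction that proves that claim, where it is the induction hypothesis for the arguments.\<close>

lemma TF1_tuple:
  assumes "set ts \<subseteq> trms \<Omega> n"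
  shows "\<lbrakk>xs \<in> Obj (pow_cat A n); \<And>t. t \<in> set ts \<Longrightarrow> FObj (TF1 X (FArr I (n, [t]))) xs = [eval_obj UX xs t]\<rbrakk>
      \<Longrightarrow> FObj (TF1 X (FArr I (n, ts))) xs = map (eval_obj UX xs) ts"
    and "\<lbrakk>fs \<in> Arr (pow_cat A n); \<And>t. t \<in> set ts \<Longrightarrow> FArr (TF1 X (FArr I (n, [t]))) fs = [eval_arr UX fs t]\<rbrakk>
      \<Longrightarrow> FArr (TF1 X (FArr I (n, ts))) fs = map (eval_arr UX fs) ts"
proof -
  interpret functor_between "pow_cat A n" "pow_cat A (length ts)" "TF1 X (FArr I (n, ts))"
    using TF1_between[of "FArr I (n, ts)"] assms by simp
  show "FObj (TF1 X (FArr I (n, ts))) xs = map (eval_obj UX xs) ts"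
    if "xs \<in> Obj (pow_cat A n)" "\<And>t. t \<in> set ts \<Longrightarrow> FObj (TF1 X (FArr I (n, [t]))) xs = [eval_obj UX xs t]"
  proof (rule nth_equalityI)
    show "length (FObj (TF1 X (FArr I (n, ts))) xs) = length (map (eval_obj UX xs) ts)"
      using obj_in[OF that(1)] by simp
    show "FObj (TF1 X (FArr I (n, ts))) xs ! i = map (eval_obj UX xs) ts ! i"
      if "i < length (FObj (TF1 X (FArr I (n, ts))) xs)" for i
      using that \<open>xs \<in> _\<close> obj_in[OF \<open>xs \<in> _\<close>] TF1_component(1)[OF assms, of i xs]
        \<open>\<And>t. t \<in> set ts \<Longrightarrow> _\<close>[of "ts ! i"] by simp
  qed
  show "FArr (TF1 X (FArr I (n, ts))) fs = map (eval_arr UX fs) ts"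
    if "fs \<in> Arr (pow_cat A n)" "\<And>t. t \<in> set ts \<Longrightarrow> FArr (TF1 X (FArr I (n, [t]))) fs = [eval_arr UX fs t]"
  proof (rule nth_equalityI)
    show "length (FArr (TF1 X (FArr I (n, ts))) fs) = length (map (eval_arr UX fs) ts)"
      using arr_in[OF that(1)] by simp
    show "FArr (TF1 X (FArr I (n, ts))) fs ! i = map (eval_arr UX fs) ts ! i"
      if "i < length (FArr (TF1 X (FArr I (n, ts))) fs)" for i
      using that \<open>fs \<in> _\<close> arr_in[OF \<open>fs \<in> _\<close>] TF1_component(2)[OF assms, of i fs]
        \<open>\<And>t. t \<in> set ts \<Longrightarrow> _\<close>[of "ts ! i"] by simp
  qed
qed

text \<open>A variable is a projection, and a compound term is an operation cell after the tuple of
  its arguments, so functoriality of the model reproduces the recursion of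
  \<open>eval\<close>.\<close>

lemma TF1_single:
  assumes "t \<in> trms \<Omega> n"
  shows "xs \<in> Obj (pow_cat A n) \<Longrightarrow> FObj (TF1 X (FArr I (n, [t]))) xs = [eval_obj UX xs t]"
    and "fs \<in> Arr (pow_cat A n) \<Longrightarrow> FArr (TF1 X (FArr I (n, [t]))) fs = [eval_arr UX fs t]"
proof -
  have "(xs \<in> Obj (pow_cat A n) \<longrightarrow> FObj (TF1 X (FArr I (n, [t]))) xs = [eval_obj UX xs t])
      \<and> (fs \<in> Arr (pow_cat A n) \<longrightarrow> FArr (TF1 X (FArr I (n, [t]))) fs = [eval_arr UX fs t])"
    using assms
  proof induction
    case (Var i)
    then show ?case by (auto simp: proj_eq[symmetric] TF1_proj)
  next
    case (Op f ts)
    let ?k = "length ts"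
    have ts: "set ts \<subseteq> trms \<Omega> n" using Op by auto
    interpret t: functor_between "pow_cat A n" "pow_cat A ?k" "TF1 X (FArr I (n, ts))"
      using TF1_between[of "FArr I (n, ts)"] ts by simp
    interpret f: functor_between "pow_cat A ?k" "pow_cat A 1" "TF1 X (op_cell I ?k f)"
      using TF1_between[of "op_cell I ?k f"] Op by simp
    have eq: "TF1 X (FArr I (n, [Op f ts])) = comp_ftor (TF1 X (op_cell I ?k f)) (TF1 X (FArr I (n, ts)))"
      using TF1_Comp[of "FArr I (n, ts)" "op_cell I ?k f"] ts Op by (simp add: op_comp)
    show ?case
    proof (intro conjI impI)
      assume xs: "xs \<in> Obj (pow_cat A n)"
      have "FObj (TF1 X (FArr I (n, ts))) xs = map (eval_obj UX xs) ts"
        using TF1_tuple(1)[OF ts xs] Op.IH xs by simp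
      moreover have "map (eval_obj UX xs) ts \<in> Obj (pow_cat A ?k)"
        using t.obj_in[OF xs] calculation by simp
      ultimately show "FObj (TF1 X (FArr I (n, [Op f ts]))) xs = [eval_obj UX xs (Op f ts)]"
        using xs f.obj_in[of "map (eval_obj UX xs) ts"] Op.hyps
        by (simp add: eq AOp_UX)
    next
      assume fs: "fs \<in> Arr (pow_cat A n)"
      have "FArr (TF1 X (FArr I (n, ts))) fs = map (eval_arr UX fs) ts"
        using TF1_tuple(2)[OF ts fs] Op.IH fs by simp
      moreover have "map (eval_arr UX fs) ts \<in> Arr (pow_cat A ?k)"
        using t.arr_in[OF fs] calculation by simp
      ultimately show "FArr (TF1 X (FArr I (n, [Op f ts]))) fs = [eval_arr UX fs (Op f ts)]"
        using fs f.arr_in[of "map (eval_arr UX fs) ts"] Op.hyps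
        by (simp add: eq AOp_UX)
    qed
  qed
  then show "xs \<in> Obj (pow_cat A n) \<Longrightarrow> FObj (TF1 X (FArr I (n, [t]))) xs = [eval_obj UX xs t]"
    "fs \<in> Arr (pow_cat A n) \<Longrightarrow> FArr (TF1 X (FArr I (n, [t]))) fs = [eval_arr UX fs t]" by auto
qed

text \<open>This is the uniqueness half of freeness: the 1-cell part of a model is recovered from
  its underlying Omega-algebra.\<close>

lemma TF1_eq:
  assumes "set ts \<subseteq> trms \<Omega> n"
  shows "TF1 X (FArr I (n, ts)) = term_ftor UX n ts"
proof -
  interpret t: functor_between "pow_cat A n" "pow_cat A (length ts)" "TF1 X (FArr I (n, ts))"
    using TF1_between[of "FArr I (n, ts)"] assms by simp
  interpret u: functor_between "pow_cat A n" "pow_cat A (length ts)" "term_ftor UX n ts"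
    by (rule UX.functor_term_ftor[OF assms])
  have *: "t \<in> trms \<Omega> n" if "t \<in> set ts" for t using that assms by auto
  show ?thesis
    by (rule ftor_eqI[OF t.ftor u.ftor])
      (simp_all del: in_Obj_pow in_Arr_pow add: TF1_tuple[OF assms] TF1_single * term_ftor_def)
qed

end

section \<open>Oplax morphisms over the identity\<close>

locale oplax_over_id =
  X: two_algebra \<Omega> T J I A X + Y: two_algebra \<Omega> T J I A Y
  for \<Omega> :: "nat \<Rightarrow> 'f set" and T :: "(nat, 'a, 'c) two_cat" and J :: "('a, 'c) theory_map"
    and I :: "('f, 'a) free_iso" and A :: "('o, 'm) cat" and X Y :: "('a, 'c, 'o, 'm) model" +
  fixes k :: "('a, 'o, 'm) model_map"
  assumes morphism: "oplax_morphism T J X Y k" and over_id: "over_identity A k"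
begin

sublocale oplax_transformation T Cat2 X Y k
  using morphism unfolding oplax_morphism_def by simp

lemma OCell_J:
  assumes "set as \<subseteq> {..<n}"
  shows "OCell k (TF1 J (n, as)) = id_ntrans (comp_ftor (OAt k (length as)) (TF1 X (TF1 J (n, as))))"
  using morphism assms unfolding oplax_morphism_def by (auto dest!: bspec[of _ _ "(n, as)"])

lemma OAt_one: "OAt k (Suc 0) = id_ftor (pow_cat A (Suc 0))"
  using over_id by (simp add: over_identity_def)

lemma OAt_between: "functor_between (pow_cat A n) (pow_cat A n) (OAt k n)"
  using OAt_PiE Dom_OAt[of n] Cod_OAt[of n] by (auto simp: functor_between_def)

text \<open>Only the value at 1 is given. The cell at a projection is an identity 2-cell, so its
  source and target agree: projecting after \<open>OAt k n\<close> is the same as projecting. All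
  coordinates of \<open>OAt k n\<close> are therefore trivial.\<close>

lemma OAt_eq: "OAt k n = id_ftor (pow_cat A n)"
proof -
  interpret k: functor_between "pow_cat A n" "pow_cat A n" "OAt k n" by (rule OAt_between)
  have eq: "comp_ftor (comp_ftor (unary_ftor A) (proj_ftor A n i)) (OAt k n)
      = comp_ftor (unary_ftor A) (proj_ftor A n i)" if i: "i < n" for i
  proof -
    let ?p = "FArr I (n, [Var i])"
    have p: "?p \<in> Arr T" "Dom T ?p = n" "Cod T ?p = Suc 0" "TF1 J (n, [i]) = ?p"
      using i by (simp_all add: X.J_eq)
    have *: "TF1 X ?p = comp_ftor (unary_ftor A) (proj_ftor A n i)" "TF1 Y ?p = comp_ftor (unary_ftor A) (proj_ftor A n i)"
      using i X.TF1_proj Y.TF1_proj X.proj_eq by metis+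
    have "comp_ftor (TF1 Y ?p) (OAt k n) = NCod (OCell k ?p)"
      using Cod2_OCell[OF p(1)] p by simp
    also have "\<dots> = comp_ftor (id_ftor (pow_cat A (Suc 0))) (TF1 X ?p)"
      using OCell_J[of "[i]" n] i by (simp add: p OAt_one)
    also have "\<dots> = TF1 X ?p"
      using X.TF1_between[OF p(1)] p by (intro comp_id_ftor) (auto simp: functor_between_def)
    finally show ?thesis using * by simp
  qed
  have i: "cat_functor (id_ftor (pow_cat A n))"
    by (rule cat_functor_id_ftor) (rule k.D.category_axioms)
  show ?thesis
  proof (rule ftor_eqI[OF k.ftor i])
    fix x assume "x \<in> Obj (FDom (id_ftor (pow_cat A n)))"
    then have x: "x \<in> Obj (pow_cat A n)" by simp
    have "FObj (OAt k n) x ! i = x ! i" if "i < n" for i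
      using arg_cong[OF eq[OF that], of "\<lambda>F. FObj F x"] x k.obj_in[OF x] that by simp
    then show "FObj (OAt k n) x = FObj (id_ftor (pow_cat A n)) x"
      using x k.obj_in[OF x] by (simp add: list_eq_iff_nth_eq)
  next
    fix x assume "x \<in> Arr (FDom (id_ftor (pow_cat A n)))"
    then have x: "x \<in> Arr (pow_cat A n)" by simp
    have "FArr (OAt k n) x ! i = x ! i" if "i < n" for i
      using arg_cong[OF eq[OF that], of "\<lambda>F. FArr F x"] x k.arr_in[OF x] that by simp
    then show "FArr (OAt k n) x = FArr (id_ftor (pow_cat A n)) x"
      using x k.arr_in[OF x] by (simp add: list_eq_iff_nth_eq)
  qed simp_all
qed

lemma comp_OAt:
  assumes "g \<in> Arr T"
  shows "comp_ftor (OAt k (Cod T g)) (TF1 X g) = TF1 X g" "comp_ftor (TF1 Y g) (OAt k (Dom T g)) = TF1 Y g"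
  using X.TF1_between[OF assms] Y.TF1_between[OF assms]
  by (auto simp: OAt_eq functor_between_def intro: comp_id_ftor comp_ftor_id)

lemma OCell_between:
  assumes "g \<in> Arr T"
  shows "trans_between (pow_cat A (Dom T g)) (pow_cat A (Cod T g)) (TF1 X g) (TF1 Y g) (OCell k g)"
proof -
  interpret functor_between "pow_cat A (Dom T g)" "pow_cat A (Cod T g)" "TF1 X g"
    by (rule X.TF1_between[OF assms])
  show ?thesis
    using OCell_PiE Dom2_OCell[OF assms] Cod2_OCell[OF assms] comp_OAt[OF assms] assms
    by (auto simp: trans_between_def)
qed

lemma OCell_J_id: "set as \<subseteq> {..<n} \<Longrightarrow> OCell k (TF1 J (n, as)) = id_ntrans (TF1 X (TF1 J (n, as)))"
  using comp_OAt(1)[of "FArr I (n, map Var as)"] OCell_J[of as n] by (simp add: X.J_eq)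

lemma NAt_OCell_Comp:
  assumes f: "f \<in> Arr T" and g: "g \<in> Arr T" and fg: "Dom T g = Cod T f" and x: "x \<in> Obj (pow_cat A (Dom T f))"
  shows "NAt (OCell k (Comp T g f)) x
    = Comp (pow_cat A (Cod T g)) (FArr (TF1 Y g) (NAt (OCell k f) x)) (NAt (OCell k g) (FObj (TF1 X f) x))"
proof -
  interpret f: trans_between "pow_cat A (Dom T f)" "pow_cat A (Cod T f)" "TF1 X f" "TF1 Y f" "OCell k f"
    by (rule OCell_between[OF f])
  have g': "trans_between (pow_cat A (Cod T f)) (pow_cat A (Cod T g)) (TF1 X g) (TF1 Y g) (OCell k g)"
    using OCell_between[OF g] fg by simp
  interpret g: trans_between "pow_cat A (Cod T f)" "pow_cat A (Cod T g)" "TF1 X g" "TF1 Y g" "OCell k g"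
    by (rule g')
  have "NAt (OCell k (Comp T g f)) x
      = Comp (pow_cat A (Cod T g)) (NAt (hcomp_ntrans (id_ntrans (TF1 Y g)) (OCell k f)) x)
          (NAt (hcomp_ntrans (OCell k g) (id_ntrans (TF1 X f))) x)"
    using OCell_Comp[OF f g fg] x by (simp del: hcomp_ntrans_simps(3) in_Obj_pow pow_cat_simps)
  then show ?thesis
    by (simp only: whisker_left(2)[OF g.G.functor_between_axioms f.trans_between_axioms x]
        whisker_right(2)[OF g' f.F.functor_between_axioms x])
qed

lemma NAt_OCell_natural:
  assumes \<tau>: "\<tau> \<in> Cell T" and x: "x \<in> Obj (pow_cat A (Dom T (Dom2 T \<tau>)))"
  shows "Comp (pow_cat A (Cod T (Dom2 T \<tau>))) (NAt (TF2 Y \<tau>) x) (NAt (OCell k (Dom2 T \<tau>)) x)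
    = Comp (pow_cat A (Cod T (Dom2 T \<tau>))) (NAt (OCell k (Cod2 T \<tau>)) x) (NAt (TF2 X \<tau>) x)"
proof -
  interpret X\<tau>: trans_between "pow_cat A (Dom T (Dom2 T \<tau>))" "pow_cat A (Cod T (Dom2 T \<tau>))" "TF1 X (Dom2 T \<tau>)"
    "TF1 X (Cod2 T \<tau>)" "TF2 X \<tau>"
    by (rule X.TF2_between[OF \<tau>])
  interpret Y\<tau>: trans_between "pow_cat A (Dom T (Dom2 T \<tau>))" "pow_cat A (Cod T (Dom2 T \<tau>))" "TF1 Y (Dom2 T \<tau>)"
    "TF1 Y (Cod2 T \<tau>)" "TF2 Y \<tau>"
    by (rule Y.TF2_between[OF \<tau>])
  interpret k: trans_between "pow_cat A (Dom T (Dom2 T \<tau>))" "pow_cat A (Cod T (Dom2 T \<tau>))" "TF1 X (Dom2 T \<tau>)"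
    "TF1 Y (Dom2 T \<tau>)" "OCell k (Dom2 T \<tau>)"
    using OCell_between[of "Dom2 T \<tau>"] \<tau> by simp
  have "hcomp_ntrans (TF2 Y \<tau>) (id_ntrans (OAt k (Dom T (Dom2 T \<tau>)))) = TF2 Y \<tau>"
    "hcomp_ntrans (id_ntrans (OAt k (Cod T (Dom2 T \<tau>)))) (TF2 X \<tau>) = TF2 X \<tau>"
    unfolding OAt_eq
    by (rule hcomp_ntrans_id_right[OF Y\<tau>.trans_between_axioms] hcomp_ntrans_id_left[OF X\<tau>.trans_between_axioms])+
  then show ?thesis
    using arg_cong[OF OCell_natural[OF \<tau>], of "\<lambda>\<alpha>. NAt \<alpha> x"] x
    by (simp del: in_Obj_pow pow_cat_simps)
qed

abbreviation Uk :: "nat \<times> 'f \<Rightarrow> ('o list, 'm list, 'o, 'm) ntrans" where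
  "Uk \<equiv> MCell (forget_map \<Omega> I A A k)"

lemma MFun_forget: "MFun (forget_map \<Omega> I A A k) = id_ftor A"
proof -
  have "cat_functor (comp_ftor (proj_ftor A 1 0) (comp_ftor (OAt k 1) (unary_ftor A)))"
    by (intro cat_functor_comp_ftor cat_functor_proj_ftor cat_functor_unary_ftor X.A.category_axioms
        functor_between.ftor[OF OAt_between]) (simp_all add: OAt_eq)
  then show ?thesis
    unfolding forget_map_def
    by (simp del: One_nat_def, intro ftor_eqI cat_functor_id_ftor X.A.category_axioms)
      (simp_all add: OAt_eq)
qed

lemma Uk_eq: "f \<in> \<Omega> n \<Longrightarrow> Uk (n, f) = hcomp_ntrans (id_ntrans (proj_ftor A 1 0)) (OCell k (op_cell I n f))"
  by (simp add: forget_map_def)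

lemma Uk_between: "f \<in> \<Omega> n \<Longrightarrow> trans_between (pow_cat A n) A (AOp X.UX (n, f)) (AOp Y.UX (n, f)) (Uk (n, f))"
  using OCell_between[of "op_cell I n f"]
  unfolding Uk_eq X.AOp_UX Y.AOp_UX by (intro whisker_left(1)[OF X.functor_proj]) simp

lemma NAt_Uk:
  assumes "f \<in> \<Omega> n" "xs \<in> Obj (pow_cat A n)"
  shows "NAt (Uk (n, f)) xs = NAt (OCell k (op_cell I n f)) xs ! 0"
proof -
  interpret k: trans_between "pow_cat A n" "pow_cat A 1" "TF1 X (op_cell I n f)" "TF1 Y (op_cell I n f)"
    "OCell k (op_cell I n f)"
    using OCell_between[of "op_cell I n f"] assms(1) by simp
  show ?thesis
    unfolding Uk_eq[OF assms(1)] whisker_left(2)[OF X.functor_proj k.trans_between_axioms assms(2)]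
    by (rule proj_ftor_simps(4)[OF k.at_in[OF assms(2)]])
qed

sublocale U: omega_cells \<Omega> A X.UX Y.UX Uk
  by (intro omega_cells.intro omega_cells_axioms.intro X.UX.omega_alg_on_axioms Y.UX.omega_alg_on_axioms
      Uk_between)

text \<open>Apply the composition law to the tuple followed by a projection. The cell at the
  projection is an identity, so only the i-th coordinate of the cell at the tuple is left.\<close>

lemma NAt_OCell_component:
  assumes ts: "set ts \<subseteq> trms \<Omega> n" and i: "i < length ts" and xs: "xs \<in> Obj (pow_cat A n)"
  shows "NAt (OCell k (FArr I (n, [ts ! i]))) xs = [NAt (OCell k (FArr I (n, ts))) xs ! i]"
proof -
  let ?p = "TF1 J (fin_proj (length ts) i)" and ?g = "FArr I (n, ts)"
  interpret k: trans_between "pow_cat A n" "pow_cat A (length ts)" "TF1 X ?g" "TF1 Y ?g" "OCell k ?g"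
    using OCell_between[of ?g] ts by simp
  have p: "?p \<in> Arr T" "Dom T ?p = length ts" "Cod T ?p = 1" using i by (simp_all add: X.proj_eq)
  have obj: "FObj (TF1 X ?g) xs \<in> Obj (pow_cat A (length ts))" using xs by (rule k.F.obj_in)
  have arr: "NAt (OCell k ?g) xs \<in> Arr (pow_cat A (length ts))" using xs by (rule k.at_in)
  have "OCell k ?p = id_ntrans (TF1 X ?p)"
    unfolding fin_proj_def using i by (intro OCell_J_id) simp
  then have "NAt (OCell k ?p) (FObj (TF1 X ?g) xs) = [Id A (FObj (TF1 X ?g) xs ! i)]"
    using obj i by (simp add: X.TF1_proj)
  moreover have "FArr (TF1 Y ?p) (NAt (OCell k ?g) xs) = [NAt (OCell k ?g) xs ! i]"
    using arr i by (simp add: Y.TF1_proj)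
  moreover have "Dom A (NAt (OCell k ?g) xs ! i) = FObj (TF1 X ?g) xs ! i"
    using arg_cong[OF k.Dom_at[OF xs], of "\<lambda>xs. xs ! i"] arr i by simp
  ultimately show ?thesis
    unfolding X.proj_comp[OF ts i]
    using NAt_OCell_Comp[of ?g ?p xs] p ts xs arr i X.A.Comp_Id_right[of "NAt (OCell k ?g) xs ! i"]
    by simp
qed

text \<open>As for models, the claim for single terms is a hypothesis because the next induction
  supplies it for the arguments of an operation.\<close>

lemma NAt_OCell_tuple:
  assumes ts: "set ts \<subseteq> trms \<Omega> n" and xs: "xs \<in> Obj (pow_cat A n)"
    and single: "\<And>t. t \<in> set ts \<Longrightarrow> NAt (OCell k (FArr I (n, [t]))) xs = [eval_cell X.UX Y.UX Uk xs t]"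
  shows "NAt (OCell k (FArr I (n, ts))) xs = map (eval_cell X.UX Y.UX Uk xs) ts"
proof -
  interpret k: trans_between "pow_cat A n" "pow_cat A (length ts)" "TF1 X (FArr I (n, ts))" "TF1 Y (FArr I (n, ts))"
    "OCell k (FArr I (n, ts))"
    using OCell_between[of "FArr I (n, ts)"] ts by simp
  show ?thesis
    using k.at_in[OF xs] NAt_OCell_component[OF ts _ xs] single by (intro nth_equalityI) auto
qed

text \<open>Strictness along \<open>J\<close> settles variables, and at an operation the composition
  law is exactly the recursive clause of \<open>eval_cell\<close>.\<close>

lemma NAt_OCell_single:
  assumes "t \<in> trms \<Omega> n" "xs \<in> Obj (pow_cat A n)"
  shows "NAt (OCell k (FArr I (n, [t]))) xs = [eval_cell X.UX Y.UX Uk xs t]"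
  using assms
proof induction
  case (Var i)
  then have "OCell k (FArr I (n, [Var i])) = id_ntrans (TF1 X (FArr I (n, [Var i])))"
    using OCell_J_id[of "[i]" n] by (simp add: X.J_eq)
  then show ?case using Var by (simp add: X.TF1_eq term_ftor_def)
next
  case (Op f ts)
  let ?k = "length ts" and ?g = "FArr I (n, ts)"
  have ts: "set ts \<subseteq> trms \<Omega> n" using Op by auto
  interpret k: trans_between "pow_cat A n" "pow_cat A ?k" "TF1 X ?g" "TF1 Y ?g" "OCell k ?g"
    using OCell_between[of ?g] ts by simp
  interpret f: trans_between "pow_cat A ?k" "pow_cat A 1" "TF1 X (op_cell I ?k f)" "TF1 Y (op_cell I ?k f)"
    "OCell k (op_cell I ?k f)"
    using OCell_between[of "op_cell I ?k f"] Op by simp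
  have obj: "FObj (TF1 X ?g) xs = map (eval_obj X.UX xs) ts" using ts Op.prems by (simp add: X.TF1_eq term_ftor_def)
  have arr: "NAt (OCell k ?g) xs = map (eval_cell X.UX Y.UX Uk xs) ts"
    using NAt_OCell_tuple[OF ts Op.prems] Op by simp
  have ins: "map (eval_obj X.UX xs) ts \<in> Obj (pow_cat A ?k)" "map (eval_cell X.UX Y.UX Uk xs) ts \<in> Arr (pow_cat A ?k)"
    using k.F.obj_in[OF Op.prems] k.at_in[OF Op.prems] obj arr by simp_all
  have "FArr (TF1 Y (op_cell I ?k f)) (map (eval_cell X.UX Y.UX Uk xs) ts)
      = [FArr (AOp Y.UX (?k, f)) (map (eval_cell X.UX Y.UX Uk xs) ts)]"
    using f.G.arr_in[OF ins(2)] ins(2) Op.hyps by (simp add: Y.AOp_UX)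
  moreover have "NAt (OCell k (op_cell I ?k f)) (map (eval_obj X.UX xs) ts)
      = [NAt (Uk (?k, f)) (map (eval_obj X.UX xs) ts)]"
    using f.at_in[OF ins(1)] NAt_Uk[OF Op.hyps(1) ins(1)] by simp
  ultimately show ?case
    unfolding X.op_comp[OF Op.hyps(1) ts]
    using NAt_OCell_Comp[of ?g "op_cell I ?k f" xs] ts Op by (simp add: obj arr)
qed

text \<open>Hence an oplax morphism over the identity is determined by its cells at the operations.
  It is applied to \<open>k\<close>, to transfer the factorisation to all 1-cells, and to competing
  lifts, for uniqueness.\<close>

lemma OCell_eq:
  assumes "set ts \<subseteq> trms \<Omega> n"
  shows "OCell k (FArr I (n, ts)) = term_ntrans X.UX Y.UX Uk n ts"
proof -
  interpret k: trans_between "pow_cat A n" "pow_cat A (length ts)" "TF1 X (FArr I (n, ts))" "TF1 Y (FArr I (n, ts))"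
    "OCell k (FArr I (n, ts))"
    using OCell_between[of "FArr I (n, ts)"] assms by simp
  interpret t: trans_between "pow_cat A n" "pow_cat A (length ts)" "term_ftor X.UX n ts" "term_ftor Y.UX n ts"
    "term_ntrans X.UX Y.UX Uk n ts"
    by (rule U.trans_term_ntrans[OF assms])
  have "t \<in> trms \<Omega> n" if "t \<in> set ts" for t using that assms by auto
  then show ?thesis
    by (intro ntrans_eqI k.trans t.trans)
      (simp_all del: in_Obj_pow add: X.TF1_eq[OF assms] Y.TF1_eq[OF assms] NAt_OCell_tuple[OF assms]
        NAt_OCell_single term_ntrans_def)
qed

lemma OCell_ext: "OCell k \<in> extensional (Arr T)"
  using OCell_PiE by (simp add: PiE_iff)

lemma OAt_fun: "OAt k = (\<lambda>n. id_ftor (pow_cat A n))"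
  by (simp add: fun_eq_iff OAt_eq)

end

text \<open>The axioms of an oplax transformation in components, after the whiskerings with identity
  functors have been cancelled; both lifted morphisms are built with this rule.\<close>

lemma oplax_over_idI:
  assumes "two_algebra \<Omega> T J I A X" "two_algebra \<Omega> T J I A Y"
    and OAt: "OAt k = (\<lambda>n. id_ftor (pow_cat A n))" and ext: "OCell k \<in> extensional (Arr T)"
    and between: "\<And>g. g \<in> Arr T \<Longrightarrow>
      trans_between (pow_cat A (Dom T g)) (pow_cat A (Cod T g)) (TF1 X g) (TF1 Y g) (OCell k g)"
    and J: "\<And>n as. set as \<subseteq> {..<n} \<Longrightarrow> OCell k (TF1 J (n, as)) = id_ntrans (TF1 X (TF1 J (n, as)))"
    and comp: "\<And>f g x. \<lbrakk>f \<in> Arr T; g \<in> Arr T; Dom T g = Cod T f; x \<in> Obj (pow_cat A (Dom T f))\<rbrakk>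
      \<Longrightarrow> NAt (OCell k (Comp T g f)) x
        = Comp (pow_cat A (Cod T g)) (FArr (TF1 Y g) (NAt (OCell k f) x)) (NAt (OCell k g) (FObj (TF1 X f) x))"
    and natural: "\<And>\<tau> x. \<lbrakk>\<tau> \<in> Cell T; x \<in> Obj (pow_cat A (Dom T (Dom2 T \<tau>)))\<rbrakk>
      \<Longrightarrow> Comp (pow_cat A (Cod T (Dom2 T \<tau>))) (NAt (TF2 Y \<tau>) x) (NAt (OCell k (Dom2 T \<tau>)) x)
        = Comp (pow_cat A (Cod T (Dom2 T \<tau>))) (NAt (OCell k (Cod2 T \<tau>)) x) (NAt (TF2 X \<tau>) x)"
  shows "oplax_over_id \<Omega> T J I A X Y k"
proof -
  interpret X: two_algebra \<Omega> T J I A X by fact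
  interpret Y: two_algebra \<Omega> T J I A Y by fact
  have id_comp: "comp_ftor (id_ftor (pow_cat A (Cod T g))) (TF1 X g) = TF1 X g"
    and comp_id: "comp_ftor (TF1 Y g) (id_ftor (pow_cat A (Dom T g))) = TF1 Y g" if "g \<in> Arr T" for g
    using X.TF1_between[OF that] Y.TF1_between[OF that]
    by (auto simp: functor_between_def intro: comp_id_ftor comp_ftor_id)
  have cell: "nat_transf (OCell k g)" "NDom (OCell k g) = TF1 X g" "NCod (OCell k g) = TF1 Y g" if "g \<in> Arr T" for g
    using between[OF that] by (simp_all add: trans_between_def)
  have "oplax_transformation T Cat2 X Y k"
  proof
    show "two_functor T Cat2 X" "two_functor T Cat2 Y"
      by (rule X.two_functor_X Y.two_functor_X)+
    show "OAt k \<in> Obj T \<rightarrow>\<^sub>E Arr Cat2"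
      by (simp add: OAt cat_functor_id_ftor category_pow_cat X.A.category_axioms PiE_iff extensional_def)
    show "OCell k \<in> Arr T \<rightarrow>\<^sub>E Cell Cat2"
      using ext cell by (simp add: PiE_iff)
    fix a assume "a \<in> Obj T"
    show "Dom Cat2 (OAt k a) = TF0 X a" "Cod Cat2 (OAt k a) = TF0 Y a" by (simp_all add: OAt)
    \<comment> \<open>The identity of \<open>a\<close> is the image under \<open>J\<close> of an
      identity map, so the unit law is an instance of strictness along \<open>J\<close>.\<close>
    show "OCell k (Id T a) = Id2 Cat2 (OAt k a)"
      using J[of "[0..<a]" a] by (simp add: X.J_eq X.Id_eq[symmetric] X.TF1_Id OAt lessThan_atLeast0)
  next
    fix f assume f: "f \<in> Arr T"
    show "Dom2 Cat2 (OCell k f) = Comp Cat2 (OAt k (Cod T f)) (TF1 X f)"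
      "Cod2 Cat2 (OCell k f) = Comp Cat2 (TF1 Y f) (OAt k (Dom T f))"
      using cell[OF f] id_comp[OF f] comp_id[OF f] by (simp_all add: OAt)
  next
    fix \<tau> assume \<tau>: "\<tau> \<in> Cell T"
    let ?D = "pow_cat A (Dom T (Dom2 T \<tau>))" and ?C = "pow_cat A (Cod T (Dom2 T \<tau>))"
    interpret X\<tau>: trans_between ?D ?C "TF1 X (Dom2 T \<tau>)" "TF1 X (Cod2 T \<tau>)" "TF2 X \<tau>"
      by (rule X.TF2_between[OF \<tau>])
    interpret Y\<tau>: trans_between ?D ?C "TF1 Y (Dom2 T \<tau>)" "TF1 Y (Cod2 T \<tau>)" "TF2 Y \<tau>"
      by (rule Y.TF2_between[OF \<tau>])
    interpret k1: trans_between ?D ?C "TF1 X (Dom2 T \<tau>)" "TF1 Y (Dom2 T \<tau>)" "OCell k (Dom2 T \<tau>)"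
      using between[of "Dom2 T \<tau>"] \<tau> by simp
    interpret k2: trans_between ?D ?C "TF1 X (Cod2 T \<tau>)" "TF1 Y (Cod2 T \<tau>)" "OCell k (Cod2 T \<tau>)"
      using between[of "Cod2 T \<tau>"] \<tau> by simp
    have 1: "hcomp_ntrans (TF2 Y \<tau>) (id_ntrans (id_ftor ?D)) = TF2 Y \<tau>"
      by (rule hcomp_ntrans_id_right[OF Y\<tau>.trans_between_axioms])
    have 2: "hcomp_ntrans (id_ntrans (id_ftor ?C)) (TF2 X \<tau>) = TF2 X \<tau>"
      by (rule hcomp_ntrans_id_left[OF X\<tau>.trans_between_axioms])
    show "VComp Cat2 (HComp Cat2 (TF2 Y \<tau>) (Id2 Cat2 (OAt k (Dom T (Dom2 T \<tau>))))) (OCell k (Dom2 T \<tau>))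
        = VComp Cat2 (OCell k (Cod2 T \<tau>)) (HComp Cat2 (Id2 Cat2 (OAt k (Cod T (Dom2 T \<tau>)))) (TF2 X \<tau>))"
      unfolding Cat2_simps OAt 1 2
      by (rule ntrans_eqI[OF trans_between.trans[OF trans_between_vcomp_ntrans[OF k1.trans_between_axioms Y\<tau>.trans_between_axioms]]
            trans_between.trans[OF trans_between_vcomp_ntrans[OF X\<tau>.trans_between_axioms k2.trans_between_axioms]]])
        (use natural[OF \<tau>] in \<open>simp_all del: in_Obj_pow pow_cat_simps\<close>)
  next
    fix f g assume f: "f \<in> Arr T" and g: "g \<in> Arr T" and fg: "Dom T g = Cod T f"
    let ?D = "pow_cat A (Dom T f)" and ?C = "pow_cat A (Cod T f)" and ?B = "pow_cat A (Cod T g)"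
    have g': "trans_between ?C ?B (TF1 X g) (TF1 Y g) (OCell k g)" using between[OF g] fg by simp
    have gf: "trans_between ?D ?B (comp_ftor (TF1 X g) (TF1 X f)) (comp_ftor (TF1 Y g) (TF1 Y f)) (OCell k (Comp T g f))"
      using between[of "Comp T g f"] f g fg by (simp add: X.TF1_Comp Y.TF1_Comp)
    interpret f: trans_between ?D ?C "TF1 X f" "TF1 Y f" "OCell k f" by (rule between[OF f])
    interpret g: trans_between ?C ?B "TF1 X g" "TF1 Y g" "OCell k g" by (rule g')
    have 1: "trans_between ?D ?B (comp_ftor (TF1 Y g) (TF1 X f)) (comp_ftor (TF1 Y g) (TF1 Y f))
        (hcomp_ntrans (id_ntrans (TF1 Y g)) (OCell k f))"
      by (rule whisker_left(1)[OF g.G.functor_between_axioms f.trans_between_axioms])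
    have 2: "trans_between ?D ?B (comp_ftor (TF1 X g) (TF1 X f)) (comp_ftor (TF1 Y g) (TF1 X f))
        (hcomp_ntrans (OCell k g) (id_ntrans (TF1 X f)))"
      by (rule whisker_right(1)[OF g' f.F.functor_between_axioms])
    show "OCell k (Comp T g f) = VComp Cat2 (HComp Cat2 (Id2 Cat2 (TF1 Y g)) (OCell k f))
        (HComp Cat2 (OCell k g) (Id2 Cat2 (TF1 X f)))"
      unfolding Cat2_simps
      by (rule ntrans_eqI[OF trans_between.trans[OF gf] trans_between.trans[OF trans_between_vcomp_ntrans[OF 2 1]]])
        (use comp[OF f g fg] trans_between.NDom[OF gf] trans_between.NCod[OF gf]
          whisker_left(2)[OF g.G.functor_between_axioms f.trans_between_axioms]
          whisker_right(2)[OF g' f.F.functor_between_axioms] in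
          \<open>simp_all del: in_Obj_pow pow_cat_simps hcomp_ntrans_simps(3)\<close>)
  qed
  moreover have "OCell k (TF1 J \<phi>) = id_ntrans (comp_ftor (OAt k (Cod fin_op \<phi>)) (TF1 X (TF1 J \<phi>)))"
    if "\<phi> \<in> Arr fin_op" for \<phi>
  proof -
    obtain n as where \<phi>: "\<phi> = (n, as)" by (cases \<phi>)
    then show ?thesis
      using J[of as n] id_comp[of "FArr I (n, map Var as)"] that by (simp add: OAt X.J_eq)
  qed
  ultimately show ?thesis
    by unfold_locales (simp_all add: oplax_morphism_def over_identity_def OAt)
qed

section \<open>Lifting the factorisation\<close>

text \<open>\<open>c\<close> and \<open>d\<close> are the cells of the morphisms called e and m in
  the theorem. The conditions on E, M and the factorisation concern the operations only; their
  extension to all 1-cells is proved below.\<close>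

locale factorised_morphism =
  K: oplax_over_id \<Omega> T J I A X Y k + S: factorisation_system A E M
  + e: omega_cells \<Omega> A "forget_alg \<Omega> I A X" Z c + m: omega_cells \<Omega> A Z "forget_alg \<Omega> I A Y" d
  for \<Omega> :: "nat \<Rightarrow> 'f set" and T :: "(nat, 'a, 'c) two_cat" and J :: "('a, 'c) theory_map"
    and I :: "('f, 'a) free_iso" and A :: "('o, 'm) cat" and X Y :: "('a, 'c, 'o, 'm) model"
    and k :: "('a, 'o, 'm) model_map" and E M :: "'m set"
    and Z :: "('f, 'o, 'm) omega_alg" and c d :: "nat \<times> 'f \<Rightarrow> ('o list, 'm list, 'o, 'm) ntrans" +
  assumes X_preserves: "f \<in> \<Omega> n \<Longrightarrow> preserves_pointwise n (AOp K.X.UX (n, f)) E"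
    and Y_preserves: "f \<in> \<Omega> n \<Longrightarrow> preserves_pointwise n (AOp K.Y.UX (n, f)) M"
    and c_E: "f \<in> \<Omega> n \<Longrightarrow> pointwise_in E (c (n, f))"
    and d_M: "f \<in> \<Omega> n \<Longrightarrow> pointwise_in M (d (n, f))"
    and factor: "\<lbrakk>f \<in> \<Omega> n; xs \<in> Obj (pow_cat A n)\<rbrakk>
      \<Longrightarrow> NAt (K.Uk (n, f)) xs = Comp A (NAt (d (n, f)) xs) (NAt (c (n, f)) xs)"
begin

section \<open>The algebra and the two factors extended to all 1-cells\<close>

definition terms :: "'a \<Rightarrow> nat \<times> 'f trm list" where
  "terms = inv_into (Arr (free_theory \<Omega>)) (FArr I)"

lemma terms_I [simp]: "set ts \<subseteq> trms \<Omega> n \<Longrightarrow> terms (FArr I (n, ts)) = (n, ts)"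
  unfolding terms_def using K.X.bij_I by (intro inv_into_f_f) (auto simp: bij_betw_def)

definition Z1 :: "'a \<Rightarrow> ('o list, 'm list, 'o list, 'm list) ftor" where
  "Z1 g = case_prod (term_ftor Z) (terms g)"

definition e1 :: "'a \<Rightarrow> ('o list, 'm list, 'o list, 'm list) ntrans" where
  "e1 g = case_prod (term_ntrans K.X.UX Z c) (terms g)"

definition m1 :: "'a \<Rightarrow> ('o list, 'm list, 'o list, 'm list) ntrans" where
  "m1 g = case_prod (term_ntrans Z K.Y.UX d) (terms g)"

lemma one_cells_I [simp]:
  assumes "set ts \<subseteq> trms \<Omega> n"
  shows "Z1 (FArr I (n, ts)) = term_ftor Z n ts"
    and "e1 (FArr I (n, ts)) = term_ntrans K.X.UX Z c n ts"
    and "m1 (FArr I (n, ts)) = term_ntrans Z K.Y.UX d n ts"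
  using assms by (simp_all add: Z1_def e1_def m1_def)

abbreviation Dpow :: "'a \<Rightarrow> ('o list, 'm list) cat" where "Dpow g \<equiv> pow_cat A (Dom T g)"
abbreviation Cpow :: "'a \<Rightarrow> ('o list, 'm list) cat" where "Cpow g \<equiv> pow_cat A (Cod T g)"

lemma e1_between: "g \<in> Arr T \<Longrightarrow> trans_between (Dpow g) (Cpow g) (TF1 X g) (Z1 g) (e1 g)"
  by (erule K.X.Arr_cases) (simp add: K.X.TF1_eq e.trans_term_ntrans)

lemma m1_between: "g \<in> Arr T \<Longrightarrow> trans_between (Dpow g) (Cpow g) (Z1 g) (TF1 Y g) (m1 g)"
  by (erule K.X.Arr_cases) (simp add: K.Y.TF1_eq m.trans_term_ntrans)

lemma Z1_between: "g \<in> Arr T \<Longrightarrow> functor_between (Dpow g) (Cpow g) (Z1 g)"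
  by (erule K.X.Arr_cases) (simp add: e.Q.functor_term_ftor)

lemma Comp_cases:
  assumes f: "f \<in> Arr T" and g: "g \<in> Arr T" and fg: "Dom T g = Cod T f"
  obtains n ts us where "set ts \<subseteq> trms \<Omega> n" "set us \<subseteq> trms \<Omega> (length ts)"
    "f = FArr I (n, ts)" "g = FArr I (length ts, us)" "Comp T g f = FArr I (n, map (subst ((!) ts)) us)"
    "set (map (subst ((!) ts)) us) \<subseteq> trms \<Omega> n"
proof -
  obtain n ts where ts: "set ts \<subseteq> trms \<Omega> n" "f = FArr I (n, ts)" using K.X.Arr_cases[OF f] .
  obtain n' us where us: "set us \<subseteq> trms \<Omega> n'" "g = FArr I (n', us)" using K.X.Arr_cases[OF g] .
  have n': "n' = length ts" using fg ts us by simp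
  have "set (map (subst ((!) ts)) us) \<subseteq> trms \<Omega> n"
    using subst_in_trms[OF _ ts(1)] us n' by auto
  then show ?thesis using that ts us n' K.X.Comp_I by simp
qed

lemma Z1_Id: "Z1 (Id T n) = id_ftor (pow_cat A n)"
proof -
  have "set (map Var [0..<n]) \<subseteq> trms \<Omega> n" by (auto intro: trms.Var)
  then show ?thesis by (simp only: K.X.Id_eq one_cells_I e.Q.term_ftor_Var)
qed

lemma Z1_Comp:
  assumes "f \<in> Arr T" "g \<in> Arr T" "Dom T g = Cod T f"
  shows "Z1 (Comp T g f) = comp_ftor (Z1 g) (Z1 f)"
  using assms by (rule Comp_cases) (simp only: one_cells_I e.Q.term_ftor_subst)

lemma e1_Comp:
  assumes "f \<in> Arr T" "g \<in> Arr T" "Dom T g = Cod T f" "x \<in> Obj (Dpow f)"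
  shows "NAt (e1 (Comp T g f)) x = Comp (Cpow g) (FArr (Z1 g) (NAt (e1 f) x)) (NAt (e1 g) (FObj (TF1 X f) x))"
  by (rule Comp_cases[OF assms(1-3)])
    (use assms(4) in \<open>simp only: one_cells_I e.NAt_term_ntrans_subst K.X.TF1_eq K.X.Dom_I K.X.Cod_I\<close>)

lemma m1_Comp:
  assumes "f \<in> Arr T" "g \<in> Arr T" "Dom T g = Cod T f" "x \<in> Obj (Dpow f)"
  shows "NAt (m1 (Comp T g f)) x = Comp (Cpow g) (FArr (TF1 Y g) (NAt (m1 f) x)) (NAt (m1 g) (FObj (Z1 f) x))"
  by (rule Comp_cases[OF assms(1-3)])
    (use assms(4) in \<open>simp only: one_cells_I m.NAt_term_ntrans_subst K.Y.TF1_eq K.X.Dom_I K.X.Cod_I\<close>)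

text \<open>Coordinatewise an instance of \<open>eval_cell_comp\<close>; it will make the square
  attached to a 2-cell commute.\<close>

lemma k_factor:
  assumes "g \<in> Arr T" "x \<in> Obj (Dpow g)"
  shows "NAt (OCell k g) x = Comp (Cpow g) (NAt (m1 g) x) (NAt (e1 g) x)"
proof -
  obtain n ts where g: "set ts \<subseteq> trms \<Omega> n" "g = FArr I (n, ts)" using K.X.Arr_cases[OF assms(1)] .
  then have x: "x \<in> Obj (pow_cat A n)" using assms by simp
  have "t \<in> trms \<Omega> n" if "t \<in> set ts" for t using that g by auto
  then have "eval_cell K.X.UX K.Y.UX K.Uk x t = Comp A (eval_cell Z K.Y.UX d x t) (eval_cell K.X.UX Z c x t)"
    if "t \<in> set ts" for t
    using that by (intro eval_cell_comp[OF e.omega_cells_axioms m.omega_cells_axioms factor _ x]) auto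
  then show ?thesis
    using g x by (simp add: K.OCell_eq term_ntrans_def list_eq_iff_nth_eq)
qed

text \<open>Two 1-cells appear because the diagonal at a 2-cell lies between e at its source and m
  at its target, and two objects because naturality of the diagonals compares them along an
  arrow.\<close>

lemma e1_m1_orthogonal:
  assumes "g \<in> Arr T" "h \<in> Arr T" "Cod T g = Cod T h" "x \<in> Obj (Dpow g)" "y \<in> Obj (Dpow h)"
  shows "orthogonal (Cpow h) (NAt (e1 g) x) (NAt (m1 h) y)"
proof -
  obtain n ts where g: "set ts \<subseteq> trms \<Omega> n" "g = FArr I (n, ts)" using K.X.Arr_cases[OF assms(1)] .
  obtain p us where h: "set us \<subseteq> trms \<Omega> p" "h = FArr I (p, us)" using K.X.Arr_cases[OF assms(2)] .
  have x: "x \<in> Obj (pow_cat A n)" and y: "y \<in> Obj (pow_cat A p)" and len: "length ts = length us"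
    using assms g h by simp_all
  interpret e1: trans_between "pow_cat A n" "pow_cat A (length us)" "TF1 X g" "Z1 g" "e1 g"
    using e1_between[OF assms(1)] g len by simp
  interpret m1: trans_between "pow_cat A p" "pow_cat A (length us)" "Z1 h" "TF1 Y h" "m1 h"
    using m1_between[OF assms(2)] h by simp
  have "orthogonal (pow_cat A (length us)) (NAt (e1 g) x) (NAt (m1 h) y)"
  proof (rule orthogonal_pow_cat[OF K.X.A.category_axioms e1.at_in[OF x] m1.at_in[OF y]])
    fix i assume i: "i < length us"
    then have "ts ! i \<in> trms \<Omega> n" "us ! i \<in> trms \<Omega> p"
      using g h len by (auto simp: subset_iff)
    then have "eval_cell K.X.UX Z c x (ts ! i) \<in> E" "eval_cell Z K.Y.UX d y (us ! i) \<in> M"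
      using x y by (auto intro: S.eval_cell_E[OF e.omega_cells_axioms X_preserves c_E]
          S.eval_cell_M[OF m.omega_cells_axioms Y_preserves d_M] simp del: in_Obj_pow)
    then show "orthogonal A (NAt (e1 g) x ! i) (NAt (m1 h) y ! i)"
      using g h i len x y by (simp add: term_ntrans_def S.orth)
  qed
  then show ?thesis using h by simp
qed

text \<open>The two equations are the oplax naturality of e and of m at \<tau>, written in
  components. Every lift of the algebra has to satisfy them, so a unique solution gives existence
  and uniqueness at once.\<close>

definition lifts :: "'c \<Rightarrow> ('o list, 'm list, 'o list, 'm list) ntrans \<Rightarrow> bool" where
  "lifts \<tau> \<zeta> \<longleftrightarrow> trans_between (Dpow (Dom2 T \<tau>)) (Cpow (Dom2 T \<tau>)) (Z1 (Dom2 T \<tau>)) (Z1 (Cod2 T \<tau>)) \<zeta>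
    \<and> (\<forall>x\<in>Obj (Dpow (Dom2 T \<tau>)).
        Comp (Cpow (Dom2 T \<tau>)) (NAt \<zeta> x) (NAt (e1 (Dom2 T \<tau>)) x)
          = Comp (Cpow (Dom2 T \<tau>)) (NAt (e1 (Cod2 T \<tau>)) x) (NAt (TF2 X \<tau>) x)
        \<and> Comp (Cpow (Dom2 T \<tau>)) (NAt (TF2 Y \<tau>) x) (NAt (m1 (Dom2 T \<tau>)) x)
          = Comp (Cpow (Dom2 T \<tau>)) (NAt (m1 (Cod2 T \<tau>)) x) (NAt \<zeta> x))"

lemma cod_between:
  assumes "\<tau> \<in> Cell T"
  shows "trans_between (Dpow (Dom2 T \<tau>)) (Cpow (Dom2 T \<tau>)) (TF1 X (Cod2 T \<tau>)) (Z1 (Cod2 T \<tau>)) (e1 (Cod2 T \<tau>))"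
    and "trans_between (Dpow (Dom2 T \<tau>)) (Cpow (Dom2 T \<tau>)) (Z1 (Cod2 T \<tau>)) (TF1 Y (Cod2 T \<tau>)) (m1 (Cod2 T \<tau>))"
  using e1_between[of "Cod2 T \<tau>"] m1_between[of "Cod2 T \<tau>"] assms by simp_all

lemma dom_between:
  assumes "\<tau> \<in> Cell T"
  shows "trans_between (Dpow (Dom2 T \<tau>)) (Cpow (Dom2 T \<tau>)) (TF1 X (Dom2 T \<tau>)) (Z1 (Dom2 T \<tau>)) (e1 (Dom2 T \<tau>))"
    and "trans_between (Dpow (Dom2 T \<tau>)) (Cpow (Dom2 T \<tau>)) (Z1 (Dom2 T \<tau>)) (TF1 Y (Dom2 T \<tau>)) (m1 (Dom2 T \<tau>))"
  using e1_between[of "Dom2 T \<tau>"] m1_between[of "Dom2 T \<tau>"] assms by simp_all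

text \<open>The square commutes because both of its paths are composites with \<open>k\<close>, as
  \<open>k\<close> is m after e, and \<open>k\<close> is itself oplax natural at \<tau>.\<close>

lemma lifts_ex:
  assumes \<tau>: "\<tau> \<in> Cell T"
  shows "\<exists>\<zeta>. lifts \<tau> \<zeta>"
proof -
  let ?D = "Dpow (Dom2 T \<tau>)" and ?C = "Cpow (Dom2 T \<tau>)"
  have comm: "Comp ?C (NAt (m1 (Cod2 T \<tau>)) x) (Comp ?C (NAt (e1 (Cod2 T \<tau>)) x) (NAt (TF2 X \<tau>) x))
      = Comp ?C (NAt (TF2 Y \<tau>) x) (Comp ?C (NAt (m1 (Dom2 T \<tau>)) x) (NAt (e1 (Dom2 T \<tau>)) x))"
    if x: "x \<in> Obj ?D" for x
  proof -
    interpret e: trans_between ?D ?C "TF1 X (Cod2 T \<tau>)" "Z1 (Cod2 T \<tau>)" "e1 (Cod2 T \<tau>)" by (rule cod_between[OF \<tau>])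
    interpret m: trans_between ?D ?C "Z1 (Cod2 T \<tau>)" "TF1 Y (Cod2 T \<tau>)" "m1 (Cod2 T \<tau>)" by (rule cod_between[OF \<tau>])
    interpret X: trans_between ?D ?C "TF1 X (Dom2 T \<tau>)" "TF1 X (Cod2 T \<tau>)" "TF2 X \<tau>" by (rule K.X.TF2_between[OF \<tau>])
    have "Comp ?C (NAt (m1 (Cod2 T \<tau>)) x) (Comp ?C (NAt (e1 (Cod2 T \<tau>)) x) (NAt (TF2 X \<tau>) x))
        = Comp ?C (NAt (OCell k (Cod2 T \<tau>)) x) (NAt (TF2 X \<tau>) x)"
      using x k_factor[of "Cod2 T \<tau>" x] \<tau> by (simp add: e.F.C.Comp_assoc del: in_Obj_pow in_Arr_pow pow_cat_simps)
    also have "\<dots> = Comp ?C (NAt (TF2 Y \<tau>) x) (NAt (OCell k (Dom2 T \<tau>)) x)"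
      by (rule K.NAt_OCell_natural[OF \<tau> x, symmetric])
    finally show ?thesis using k_factor[of "Dom2 T \<tau>" x] x \<tau> by (simp del: in_Obj_pow pow_cat_simps)
  qed
  have orth: "orthogonal ?C (NAt (e1 (Dom2 T \<tau>)) x) (NAt (m1 (Cod2 T \<tau>)) y)" if "x \<in> Obj ?D" "y \<in> Obj ?D" for x y
    using e1_m1_orthogonal[of "Dom2 T \<tau>" "Cod2 T \<tau>" x y] that \<tau> by (simp del: in_Obj_pow)
  show ?thesis
    by (rule natural_diagonal[OF dom_between[OF \<tau>] cod_between[OF \<tau>] K.X.TF2_between[OF \<tau>]
          K.Y.TF2_between[OF \<tau>] comm orth])
      (auto simp: lifts_def simp del: in_Obj_pow pow_cat_simps)
qed

lemma lifts_unique: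
  assumes \<tau>: "\<tau> \<in> Cell T" and "lifts \<tau> \<zeta>" "lifts \<tau> \<zeta>'"
  shows "\<zeta> = \<zeta>'"
proof (rule trans_between_orthogonal_eq[OF dom_between(1)[OF \<tau>] cod_between(2)[OF \<tau>]])
  fix x assume x: "x \<in> Obj (Dpow (Dom2 T \<tau>))"
  show "orthogonal (Cpow (Dom2 T \<tau>)) (NAt (e1 (Dom2 T \<tau>)) x) (NAt (m1 (Cod2 T \<tau>)) x)"
    using e1_m1_orthogonal[of "Dom2 T \<tau>" "Cod2 T \<tau>" x x] x \<tau> by (simp del: in_Obj_pow)
qed (use assms in \<open>simp_all add: lifts_def del: in_Obj_pow pow_cat_simps\<close>)

text \<open>The choice is determined: by \<open>lifts_unique\<close> there is only one
  candidate.\<close>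

definition Z2 :: "'c \<Rightarrow> ('o list, 'm list, 'o list, 'm list) ntrans" where
  "Z2 \<tau> = (SOME \<zeta>. lifts \<tau> \<zeta>)"

lemma lifts_Z2: "\<tau> \<in> Cell T \<Longrightarrow> lifts \<tau> (Z2 \<tau>)"
  unfolding Z2_def by (rule someI_ex[OF lifts_ex])

text \<open>Each law for the values at 2-cells is reduced to checking that the expected value
  satisfies the two equations of \<open>lifts\<close>.\<close>

lemma Z2_eqI: "\<lbrakk>\<tau> \<in> Cell T; lifts \<tau> \<zeta>\<rbrakk> \<Longrightarrow> Z2 \<tau> = \<zeta>"
  by (rule lifts_unique[OF _ lifts_Z2])

lemma Z2_between: "\<tau> \<in> Cell T \<Longrightarrow>
    trans_between (Dpow (Dom2 T \<tau>)) (Cpow (Dom2 T \<tau>)) (Z1 (Dom2 T \<tau>)) (Z1 (Cod2 T \<tau>)) (Z2 \<tau>)"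
  using lifts_Z2 unfolding lifts_def by blast

lemma Z2_e: "\<lbrakk>\<tau> \<in> Cell T; x \<in> Obj (Dpow (Dom2 T \<tau>))\<rbrakk> \<Longrightarrow>
    Comp (Cpow (Dom2 T \<tau>)) (NAt (Z2 \<tau>) x) (NAt (e1 (Dom2 T \<tau>)) x)
      = Comp (Cpow (Dom2 T \<tau>)) (NAt (e1 (Cod2 T \<tau>)) x) (NAt (TF2 X \<tau>) x)"
  using lifts_Z2 unfolding lifts_def by blast

lemma Z2_m: "\<lbrakk>\<tau> \<in> Cell T; x \<in> Obj (Dpow (Dom2 T \<tau>))\<rbrakk> \<Longrightarrow>
    Comp (Cpow (Dom2 T \<tau>)) (NAt (TF2 Y \<tau>) x) (NAt (m1 (Dom2 T \<tau>)) x)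
      = Comp (Cpow (Dom2 T \<tau>)) (NAt (m1 (Cod2 T \<tau>)) x) (NAt (Z2 \<tau>) x)"
  using lifts_Z2 unfolding lifts_def by blast

section \<open>Functoriality of the values at 2-cells\<close>

lemma Z2_Id2:
  assumes g: "g \<in> Arr T"
  shows "Z2 (Id2 T g) = id_ntrans (Z1 g)"
proof (rule Z2_eqI)
  interpret e: trans_between "Dpow g" "Cpow g" "TF1 X g" "Z1 g" "e1 g" by (rule e1_between[OF g])
  interpret m: trans_between "Dpow g" "Cpow g" "Z1 g" "TF1 Y g" "m1 g" by (rule m1_between[OF g])
  have "Comp (Cpow g) (NAt (id_ntrans (Z1 g)) x) (NAt (e1 g) x) = NAt (e1 g) x"
    "Comp (Cpow g) (NAt (e1 g) x) (NAt (id_ntrans (TF1 X g)) x) = NAt (e1 g) x"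
    "Comp (Cpow g) (NAt (id_ntrans (TF1 Y g)) x) (NAt (m1 g) x) = NAt (m1 g) x"
    "Comp (Cpow g) (NAt (m1 g) x) (NAt (id_ntrans (Z1 g)) x) = NAt (m1 g) x"
    if "x \<in> Obj (Dpow g)" for x
    using that e.F.C.Comp_Id_left[of "NAt (e1 g) x"] e.F.C.Comp_Id_right[of "NAt (e1 g) x"]
      e.F.C.Comp_Id_left[of "NAt (m1 g) x"] e.F.C.Comp_Id_right[of "NAt (m1 g) x"]
    by (simp_all del: in_Obj_pow in_Arr_pow pow_cat_simps)
  then show "lifts (Id2 T g) (id_ntrans (Z1 g))"
    using g by (simp add: lifts_def trans_between_id_ntrans Z1_between K.X.TF2_Id2 K.Y.TF2_Id2
        del: id_ntrans_simps(3) in_Obj_pow pow_cat_simps)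
qed (use g in simp)

lemma Z2_VComp:
  assumes \<tau>: "\<tau> \<in> Cell T" and \<sigma>: "\<sigma> \<in> Cell T" and eq: "Dom2 T \<sigma> = Cod2 T \<tau>"
  shows "Z2 (VComp T \<sigma> \<tau>) = vcomp_ntrans (Z2 \<sigma>) (Z2 \<tau>)"
proof (rule Z2_eqI)
  let ?D = "Dpow (Dom2 T \<tau>)" and ?C = "Cpow (Dom2 T \<tau>)"
  have bd: "Dpow (Cod2 T \<tau>) = ?D" "Cpow (Cod2 T \<tau>) = ?C" using \<tau> by simp_all
  \<comment> \<open>\<open>D\<close>, \<open>M\<close> and \<open>C\<close> hold the components of e
    and m at the source, the middle and the target of the vertical composite; \<open>X\<close>,
    \<open>Y\<close> and \<open>Z\<close> hold the values of the three algebras at the two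
    2-cells.\<close>
  note D = dom_between[OF \<tau>] note M = cod_between[OF \<tau>] note C = cod_between[OF \<sigma>, unfolded eq bd]
  note X = K.X.TF2_between[OF \<tau>] K.X.TF2_between[OF \<sigma>, unfolded eq bd]
  note Y = K.Y.TF2_between[OF \<tau>] K.Y.TF2_between[OF \<sigma>, unfolded eq bd]
  note Z = Z2_between[OF \<tau>] Z2_between[OF \<sigma>, unfolded eq bd]
  have "Comp ?C (NAt (vcomp_ntrans (Z2 \<sigma>) (Z2 \<tau>)) x) (NAt (e1 (Dom2 T \<tau>)) x)
      = Comp ?C (NAt (e1 (Cod2 T \<sigma>)) x) (NAt (vcomp_ntrans (TF2 X \<sigma>) (TF2 X \<tau>)) x)"
    "Comp ?C (NAt (vcomp_ntrans (TF2 Y \<sigma>) (TF2 Y \<tau>)) x) (NAt (m1 (Dom2 T \<tau>)) x)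
      = Comp ?C (NAt (m1 (Cod2 T \<sigma>)) x) (NAt (vcomp_ntrans (Z2 \<sigma>) (Z2 \<tau>)) x)" if x: "x \<in> Obj ?D" for x
    using Z2_e[OF \<sigma>, unfolded eq bd] Z2_m[OF \<sigma>, unfolded eq bd]
    by (intro vcomp_square[OF D(1) M(1) C(1) X(1) Z(1) X(2) Z(2) x] vcomp_square[OF D(2) M(2) C(2) Z(1) Y(1) Z(2) Y(2) x]
        Z2_e[OF \<tau> x] Z2_m[OF \<tau> x] x; simp only: x)+
  then show "lifts (VComp T \<sigma> \<tau>) (vcomp_ntrans (Z2 \<sigma>) (Z2 \<tau>))"
    using \<tau> \<sigma> eq trans_between_vcomp_ntrans[OF Z]
    by (simp add: lifts_def K.X.TF2_VComp K.Y.TF2_VComp del: vcomp_ntrans_simps(3) in_Obj_pow pow_cat_simps)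
qed (use \<tau> \<sigma> eq in simp)

lemma Z2_HComp:
  assumes \<tau>: "\<tau> \<in> Cell T" and \<sigma>: "\<sigma> \<in> Cell T" and eq: "Dom T (Dom2 T \<sigma>) = Cod T (Dom2 T \<tau>)"
  shows "Z2 (HComp T \<sigma> \<tau>) = hcomp_ntrans (Z2 \<sigma>) (Z2 \<tau>)"
proof (rule Z2_eqI)
  let ?D = "Dpow (Dom2 T \<tau>)" and ?C = "Cpow (Dom2 T \<tau>)" and ?B = "Cpow (Dom2 T \<sigma>)"
  have bd: "Dpow (Dom2 T \<sigma>) = ?C" using eq by simp
  note D = dom_between[OF \<tau>] dom_between[OF \<sigma>, unfolded bd]
  note C = cod_between[OF \<tau>] cod_between[OF \<sigma>, unfolded bd]
  note X = K.X.TF2_between[OF \<tau>] K.X.TF2_between[OF \<sigma>, unfolded eq]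
  note Y = K.Y.TF2_between[OF \<tau>] K.Y.TF2_between[OF \<sigma>, unfolded eq]
  note Z = Z2_between[OF \<tau>] Z2_between[OF \<sigma>, unfolded bd]
  \<comment> \<open>The composition law splits e and m at composite 1-cells, which brings the
    required equations into the form of \<open>hcomp_square\<close>.\<close>
  have comps: "NAt (e1 (Comp T (Dom2 T \<sigma>) (Dom2 T \<tau>))) x
      = Comp ?B (FArr (Z1 (Dom2 T \<sigma>)) (NAt (e1 (Dom2 T \<tau>)) x)) (NAt (e1 (Dom2 T \<sigma>)) (FObj (TF1 X (Dom2 T \<tau>)) x))"
    "NAt (e1 (Comp T (Cod2 T \<sigma>) (Cod2 T \<tau>))) x
      = Comp ?B (FArr (Z1 (Cod2 T \<sigma>)) (NAt (e1 (Cod2 T \<tau>)) x)) (NAt (e1 (Cod2 T \<sigma>)) (FObj (TF1 X (Cod2 T \<tau>)) x))"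
    "NAt (m1 (Comp T (Dom2 T \<sigma>) (Dom2 T \<tau>))) x
      = Comp ?B (FArr (TF1 Y (Dom2 T \<sigma>)) (NAt (m1 (Dom2 T \<tau>)) x)) (NAt (m1 (Dom2 T \<sigma>)) (FObj (Z1 (Dom2 T \<tau>)) x))"
    "NAt (m1 (Comp T (Cod2 T \<sigma>) (Cod2 T \<tau>))) x
      = Comp ?B (FArr (TF1 Y (Cod2 T \<sigma>)) (NAt (m1 (Cod2 T \<tau>)) x)) (NAt (m1 (Cod2 T \<sigma>)) (FObj (Z1 (Cod2 T \<tau>)) x))"
    if "x \<in> Obj ?D" for x
    using that \<tau> \<sigma> eq by (simp_all add: e1_Comp m1_Comp del: in_Obj_pow pow_cat_simps)
  have "Comp ?B (NAt (hcomp_ntrans (Z2 \<sigma>) (Z2 \<tau>)) x) (NAt (e1 (Comp T (Dom2 T \<sigma>) (Dom2 T \<tau>))) x)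
      = Comp ?B (NAt (e1 (Comp T (Cod2 T \<sigma>) (Cod2 T \<tau>))) x) (NAt (hcomp_ntrans (TF2 X \<sigma>) (TF2 X \<tau>)) x)"
    if x: "x \<in> Obj ?D" for x
    unfolding comps[OF x]
    by (rule hcomp_square[OF D(1) C(1) X(1) Z(1) D(3) C(3) X(2) Z(2) x Z2_e[OF \<tau> x] Z2_e[OF \<sigma>, unfolded bd]])
  moreover have "Comp ?B (NAt (hcomp_ntrans (TF2 Y \<sigma>) (TF2 Y \<tau>)) x) (NAt (m1 (Comp T (Dom2 T \<sigma>) (Dom2 T \<tau>))) x)
      = Comp ?B (NAt (m1 (Comp T (Cod2 T \<sigma>) (Cod2 T \<tau>))) x) (NAt (hcomp_ntrans (Z2 \<sigma>) (Z2 \<tau>)) x)"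
    if x: "x \<in> Obj ?D" for x
    unfolding comps[OF x]
    by (rule hcomp_square[OF D(2) C(2) Z(1) Y(1) D(4) C(4) Z(2) Y(2) x Z2_m[OF \<tau> x] Z2_m[OF \<sigma>, unfolded bd]])
  ultimately show "lifts (HComp T \<sigma> \<tau>) (hcomp_ntrans (Z2 \<sigma>) (Z2 \<tau>))"
    using \<tau> \<sigma> eq trans_between_hcomp_ntrans[OF Z]
    by (simp add: lifts_def K.X.TF2_HComp K.Y.TF2_HComp Z1_Comp del: hcomp_ntrans_simps(3) in_Obj_pow pow_cat_simps)
qed (use \<tau> \<sigma> eq in simp)

section \<open>The lifted algebra and the lifted morphisms\<close>

definition Zt :: "('a, 'c, 'o, 'm) model" where
  "Zt = \<lparr>TF0 = pow_cat A, TF1 = restrict Z1 (Arr T), TF2 = restrict Z2 (Cell T)\<rparr>"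

lemma Zt_simps [simp]:
  "TF0 Zt = pow_cat A" "g \<in> Arr T \<Longrightarrow> TF1 Zt g = Z1 g" "\<tau> \<in> Cell T \<Longrightarrow> TF2 Zt \<tau> = Z2 \<tau>"
  by (simp_all add: Zt_def)

lemma algebra_Zt: "algebra_on T J A Zt"
proof -
  \<comment> \<open>That \<open>Cat2\<close> is a 2-category is read off from the given model: being
    a 2-functor into \<open>Cat2\<close> includes it.\<close>
  have Cat2: "two_category (Cat2 :: (('o list, 'm list) cat, _, _) two_cat)" "two_category T"
    using K.X.two_functor_X unfolding two_functor_def by simp_all
  have Z: "cat_functor (Z1 g)" "FDom (Z1 g) = Dpow g" "FCod (Z1 g) = Cpow g" if "g \<in> Arr T" for g
    using Z1_between[OF that] by (simp_all add: functor_between_def)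
  have Z': "nat_transf (Z2 \<tau>)" "NDom (Z2 \<tau>) = Z1 (Dom2 T \<tau>)" "NCod (Z2 \<tau>) = Z1 (Cod2 T \<tau>)" if "\<tau> \<in> Cell T" for \<tau>
    using Z2_between[OF that] by (simp_all add: trans_between_def)
  have "two_functor T Cat2 Zt"
    unfolding two_functor_def
  proof (intro conjI Cat2)
    show "cat_functor \<lparr>FDom = underlying_cat T, FCod = underlying_cat Cat2, FObj = TF0 Zt, FArr = TF1 Zt\<rparr>"
      by (rule functor_between.ftor, rule functor_betweenI[OF K.X.T1.category_axioms K.X.X1.C.category_axioms])
        (simp_all add: Z Z1_Id Z1_Comp category_pow_cat K.X.A.category_axioms, simp_all add: Zt_def)
    show "cat_functor \<lparr>FDom = vert_cat T, FCod = vert_cat Cat2, FObj = TF1 Zt, FArr = TF2 Zt\<rparr>"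
      by (rule functor_between.ftor, rule functor_betweenI[OF K.X.T2.category_axioms K.X.X2.C.category_axioms])
        (simp_all add: Z Z' Z2_Id2 Z2_VComp, simp_all add: Zt_def)
    show "cat_functor \<lparr>FDom = horiz_cat T, FCod = horiz_cat Cat2, FObj = TF0 Zt, FArr = TF2 Zt\<rparr>"
      by (rule functor_between.ftor, rule functor_betweenI[OF K.X.T3.category_axioms K.X.X3.C.category_axioms])
        (simp_all add: Z Z' Z2_Id2 Z1_Id Z2_HComp category_pow_cat K.X.A.category_axioms, simp_all add: Zt_def)
  qed
  moreover have "TF1 Zt (TF1 J (fin_proj n i)) = comp_ftor (unary_ftor A) (proj_ftor A n i)" if i: "i < n" for n i
  proof -
    have "TF1 Zt (TF1 J (fin_proj n i)) = term_ftor Z n [Var i]" using i by (simp add: K.X.proj_eq)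
    \<comment> \<open>The evaluation of a variable does not involve the operations, so the condition
      on projections can be borrowed from \<open>X\<close>.\<close>
    also have "\<dots> = term_ftor K.X.UX n [Var i]" by (simp add: term_ftor_def)
    also have "\<dots> = comp_ftor (unary_ftor A) (proj_ftor A n i)"
      using K.X.TF1_eq[of "[Var i]" n] K.X.TF1_proj[OF i] i by (simp add: K.X.proj_eq)
    finally show ?thesis .
  qed
  ultimately show ?thesis by (simp add: algebra_on_def K.X.A.category_axioms)
qed

sublocale Zt: two_algebra \<Omega> T J I A Zt
  by unfold_locales (rule algebra_Zt)

lemma forget_Zt:
  assumes "AOp Z \<in> extensional (Sigma UNIV \<Omega>)"
  shows "forget_alg \<Omega> I A Zt = Z"
proof -
  have "AOp (forget_alg \<Omega> I A Zt) = AOp Z"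
  proof (rule extensionalityI[OF _ assms])
    show "AOp (forget_alg \<Omega> I A Zt) \<in> extensional (Sigma UNIV \<Omega>)" by (simp add: forget_alg_def)
    fix p assume "p \<in> Sigma UNIV \<Omega>"
    then obtain n f where p: "p = (n, f)" and f: "f \<in> \<Omega> n" by auto
    show "AOp (forget_alg \<Omega> I A Zt) p = AOp Z p"
      using f e.Q.term_ftor_Op[OF f] unfolding p by (simp add: Zt.AOp_UX op_cell_def)
  qed
  then show ?thesis by (simp add: forget_alg_def)
qed

definition et :: "('a, 'o, 'm) model_map" where
  "et = \<lparr>OAt = \<lambda>n. id_ftor (pow_cat A n), OCell = restrict e1 (Arr T)\<rparr>"

definition mt :: "('a, 'o, 'm) model_map" where
  "mt = \<lparr>OAt = \<lambda>n. id_ftor (pow_cat A n), OCell = restrict m1 (Arr T)\<rparr>"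

text \<open>The composition law is \<open>e1_Comp\<close>, and naturality at 2-cells holds by
  construction, as one of the two equations that define \<open>Z2\<close>.\<close>

sublocale et: oplax_over_id \<Omega> T J I A X Zt et
proof (rule oplax_over_idI[OF K.X.two_algebra_axioms Zt.two_algebra_axioms])
  fix n and as :: "nat list" assume as: "set as \<subseteq> {..<n}"
  then have "set (map Var as) \<subseteq> trms \<Omega> n" by simp
  then show "OCell et (TF1 J (n, as)) = id_ntrans (TF1 X (TF1 J (n, as)))"
    using as by (simp only: K.X.J_eq K.X.TF1_eq et_def oplax.simps restrict_apply K.X.I_in if_True one_cells_I
        e.term_ntrans_Var)
qed (simp_all add: et_def e1_between e1_Comp Z2_e del: in_Obj_pow pow_cat_simps)

sublocale mt: oplax_over_id \<Omega> T J I A Zt Y mt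
proof (rule oplax_over_idI[OF Zt.two_algebra_axioms K.Y.two_algebra_axioms])
  fix n and as :: "nat list" assume as: "set as \<subseteq> {..<n}"
  then have "set (map Var as) \<subseteq> trms \<Omega> n" by simp
  then show "OCell mt (TF1 J (n, as)) = id_ntrans (TF1 Zt (TF1 J (n, as)))"
    using as by (simp only: K.X.J_eq Zt_simps mt_def oplax.simps restrict_apply K.X.I_in if_True one_cells_I
        m.term_ntrans_Var)
qed (simp_all add: mt_def m1_between m1_Comp Z2_m del: in_Obj_pow pow_cat_simps)

lemma forget_et:
  assumes "c \<in> extensional (Sigma UNIV \<Omega>)"
  shows "forget_map \<Omega> I A A et = \<lparr>MFun = id_ftor A, MCell = c\<rparr>"
proof -
  have "et.Uk = c"
  proof (rule extensionalityI[OF _ assms])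
    show "et.Uk \<in> extensional (Sigma UNIV \<Omega>)" by (simp add: forget_map_def)
    fix p assume "p \<in> Sigma UNIV \<Omega>"
    then obtain n f where p: "p = (n, f)" and f: "f \<in> \<Omega> n" by auto
    have "OCell et (op_cell I n f) = term_ntrans K.X.UX Z c n [Op f (map Var [0..<n])]"
      using f by (simp add: et_def op_cell_def)
    then show "et.Uk p = c p"
      unfolding p et.Uk_eq[OF f] by (simp only: e.term_ntrans_Op[OF f])
  qed
  then show ?thesis using et.MFun_forget by simp
qed

lemma forget_mt:
  assumes "d \<in> extensional (Sigma UNIV \<Omega>)"
  shows "forget_map \<Omega> I A A mt = \<lparr>MFun = id_ftor A, MCell = d\<rparr>"
proof -
  have "mt.Uk = d"
  proof (rule extensionalityI[OF _ assms])
    show "mt.Uk \<in> extensional (Sigma UNIV \<Omega>)" by (simp add: forget_map_def)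
    fix p assume "p \<in> Sigma UNIV \<Omega>"
    then obtain n f where p: "p = (n, f)" and f: "f \<in> \<Omega> n" by auto
    have "OCell mt (op_cell I n f) = term_ntrans Z K.Y.UX d n [Op f (map Var [0..<n])]"
      using f by (simp add: mt_def op_cell_def)
    then show "mt.Uk p = d p"
      unfolding p mt.Uk_eq[OF f] by (simp only: m.term_ntrans_Op[OF f])
  qed
  then show ?thesis using mt.MFun_forget by simp
qed

text \<open>At 1-cells freeness leaves no choice for any of the three. At a 2-cell, naturality of
  \<open>e'\<close> and \<open>m'\<close> says that the value of \<open>Z'\<close> satisfies
  \<open>lifts\<close>, which has one solution. Extensionality turns agreement on carriers into
  equality.\<close>

lemma lift_unique:
  assumes "two_algebra \<Omega> T J I A Z'" "oplax_over_id \<Omega> T J I A X Z' e'" "oplax_over_id \<Omega> T J I A Z' Y m'"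
    and Z': "forget_alg \<Omega> I A Z' = Z" and e': "MCell (forget_map \<Omega> I A A e') = c"
    and m': "MCell (forget_map \<Omega> I A A m') = d"
  shows "Z' = Zt \<and> e' = et \<and> m' = mt"
proof -
  interpret Z': two_algebra \<Omega> T J I A Z' by fact
  interpret e': oplax_over_id \<Omega> T J I A X Z' e' by fact
  interpret m': oplax_over_id \<Omega> T J I A Z' Y m' by fact
  have TF1: "TF1 Z' g = Z1 g" and OCell_e: "OCell e' g = e1 g" and OCell_m: "OCell m' g = m1 g" if "g \<in> Arr T" for g
    using that by (rule K.X.Arr_cases, simp add: Z'.TF1_eq e'.OCell_eq m'.OCell_eq Z' e' m')+
  have TF2: "TF2 Z' \<tau> = Z2 \<tau>" if \<tau>: "\<tau> \<in> Cell T" for \<tau>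
    using \<tau> Z'.TF2_between[OF \<tau>] e'.NAt_OCell_natural[OF \<tau>] m'.NAt_OCell_natural[OF \<tau>]
    by (intro Z2_eqI[symmetric]) (simp_all add: lifts_def TF1 OCell_e OCell_m del: in_Obj_pow pow_cat_simps)
  have "TF0 Z' = TF0 Zt" by (simp add: fun_eq_iff)
  moreover have "TF1 Z' = TF1 Zt"
    by (rule extensionalityI[OF Z'.TF1_ext Zt.TF1_ext]) (simp add: TF1)
  moreover have "TF2 Z' = TF2 Zt"
    by (rule extensionalityI[OF Z'.TF2_ext Zt.TF2_ext]) (simp add: TF2)
  moreover have "OCell e' = OCell et"
    by (rule extensionalityI[OF e'.OCell_ext et.OCell_ext]) (simp add: OCell_e et_def)
  moreover have "OCell m' = OCell mt"
    by (rule extensionalityI[OF m'.OCell_ext mt.OCell_ext]) (simp add: OCell_m mt_def)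
  ultimately show ?thesis
    using e'.OAt_fun m'.OAt_fun by (simp add: et_def mt_def Zt_def)
qed

end

text \<open>Factorisations are not canonical, so the second half quantifies over every choice of
  pointwise factorisations at the operations; the first half guarantees that such choices
  exist.\<close>

theorem theorem1p30:
  fixes \<Omega> :: "nat \<Rightarrow> 'f set"
    and T :: "(nat, 'a, 'c) two_cat"
    and J :: "('a, 'c) theory_map"
    and I :: "('f, 'a) free_iso"
    and A :: "('o, 'm) cat"
    and X Y :: "('a, 'c, 'o, 'm) model"
    and k :: "('a, 'o, 'm) model_map"
    and E M :: "'m set"
  defines "UX \<equiv> forget_alg \<Omega> I A X"
    and "UY \<equiv> forget_alg \<Omega> I A Y"
    and "Uk \<equiv> forget_map \<Omega> I A A k"
  assumes "lawvere_2theory T J"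
    and "underlying_free \<Omega> T J I"
    and "algebra_on T J A X"
    and "algebra_on T J A Y"
    and "oplax_morphism T J X Y k"
    and "over_identity A k"
    and "orthogonal_factorisation_system A E M"
    and "\<And>n f. f \<in> \<Omega> n \<Longrightarrow> preserves_pointwise n (AOp UX (n, f)) E"
    and "\<And>n f. f \<in> \<Omega> n \<Longrightarrow> preserves_pointwise n (AOp UY (n, f)) M"
  shows "(\<forall>n. \<forall>f\<in>\<Omega> n.
            nat_transf (MCell Uk (n, f))
            \<and> NDom (MCell Uk (n, f)) = AOp UX (n, f) \<and> NCod (MCell Uk (n, f)) = AOp UY (n, f)
            \<and> (\<exists>Z e m. pointwise_factorisation E M (MCell Uk (n, f)) Z e m))
    \<and> (\<forall>Zop eop mop.
        (\<forall>n. \<forall>f\<in>\<Omega> n.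
          pointwise_factorisation E M (MCell Uk (n, f)) (Zop (n, f)) (eop (n, f)) (mop (n, f)))
        \<longrightarrow> (let Z = \<lparr>ACarrier = A, AOp = restrict Zop (Sigma UNIV \<Omega>)\<rparr>;
                e = \<lparr>MFun = id_ftor A, MCell = restrict eop (Sigma UNIV \<Omega>)\<rparr>;
                m = \<lparr>MFun = id_ftor A, MCell = restrict mop (Sigma UNIV \<Omega>)\<rparr>
             in omega_algebra \<Omega> Z \<and> omega_oplax_morphism \<Omega> UX Z e \<and> omega_oplax_morphism \<Omega> Z UY m
              \<and> (\<exists>!(Z', e', m').
                    algebra_on T J A Z'
                    \<and> oplax_morphism T J X Z' e' \<and> over_identity A e'
                    \<and> oplax_morphism T J Z' Y m' \<and> over_identity A m'
                    \<and> forget_alg \<Omega> I A Z' = Z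
                    \<and> forget_map \<Omega> I A A e' = e
                    \<and> forget_map \<Omega> I A A m' = m)))"
proof -
  interpret K: oplax_over_id \<Omega> T J I A X Y k
    using assms(4-9)
    by (simp add: oplax_over_id_def oplax_over_id_axioms_def two_algebra_def two_algebra_axioms_def
        free_2theory_def)
  interpret S: factorisation_system A E M
    using assms(10)
    by (simp add: factorisation_system_def factorisation_system_axioms_def K.X.A.category_axioms)
  have part1: "nat_transf (MCell Uk (n, f)) \<and> NDom (MCell Uk (n, f)) = AOp UX (n, f)
      \<and> NCod (MCell Uk (n, f)) = AOp UY (n, f)
      \<and> (\<exists>Z e m. pointwise_factorisation E M (MCell Uk (n, f)) Z e m)" if f: "f \<in> \<Omega> n" for n f
    using K.Uk_between[OF f] S.pointwise_factorisation_ex[OF K.Uk_between[OF f]]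
    unfolding UX_def UY_def Uk_def by (simp add: trans_between_def)
  have part2: "let Z = \<lparr>ACarrier = A, AOp = restrict Zop (Sigma UNIV \<Omega>)\<rparr>;
                e = \<lparr>MFun = id_ftor A, MCell = restrict eop (Sigma UNIV \<Omega>)\<rparr>;
                m = \<lparr>MFun = id_ftor A, MCell = restrict mop (Sigma UNIV \<Omega>)\<rparr>
             in omega_algebra \<Omega> Z \<and> omega_oplax_morphism \<Omega> UX Z e \<and> omega_oplax_morphism \<Omega> Z UY m
              \<and> (\<exists>!(Z', e', m').
                    algebra_on T J A Z'
                    \<and> oplax_morphism T J X Z' e' \<and> over_identity A e'
                    \<and> oplax_morphism T J Z' Y m' \<and> over_identity A m'
                    \<and> forget_alg \<Omega> I A Z' = Z
                    \<and> forget_map \<Omega> I A A e' = e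
                    \<and> forget_map \<Omega> I A A m' = m)"
    if pf: "\<forall>n. \<forall>f\<in>\<Omega> n. pointwise_factorisation E M (MCell Uk (n, f)) (Zop (n, f)) (eop (n, f)) (mop (n, f))"
    for Zop eop mop
  proof -
    define Z where "Z = \<lparr>ACarrier = A, AOp = restrict Zop (Sigma UNIV \<Omega>)\<rparr>"
    define c where "c = restrict eop (Sigma UNIV \<Omega>)"
    define d where "d = restrict mop (Sigma UNIV \<Omega>)"
    have pf: "pointwise_factorisation E M (K.Uk (n, f)) (AOp Z (n, f)) (c (n, f)) (d (n, f))" if "f \<in> \<Omega> n" for n f
      using pf that by (simp add: Z_def c_def d_def Uk_def)
    have c: "trans_between (pow_cat A n) A (AOp K.X.UX (n, f)) (AOp Z (n, f)) (c (n, f))" if f: "f \<in> \<Omega> n" for n f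
      using pf[OF f] K.Uk_between[OF f] by (simp add: pointwise_factorisation_def trans_between_def)
    \<comment> \<open>The boundary of \<open>Z\<close> is extracted from \<open>c\<close>, whose
      source is known, because \<open>trans_between\<close> for \<open>d\<close> asks for the
      boundary of its source, which is \<open>Z\<close>.\<close>
    have Z: "functor_between (pow_cat A n) A (AOp Z (n, f))" if f: "f \<in> \<Omega> n" for n f
    proof -
      interpret trans_between "pow_cat A n" A "AOp K.X.UX (n, f)" "AOp Z (n, f)" "c (n, f)" by (rule c[OF f])
      show ?thesis by (rule G.functor_between_axioms)
    qed
    have d: "trans_between (pow_cat A n) A (AOp Z (n, f)) (AOp K.Y.UX (n, f)) (d (n, f))" if f: "f \<in> \<Omega> n" for n f
      using pf[OF f] K.Uk_between[OF f] Z[OF f]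
      by (simp add: pointwise_factorisation_def trans_between_def functor_between_def)
    have "omega_algebra \<Omega> Z"
      using Z by (auto simp: omega_algebra_def functor_between_def K.X.A.category_axioms Z_def)
    then interpret Z: omega_alg_on \<Omega> A Z by unfold_locales (simp_all add: Z_def)
    interpret F: factorised_morphism \<Omega> T J I A X Y k E M Z c d
    proof (intro factorised_morphism.intro factorised_morphism_axioms.intro omega_cells.intro
        omega_cells_axioms.intro K.oplax_over_id_axioms S.factorisation_system_axioms K.X.UX.omega_alg_on_axioms
        K.Y.UX.omega_alg_on_axioms Z.omega_alg_on_axioms c d)
      fix n f assume f: "f \<in> \<Omega> n"
      show "preserves_pointwise n (AOp K.X.UX (n, f)) E" "preserves_pointwise n (AOp K.Y.UX (n, f)) M"
        using assms(11,12) f unfolding UX_def UY_def by simp_all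
      show "pointwise_in E (c (n, f))" "pointwise_in M (d (n, f))"
        using pf[OF f] by (simp_all add: pointwise_factorisation_def)
      fix xs assume "xs \<in> Obj (pow_cat A n)"
      moreover have "vcomp_ntrans (d (n, f)) (c (n, f)) = K.Uk (n, f)"
        using pf[OF f] by (simp add: pointwise_factorisation_def)
      moreover have "FDom (NDom (c (n, f))) = pow_cat A n" "FCod (NDom (c (n, f))) = A"
        using c[OF f] by (simp_all add: trans_between_def)
      ultimately show "NAt (K.Uk (n, f)) xs = Comp A (NAt (d (n, f)) xs) (NAt (c (n, f)) xs)"
        by (metis vcomp_ntrans_simps(3))
    qed
    have ext: "AOp Z \<in> extensional (Sigma UNIV \<Omega>)" "c \<in> extensional (Sigma UNIV \<Omega>)" "d \<in> extensional (Sigma UNIV \<Omega>)"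
      by (simp_all add: Z_def c_def d_def)
    have "\<exists>!(Z', e', m'). algebra_on T J A Z'
        \<and> oplax_morphism T J X Z' e' \<and> over_identity A e'
        \<and> oplax_morphism T J Z' Y m' \<and> over_identity A m'
        \<and> forget_alg \<Omega> I A Z' = Z
        \<and> forget_map \<Omega> I A A e' = \<lparr>MFun = id_ftor A, MCell = c\<rparr>
        \<and> forget_map \<Omega> I A A m' = \<lparr>MFun = id_ftor A, MCell = d\<rparr>" (is "\<exists>!p. ?P p")
    proof (rule ex1I[of _ "(F.Zt, F.et, F.mt)"])
      show "?P (F.Zt, F.et, F.mt)"
        by (simp add: F.algebra_Zt F.et.morphism F.et.over_id F.mt.morphism F.mt.over_id F.forget_Zt F.forget_et
            F.forget_mt ext)
      fix p assume p: "?P p"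
      obtain Z' e' m' where p_eq: "p = (Z', e', m')" by (cases p)
      have Z': "two_algebra \<Omega> T J I A Z'"
        using p K.X.free_2theory_axioms by (simp add: p_eq two_algebra_def two_algebra_axioms_def)
      then have "oplax_over_id \<Omega> T J I A X Z' e'" "oplax_over_id \<Omega> T J I A Z' Y m'"
        using p K.X.two_algebra_axioms K.Y.two_algebra_axioms
        by (simp_all add: p_eq oplax_over_id_def oplax_over_id_axioms_def)
      then show "p = (F.Zt, F.et, F.mt)"
        using F.lift_unique[OF Z'] p by (simp add: p_eq)
    qed
    then show ?thesis
      using Z.alg F.e.omega_oplax_morphism_id[OF ext(2)] F.m.omega_oplax_morphism_id[OF ext(3)]
      unfolding Let_def UX_def UY_def Z_def c_def d_def by blast
  qed
  show ?thesis using part1 part2 by blast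
qed

end
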